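(* Let $p\in(1,\infty]$ and $\beta,\gamma\in(0,\eta)$. Then the following hold true: (i) if $f\in(\mathcal G^\eta_0(\beta,\gamma))'$ belongs to $H^{+,p}(X)$, then there exists $\widetilde f\in L^p(X)$ such that $$\langle f,\varphi\rangle=\int_X\widetilde f(x)\varphi(x)\,d\mu(x)\qquad\text{for any }\varphi\in\mathcal G^\eta_0(\beta,\gamma),$$ and $\|\widetilde f\|_{L^p(X)}\le\|f\|_{H^{+,p}(X)}$; (ii) any $f\in L^p(X)$ induces a distribution on $\mathcal G^\eta_0(\beta,\gamma)$ by $\varphi\mapsto\int_X f\varphi\,d\mu$, still denoted by $f$, such that $f\in H^{*,p}(X)$ and $\|f\|_{H^{*,p}(X)}\le C\|f\|_{L^p(X)}$, where $C$ is a positive constant independent of $f$. Consequently, for any fixed $\theta\in(0,\infty)$, $H^{+,p}(X)=H^p_\theta(X)=H^{*,p}(X)=L^p(X)$ in the sense of both representing the same distributions and equivalent norms.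
   Context: Setting. $(X,d,\mu)$ is a space of homogeneous type: $d:X\times X\to[0,\infty)$ is a quasi-metric ($d(x,y)=0$ iff $x=y$; $d(x,y)=d(y,x)$; $d(x,z)\le A_0[d(x,y)+d(y,z)]$ with $A_0\in[1,\infty)$); $B(x,r):=\{y\in X:\ d(x,y)<r\}$; $\tau B$ is the ball with the same center and $\tau$ times the radius; $\mu$ is a non-negative measure with $\mu(2B)\le C_{(\mu)}\mu(B)$ for all balls $B$, and $\omega:=\log_2C_{(\mu)}$ is the upper dimension. Standing assumptions: for each $x$ the balls $\{B(x,r)\}_{r>0}$ form a basis of open neighborhoods of $x$; $\mu$ is Borel regular (open sets are measurable and every set $A$ is contained in a Borel set $E$ with $\mu(A)=\mu(E)$); $\mu(B(x,r))\in(0,\infty)$; $\mu(\{x\})=0$ for all $x$; $\operatorname{diam}X=\infty$ (hence $\mu(X)=\infty$). Write $V_r(x):=\mu(B(x,r))$, $V(x,y):=\mu(B(x,d(x,y)))$. Dyadic points and the index $\eta$. Fix a small $\delta\in(0,1)$ (e.g. $\delta\le(2A_0)^{-10}$), constants $0<c_0\le C_0$ with $12A_0^3C_0\delta\le c_0$, and nested countable index sets $\mathcal A_k\subset\mathcal A_{k+1}$ ($k\in\mathbb Z$) with points $z_\alpha^k$ ($\alpha\in\mathcal A_k$, $z^{k+1}_\alpha=z^k_\alpha$ for $\alpha\in\mathcal A_k$) satisfying $d(z^k_\alpha,z^k_\beta)\ge c_0\delta^k$ for $\alpha\ne\beta$ and $\min_\alpha d(x,z^k_\alpha)\le C_0\delta^k$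 for all $x\in X$. Put $\mathcal G_k:=\mathcal A_{k+1}\setminus\mathcal A_k$, $y^k_\alpha:=z^{k+1}_\alpha$ for $\alpha\in\mathcal G_k$, and $\mathcal Y^k:=\{y^k_\alpha\}_{\alpha\in\mathcal G_k}$. The number $\eta\in(0,1)$ is the smoothness index of the Auscher–Hytönen construction: for this $\eta$, every ball $B(x,r)$ admits a function $\psi$ with $\chi_{B(x,r)}\le\psi\le\chi_{B(x,2A_0r)}$ and $|\psi(y)-\psi(z)|\le C[d(y,z)/r]^\eta$, and $L^2(X)$ has an orthonormal basis $\{\psi^k_\alpha:k\in\mathbb Z,\alpha\in\mathcal G_k\}$ of (real-valued) wavelets with $\int_X\psi^k_\alpha\,d\mu=0$, $|\psi^k_\alpha(x)|\le CV_{\delta^k}(y^k_\alpha)^{-1/2}\exp\{-\nu[d(y^k_\alpha,x)/\delta^k]^a\}$, and $|\psi^k_\alpha(x)-\psi^k_\alpha(y)|\le C[d(x,y)/\delta^k]^\eta V_{\delta^k}(y^k_\alpha)^{-1/2}\exp\{-\nu[d(y^k_\alpha,x)/\delta^k]^a\}$ if $d(x,y)\le\delta^k$, for some constants $C,\nu\in(0,\infty)$, $a\in(0,1]$. Test functions and distributions. For $x_1\in X$, $r\in(0,\infty)$, $\beta\in(0,1]$, $\gamma\in(0,\infty)$, $\mathcal G(x_1,r,\beta,\gamma)$ is the set of functions $f$ on $X$ for which there is $C>0$ with: (size) $|f(x)|\le C\frac1{V_r(x_1)+V(x_1,x)}\big[\frac r{r+d(x_1,x)}\big]^\gamma$ for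 all $x$; (regularity) $|f(x)-f(y)|\le C\big[\frac{d(x,y)}{r+d(x_1,x)}\big]^\beta\frac1{V_r(x_1)+V(x_1,x)}\big[\frac r{r+d(x_1,x)}\big]^\gamma$ whenever $d(x,y)\le(2A_0)^{-1}[r+d(x_1,x)]$; its norm is the infimum of such $C$. Fix $x_0\in X$ and set $\mathcal G(\beta,\gamma):=\mathcal G(x_0,1,\beta,\gamma)$. For $\beta,\gamma\in(0,\eta)$, $\mathcal G^\eta_0(\beta,\gamma)$ is the closure of $\mathcal G(\eta,\eta)$ in $\mathcal G(\beta,\gamma)$, with the norm of $\mathcal G(\beta,\gamma)$; $(\mathcal G^\eta_0(\beta,\gamma))'$ is its dual with the weak-$*$ topology. Approximations of the identity. Put $E_k(x,y):=[V_{\delta^k}(x)V_{\delta^k}(y)]^{-1/2}\exp\{-\nu[d(x,y)/\delta^k]^a\}$ and $F_k(x,y):=\exp\{-\nu[\max\{d(x,\mathcal Y^k),d(y,\mathcal Y^k)\}/\delta^k]^a\}$. An $\exp$-ATI is a sequence $\{Q_k\}_{k\in\mathbb Z}$ of bounded integral operators on $L^2(X)$ with $\sum_kQ_k=I$ in $L^2(X)$ whose kernels satisfy, for some $C,\nu\in(0,\infty)$, $a\in(0,1]$: (a) $|Q_k(x,y)|\le CE_k(x,y)F_k(x,y)$; (b) if $d(x,x')\le\delta^k$, $|Q_k(x,y)-Q_k(x',y)|+|Q_k(y,x)-Q_k(y,x')|\le C[d(x,x')/\delta^k]^\eta E_k(x,y)F_k(x,y)$; (c) if $d(x,x')\le\delta^k$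 and $d(y,y')\le\delta^k$, $|[Q_k(x,y)-Q_k(x',y)]-[Q_k(x,y')-Q_k(x',y')]|\le C[d(x,x')/\delta^k]^\eta[d(y,y')/\delta^k]^\eta E_k(x,y)F_k(x,y)$; (d) $\int_XQ_k(x,y)\,d\mu(y)=0=\int_XQ_k(x,y)\,d\mu(x)$. A $1$-$\exp$-ATI is a sequence $\{P_k\}_{k\in\mathbb Z}$ of bounded operators on $L^2(X)$ whose kernels satisfy (a), (b), (c) without the factor $F_k$, with $\int_XP_k(x,y)\,d\mu(y)=1=\int_XP_k(y,x)\,d\mu(y)$, and such that $\{P_k-P_{k-1}\}_{k\in\mathbb Z}$ is an $\exp$-ATI (such sequences are known to exist). Maximal functions and Hardy spaces. Fix a $1$-$\exp$-ATI $\{P_k\}$. For $f\in(\mathcal G^\eta_0(\beta,\gamma))'$ let $P_kf(x):=\langle f,P_k(x,\cdot)\rangle$, $\mathcal M^+(f)(x):=\sup_{k\in\mathbb Z}|P_kf(x)|$, $\mathcal M_\theta(f)(x):=\sup_{k\in\mathbb Z}\sup_{y\in B(x,\theta\delta^k)}|P_kf(y)|$ and $f^*(x):=\sup\{|\langle f,\varphi\rangle|:\varphi\in\mathcal G^\eta_0(\beta,\gamma),\ \|\varphi\|_{\mathcal G(x,r_0,\beta,\gamma)}\le1\text{ for some }r_0\in(0,\infty)\}$. $H^{+,p}(X)$, $H^p_\theta(X)$, $H^{*,p}(X)$ are the sets of $f\in(\mathcal G^\eta_0(\beta,\gamma))'$ with $\|f\|_{H^{+,p}(X)}:=\|\mathcal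 M^+(f)\|_{L^p(X)}<\infty$, $\|f\|_{H^p_\theta(X)}:=\|\mathcal M_\theta(f)\|_{L^p(X)}<\infty$, $\|f\|_{H^{*,p}(X)}:=\|f^*\|_{L^p(X)}<\infty$, respectively. *)

theory Defs
  imports "HOL-Analysis.Analysis" "HOL-Probability.Essential_Supremum"
begin

section \<open>Spaces of homogeneous type\<close>

text \<open>The underlying space $X$ is the whole type \<open>'a\<close>; its topology is the one of the class
  \<^class>\<open>topological_space\<close>, tied to the quasi-metric \<open>d\<close> in \<open>homogeneous_type_space\<close> below.\<close>

definition qball :: "('a \<Rightarrow> 'a \<Rightarrow> real) \<Rightarrow> 'a \<Rightarrow> real \<Rightarrow> 'a set" where
  "qball d x r = {y. d x y < r}"

definition Vol :: "('a \<Rightarrow> 'a \<Rightarrow> real) \<Rightarrow> 'a measure \<Rightarrow> real \<Rightarrow> 'a \<Rightarrow> real" where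
  "Vol d \<mu> r x = measure \<mu> (qball d x r)"

definition Vol2 :: "('a \<Rightarrow> 'a \<Rightarrow> real) \<Rightarrow> 'a measure \<Rightarrow> 'a \<Rightarrow> 'a \<Rightarrow> real" where
  "Vol2 d \<mu> x y = measure \<mu> (qball d x (d x y))"

definition quasi_metric :: "('a \<Rightarrow> 'a \<Rightarrow> real) \<Rightarrow> real \<Rightarrow> bool" where
  "quasi_metric d A0 \<longleftrightarrow> 1 \<le> A0 \<and>
     (\<forall>x y. 0 \<le> d x y) \<and> (\<forall>x y. d x y = 0 \<longleftrightarrow> x = y) \<and> (\<forall>x y. d x y = d y x) \<and>
     (\<forall>x y z. d x z \<le> A0 * (d x y + d y z))"

text \<open>Borel regularity concerns arbitrary subsets of $X$, whose measure is the outer measure.\<close>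

definition homogeneous_type_space ::
  "('a::topological_space \<Rightarrow> 'a \<Rightarrow> real) \<Rightarrow> 'a measure \<Rightarrow> real \<Rightarrow> real \<Rightarrow> bool" where
  "homogeneous_type_space d \<mu> A0 C\<mu> \<longleftrightarrow>
     quasi_metric d A0 \<and>
     (\<forall>x. \<forall>r>0. open (qball d x r)) \<and>
     (\<forall>x U. open U \<and> x \<in> U \<longrightarrow> (\<exists>r>0. qball d x r \<subseteq> U)) \<and>
     space \<mu> = UNIV \<and> sets borel \<subseteq> sets \<mu> \<and>
     (\<forall>A. \<exists>E\<in>sets borel. A \<subseteq> E \<and> outer_measure_of \<mu> A = emeasure \<mu> E) \<and>
     (\<forall>x. \<forall>r>0. 0 < emeasure \<mu> (qball d x r) \<and> emeasure \<mu> (qball d x r) < \<infinity>) \<and>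
     (\<forall>x. \<forall>r>0. emeasure \<mu> (qball d x (2 * r)) \<le> ennreal C\<mu> * emeasure \<mu> (qball d x r)) \<and>
     (\<forall>x. emeasure \<mu> {x} = 0) \<and>
     (\<forall>R. \<exists>x y. R < d x y)"

section \<open>Lebesgue spaces\<close>

definition epowr :: "ennreal \<Rightarrow> real \<Rightarrow> ennreal" where
  "epowr t s = (if t = \<infinity> then \<infinity> else ennreal (enn2real t powr s))"

definition eLp_norm :: "'a measure \<Rightarrow> ennreal \<Rightarrow> ('a \<Rightarrow> ennreal) \<Rightarrow> ennreal" where
  "eLp_norm \<mu> p h =
     (if p = \<infinity> then esssup \<mu> h
      else epowr (\<integral>\<^sup>+ x. epowr (h x) (enn2real p) \<partial>\<mu>) (1 / enn2real p))"

text \<open>The grand maximal function need not be measurable on a general space of homogeneous type.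
  Norms of maximal functions are therefore taken as upper norms; on measurable functions
  this is the usual norm, see \<open>upper_Lp_norm_measurable\<close>.\<close>

definition upper_Lp_norm :: "'a measure \<Rightarrow> ennreal \<Rightarrow> ('a \<Rightarrow> ennreal) \<Rightarrow> ennreal" where
  "upper_Lp_norm \<mu> p g =
     (INF h \<in> {h \<in> borel_measurable \<mu>. \<forall>x. g x \<le> h x}. eLp_norm \<mu> p h)"

lemma epowr_mono: "s \<le> t \<Longrightarrow> 0 \<le> a \<Longrightarrow> epowr s a \<le> epowr t a"
  unfolding epowr_def
  by (auto simp: top_unique less_top intro!: ennreal_leI powr_mono2 enn2real_mono)

lemma eLp_norm_mono:
  assumes "g \<in> borel_measurable \<mu>" "\<And>x. g x \<le> h x"
  shows "eLp_norm \<mu> p g \<le> eLp_norm \<mu> p h"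
  using assms unfolding eLp_norm_def
  by (auto intro!: epowr_mono nn_integral_mono esssup_mono)

lemma upper_Lp_norm_measurable:
  assumes "g \<in> borel_measurable \<mu>"
  shows "upper_Lp_norm \<mu> p g = eLp_norm \<mu> p g"
  unfolding upper_Lp_norm_def
  by (rule antisym) (use assms in \<open>auto intro!: INF_lower2[of g] INF_greatest eLp_norm_mono\<close>)

definition Lp_norm :: "'a measure \<Rightarrow> ennreal \<Rightarrow> ('a \<Rightarrow> complex) \<Rightarrow> ennreal" where
  "Lp_norm \<mu> p f = eLp_norm \<mu> p (\<lambda>x. ennreal (cmod (f x)))"

definition Lp_space :: "'a measure \<Rightarrow> ennreal \<Rightarrow> ('a \<Rightarrow> complex) set" where
  "Lp_space \<mu> p = {f \<in> borel_measurable \<mu>. Lp_norm \<mu> p f < \<infinity>}"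

section \<open>Dyadic points and the smoothness index\<close>

definition dyadic_points ::
  "('a \<Rightarrow> 'a \<Rightarrow> real) \<Rightarrow> real \<Rightarrow> real \<Rightarrow> real \<Rightarrow> real \<Rightarrow> (int \<Rightarrow> 'i set) \<Rightarrow> (int \<Rightarrow> 'i \<Rightarrow> 'a) \<Rightarrow> bool"
where
  "dyadic_points d A0 \<delta> c0 C0 \<A> z \<longleftrightarrow>
     0 < \<delta> \<and> \<delta> < 1 \<and> 0 < c0 \<and> c0 \<le> C0 \<and> 12 * A0 ^ 3 * C0 * \<delta> \<le> c0 \<and>
     (\<forall>k. countable (\<A> k)) \<and> (\<forall>k. \<A> k \<subseteq> \<A> (k + 1)) \<and>
     (\<forall>k. \<forall>\<alpha>\<in>\<A> k. z (k + 1) \<alpha> = z k \<alpha>) \<and>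
     (\<forall>k. \<forall>\<alpha>\<in>\<A> k. \<forall>\<beta>\<in>\<A> k. \<alpha> \<noteq> \<beta> \<longrightarrow> c0 * \<delta> powi k \<le> d (z k \<alpha>) (z k \<beta>)) \<and>
     (\<forall>k x. \<exists>\<alpha>\<in>\<A> k. d x (z k \<alpha>) \<le> C0 * \<delta> powi k)"

definition new_index :: "(int \<Rightarrow> 'i set) \<Rightarrow> int \<Rightarrow> 'i set" where
  "new_index \<A> k = \<A> (k + 1) - \<A> k"

definition ypt :: "(int \<Rightarrow> 'i \<Rightarrow> 'a) \<Rightarrow> int \<Rightarrow> 'i \<Rightarrow> 'a" where
  "ypt z k \<alpha> = z (k + 1) \<alpha>"

definition Ypts :: "(int \<Rightarrow> 'i set) \<Rightarrow> (int \<Rightarrow> 'i \<Rightarrow> 'a) \<Rightarrow> int \<Rightarrow> 'a set" where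
  "Ypts \<A> z k = ypt z k ` new_index \<A> k"

definition cutoff_index :: "('a \<Rightarrow> 'a \<Rightarrow> real) \<Rightarrow> real \<Rightarrow> real \<Rightarrow> bool" where
  "cutoff_index d A0 \<eta> \<longleftrightarrow>
     (\<exists>C>0. \<forall>x. \<forall>r>0. \<exists>\<psi> :: 'a \<Rightarrow> real.
        (\<forall>y. indicator (qball d x r) y \<le> \<psi> y \<and> \<psi> y \<le> indicator (qball d x (2 * A0 * r)) y) \<and>
        (\<forall>y y'. \<bar>\<psi> y - \<psi> y'\<bar> \<le> C * (d y y' / r) powr \<eta>))"

definition wavelet_index_set :: "(int \<Rightarrow> 'i set) \<Rightarrow> (int \<times> 'i) set" where
  "wavelet_index_set \<A> = {(k, \<alpha>). \<alpha> \<in> new_index \<A> k}"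

text \<open>Orthonormal basis of (complex) $L^2$, consisting of real-valued functions:
  an orthonormal family whose finite linear combinations are dense.\<close>

definition L2_orthonormal_basis ::
  "'a measure \<Rightarrow> 'j set \<Rightarrow> ('j \<Rightarrow> 'a \<Rightarrow> real) \<Rightarrow> bool" where
  "L2_orthonormal_basis \<mu> J \<psi> \<longleftrightarrow>
     (\<forall>j\<in>J. (\<lambda>x. complex_of_real (\<psi> j x)) \<in> Lp_space \<mu> 2) \<and>
     (\<forall>i\<in>J. \<forall>j\<in>J. (LINT x|\<mu>. \<psi> i x * \<psi> j x) = (if i = j then 1 else 0)) \<and>
     (\<forall>f\<in>Lp_space \<mu> 2. \<forall>\<epsilon>>0. \<exists>F c. finite F \<and> F \<subseteq> J \<and>
        Lp_norm \<mu> 2 (\<lambda>x. f x - (\<Sum>j\<in>F. c j * complex_of_real (\<psi> j x))) < ennreal \<epsilon>)"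

definition wavelet_index ::
  "('a \<Rightarrow> 'a \<Rightarrow> real) \<Rightarrow> 'a measure \<Rightarrow> real \<Rightarrow> (int \<Rightarrow> 'i set) \<Rightarrow> (int \<Rightarrow> 'i \<Rightarrow> 'a) \<Rightarrow> real \<Rightarrow> bool"
where
  "wavelet_index d \<mu> \<delta> \<A> z \<eta> \<longleftrightarrow>
     (\<exists>(\<psi> :: int \<times> 'i \<Rightarrow> 'a \<Rightarrow> real) C \<nu> a.
        0 < C \<and> 0 < \<nu> \<and> 0 < a \<and> a \<le> 1 \<and>
        L2_orthonormal_basis \<mu> (wavelet_index_set \<A>) \<psi> \<and>
        (\<forall>k. \<forall>\<alpha>\<in>new_index \<A> k.
           integrable \<mu> (\<psi> (k, \<alpha>)) \<and> (LINT x|\<mu>. \<psi> (k, \<alpha>) x) = 0 \<and>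
           (\<forall>x. \<bar>\<psi> (k, \<alpha>) x\<bar> \<le> C * Vol d \<mu> (\<delta> powi k) (ypt z k \<alpha>) powr (- (1/2)) *
                  exp (- \<nu> * (d (ypt z k \<alpha>) x / \<delta> powi k) powr a)) \<and>
           (\<forall>x y. d x y \<le> \<delta> powi k \<longrightarrow>
                \<bar>\<psi> (k, \<alpha>) x - \<psi> (k, \<alpha>) y\<bar> \<le>
                  C * (d x y / \<delta> powi k) powr \<eta> * Vol d \<mu> (\<delta> powi k) (ypt z k \<alpha>) powr (- (1/2)) *
                  exp (- \<nu> * (d (ypt z k \<alpha>) x / \<delta> powi k) powr a))))"

definition smoothness_index ::
  "('a \<Rightarrow> 'a \<Rightarrow> real) \<Rightarrow> 'a measure \<Rightarrow> real \<Rightarrow> real \<Rightarrow> (int \<Rightarrow> 'i set) \<Rightarrow> (int \<Rightarrow> 'i \<Rightarrow> 'a) \<Rightarrow> real \<Rightarrow> bool"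
where
  "smoothness_index d \<mu> A0 \<delta> \<A> z \<eta> \<longleftrightarrow>
     0 < \<eta> \<and> \<eta> < 1 \<and> cutoff_index d A0 \<eta> \<and> wavelet_index d \<mu> \<delta> \<A> z \<eta>"

section \<open>Test functions and distributions\<close>

definition test_size :: "('a \<Rightarrow> 'a \<Rightarrow> real) \<Rightarrow> 'a measure \<Rightarrow> 'a \<Rightarrow> real \<Rightarrow> real \<Rightarrow> 'a \<Rightarrow> real" where
  "test_size d \<mu> x1 r \<gamma> x =
     1 / (Vol d \<mu> r x1 + Vol2 d \<mu> x1 x) * (r / (r + d x1 x)) powr \<gamma>"

definition test_bound ::
  "('a \<Rightarrow> 'a \<Rightarrow> real) \<Rightarrow> 'a measure \<Rightarrow> real \<Rightarrow> 'a \<Rightarrow> real \<Rightarrow> real \<Rightarrow> real \<Rightarrow> ('a \<Rightarrow> complex) \<Rightarrow> real \<Rightarrow> bool"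
where
  "test_bound d \<mu> A0 x1 r \<beta> \<gamma> f C \<longleftrightarrow>
     (\<forall>x. cmod (f x) \<le> C * test_size d \<mu> x1 r \<gamma> x) \<and>
     (\<forall>x y. d x y \<le> inverse (2 * A0) * (r + d x1 x) \<longrightarrow>
        cmod (f x - f y) \<le> C * (d x y / (r + d x1 x)) powr \<beta> * test_size d \<mu> x1 r \<gamma> x)"

definition test_space ::
  "('a \<Rightarrow> 'a \<Rightarrow> real) \<Rightarrow> 'a measure \<Rightarrow> real \<Rightarrow> 'a \<Rightarrow> real \<Rightarrow> real \<Rightarrow> real \<Rightarrow> ('a \<Rightarrow> complex) set" where
  "test_space d \<mu> A0 x1 r \<beta> \<gamma> = {f. \<exists>C>0. test_bound d \<mu> A0 x1 r \<beta> \<gamma> f C}"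

definition test_norm ::
  "('a \<Rightarrow> 'a \<Rightarrow> real) \<Rightarrow> 'a measure \<Rightarrow> real \<Rightarrow> 'a \<Rightarrow> real \<Rightarrow> real \<Rightarrow> real \<Rightarrow> ('a \<Rightarrow> complex) \<Rightarrow> real" where
  "test_norm d \<mu> A0 x1 r \<beta> \<gamma> f = Inf {C. 0 < C \<and> test_bound d \<mu> A0 x1 r \<beta> \<gamma> f C}"

text \<open>The closure of $\mathcal G(\eta,\eta)$ in $\mathcal G(\beta,\gamma)$.\<close>

definition test0 ::
  "('a \<Rightarrow> 'a \<Rightarrow> real) \<Rightarrow> 'a measure \<Rightarrow> real \<Rightarrow> 'a \<Rightarrow> real \<Rightarrow> real \<Rightarrow> real \<Rightarrow> ('a \<Rightarrow> complex) set" where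
  "test0 d \<mu> A0 x0 \<eta> \<beta> \<gamma> =
     {f \<in> test_space d \<mu> A0 x0 1 \<beta> \<gamma>. \<forall>\<epsilon>>0.
        \<exists>g \<in> test_space d \<mu> A0 x0 1 \<eta> \<eta> \<inter> test_space d \<mu> A0 x0 1 \<beta> \<gamma>.
          test_norm d \<mu> A0 x0 1 \<beta> \<gamma> (\<lambda>x. f x - g x) < \<epsilon>}"

text \<open>The dual of \<open>test0\<close>: bounded complex-linear functionals, made unique as HOL functions
  by extensionality.\<close>

definition distributions ::
  "('a \<Rightarrow> 'a \<Rightarrow> real) \<Rightarrow> 'a measure \<Rightarrow> real \<Rightarrow> 'a \<Rightarrow> real \<Rightarrow> real \<Rightarrow> real \<Rightarrow>
   (('a \<Rightarrow> complex) \<Rightarrow> complex) set" where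
  "distributions d \<mu> A0 x0 \<eta> \<beta> \<gamma> =
     {\<Lambda> \<in> extensional (test0 d \<mu> A0 x0 \<eta> \<beta> \<gamma>).
        (\<forall>\<phi>\<in>test0 d \<mu> A0 x0 \<eta> \<beta> \<gamma>. \<forall>\<psi>\<in>test0 d \<mu> A0 x0 \<eta> \<beta> \<gamma>.
           \<Lambda> (\<lambda>x. \<phi> x + \<psi> x) = \<Lambda> \<phi> + \<Lambda> \<psi>) \<and>
        (\<forall>c. \<forall>\<phi>\<in>test0 d \<mu> A0 x0 \<eta> \<beta> \<gamma>. \<Lambda> (\<lambda>x. c * \<phi> x) = c * \<Lambda> \<phi>) \<and>
        (\<exists>C. \<forall>\<phi>\<in>test0 d \<mu> A0 x0 \<eta> \<beta> \<gamma>.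
           cmod (\<Lambda> \<phi>) \<le> C * test_norm d \<mu> A0 x0 1 \<beta> \<gamma> \<phi>)}"

definition induced_distribution ::
  "('a \<Rightarrow> 'a \<Rightarrow> real) \<Rightarrow> 'a measure \<Rightarrow> real \<Rightarrow> 'a \<Rightarrow> real \<Rightarrow> real \<Rightarrow> real \<Rightarrow>
   ('a \<Rightarrow> complex) \<Rightarrow> ('a \<Rightarrow> complex) \<Rightarrow> complex" where
  "induced_distribution d \<mu> A0 x0 \<eta> \<beta> \<gamma> f =
     (\<lambda>\<phi> \<in> test0 d \<mu> A0 x0 \<eta> \<beta> \<gamma>. LINT x|\<mu>. f x * \<phi> x)"

section \<open>Approximations of the identity with exponential decay\<close>

definition Eker ::
  "('a \<Rightarrow> 'a \<Rightarrow> real) \<Rightarrow> 'a measure \<Rightarrow> real \<Rightarrow> real \<Rightarrow> real \<Rightarrow> int \<Rightarrow> 'a \<Rightarrow> 'a \<Rightarrow> real" where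
  "Eker d \<mu> \<delta> \<nu> a k x y =
     (Vol d \<mu> (\<delta> powi k) x * Vol d \<mu> (\<delta> powi k) y) powr (- (1/2)) *
     exp (- \<nu> * (d x y / \<delta> powi k) powr a)"

text \<open>For empty \<open>Y\<close> the distance $d(x,Y)$ is infinite, so the exponential factor vanishes.\<close>

definition Fker ::
  "('a \<Rightarrow> 'a \<Rightarrow> real) \<Rightarrow> (int \<Rightarrow> 'a set) \<Rightarrow> real \<Rightarrow> real \<Rightarrow> real \<Rightarrow> int \<Rightarrow> 'a \<Rightarrow> 'a \<Rightarrow> real" where
  "Fker d Y \<delta> \<nu> a k x y =
     (if Y k = {} then 0
      else exp (- \<nu> * (max (INF u\<in>Y k. d x u) (INF u\<in>Y k. d y u) / \<delta> powi k) powr a))"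

definition ker_op :: "'a measure \<Rightarrow> ('a \<Rightarrow> 'a \<Rightarrow> complex) \<Rightarrow> ('a \<Rightarrow> complex) \<Rightarrow> 'a \<Rightarrow> complex" where
  "ker_op \<mu> K f x = (LINT y|\<mu>. K x y * f y)"

definition L2_bounded_kernel :: "'a measure \<Rightarrow> ('a \<Rightarrow> 'a \<Rightarrow> complex) \<Rightarrow> bool" where
  "L2_bounded_kernel \<mu> K \<longleftrightarrow>
     (\<exists>C::real. \<forall>f\<in>Lp_space \<mu> 2.
        (AE x in \<mu>. integrable \<mu> (\<lambda>y. K x y * f y)) \<and>
        ker_op \<mu> K f \<in> borel_measurable \<mu> \<and>
        Lp_norm \<mu> 2 (ker_op \<mu> K f) \<le> ennreal C * Lp_norm \<mu> 2 f)"

definition kernel_estimates ::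
  "('a \<Rightarrow> 'a \<Rightarrow> real) \<Rightarrow> real \<Rightarrow> real \<Rightarrow> (int \<Rightarrow> 'a \<Rightarrow> 'a \<Rightarrow> complex) \<Rightarrow> real \<Rightarrow>
   (int \<Rightarrow> 'a \<Rightarrow> 'a \<Rightarrow> real) \<Rightarrow> bool" where
  "kernel_estimates d \<delta> \<eta> Q C W \<longleftrightarrow>
     (\<forall>k x y. cmod (Q k x y) \<le> C * W k x y) \<and>
     (\<forall>k x x' y. d x x' \<le> \<delta> powi k \<longrightarrow>
        cmod (Q k x y - Q k x' y) + cmod (Q k y x - Q k y x')
          \<le> C * (d x x' / \<delta> powi k) powr \<eta> * W k x y) \<and>
     (\<forall>k x x' y y'. d x x' \<le> \<delta> powi k \<and> d y y' \<le> \<delta> powi k \<longrightarrow>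
        cmod ((Q k x y - Q k x' y) - (Q k x y' - Q k x' y'))
          \<le> C * (d x x' / \<delta> powi k) powr \<eta> * (d y y' / \<delta> powi k) powr \<eta> * W k x y)"

definition sum_to_identity :: "'a measure \<Rightarrow> (int \<Rightarrow> 'a \<Rightarrow> 'a \<Rightarrow> complex) \<Rightarrow> bool" where
  "sum_to_identity \<mu> Q \<longleftrightarrow>
     (\<forall>f\<in>Lp_space \<mu> 2.
        ((\<lambda>(M, N). Lp_norm \<mu> 2 (\<lambda>x. (\<Sum>k\<in>{- int M..int N}. ker_op \<mu> (Q k) f x) - f x))
           \<longlongrightarrow> 0) (sequentially \<times>\<^sub>F sequentially))"

definition exp_ATI ::
  "('a \<Rightarrow> 'a \<Rightarrow> real) \<Rightarrow> 'a measure \<Rightarrow> real \<Rightarrow> (int \<Rightarrow> 'a set) \<Rightarrow> real \<Rightarrow>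
   (int \<Rightarrow> 'a \<Rightarrow> 'a \<Rightarrow> complex) \<Rightarrow> bool" where
  "exp_ATI d \<mu> \<delta> Y \<eta> Q \<longleftrightarrow>
     (\<forall>k. L2_bounded_kernel \<mu> (Q k)) \<and> sum_to_identity \<mu> Q \<and>
     (\<exists>C \<nu> a. 0 < C \<and> 0 < \<nu> \<and> 0 < a \<and> a \<le> 1 \<and>
        kernel_estimates d \<delta> \<eta> Q C (\<lambda>k x y. Eker d \<mu> \<delta> \<nu> a k x y * Fker d Y \<delta> \<nu> a k x y)) \<and>
     (\<forall>k x. (LINT y|\<mu>. Q k x y) = 0) \<and> (\<forall>k y. (LINT x|\<mu>. Q k x y) = 0)"

definition one_exp_ATI ::
  "('a \<Rightarrow> 'a \<Rightarrow> real) \<Rightarrow> 'a measure \<Rightarrow> real \<Rightarrow> (int \<Rightarrow> 'a set) \<Rightarrow> real \<Rightarrow>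
   (int \<Rightarrow> 'a \<Rightarrow> 'a \<Rightarrow> complex) \<Rightarrow> bool" where
  "one_exp_ATI d \<mu> \<delta> Y \<eta> P \<longleftrightarrow>
     (\<forall>k. L2_bounded_kernel \<mu> (P k)) \<and>
     (\<exists>C \<nu> a. 0 < C \<and> 0 < \<nu> \<and> 0 < a \<and> a \<le> 1 \<and>
        kernel_estimates d \<delta> \<eta> P C (Eker d \<mu> \<delta> \<nu> a)) \<and>
     (\<forall>k x. (LINT y|\<mu>. P k x y) = 1) \<and> (\<forall>k x. (LINT y|\<mu>. P k y x) = 1) \<and>
     exp_ATI d \<mu> \<delta> Y \<eta> (\<lambda>k x y. P k x y - P (k - 1) x y)"

section \<open>Maximal functions and Hardy spaces\<close>

definition radial_max ::
  "(int \<Rightarrow> 'a \<Rightarrow> 'a \<Rightarrow> complex) \<Rightarrow> (('a \<Rightarrow> complex) \<Rightarrow> complex) \<Rightarrow> 'a \<Rightarrow> ennreal" where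
  "radial_max P \<Lambda> x = (SUP k. ennreal (cmod (\<Lambda> (P k x))))"

definition nontangential_max ::
  "('a \<Rightarrow> 'a \<Rightarrow> real) \<Rightarrow> real \<Rightarrow> (int \<Rightarrow> 'a \<Rightarrow> 'a \<Rightarrow> complex) \<Rightarrow> real \<Rightarrow>
   (('a \<Rightarrow> complex) \<Rightarrow> complex) \<Rightarrow> 'a \<Rightarrow> ennreal" where
  "nontangential_max d \<delta> P \<theta> \<Lambda> x =
     (SUP k. SUP y\<in>qball d x (\<theta> * \<delta> powi k). ennreal (cmod (\<Lambda> (P k y))))"

definition grand_max ::
  "('a \<Rightarrow> 'a \<Rightarrow> real) \<Rightarrow> 'a measure \<Rightarrow> real \<Rightarrow> 'a \<Rightarrow> real \<Rightarrow> real \<Rightarrow> real \<Rightarrow>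
   (('a \<Rightarrow> complex) \<Rightarrow> complex) \<Rightarrow> 'a \<Rightarrow> ennreal" where
  "grand_max d \<mu> A0 x0 \<eta> \<beta> \<gamma> \<Lambda> x =
     (SUP \<phi> \<in> {\<phi> \<in> test0 d \<mu> A0 x0 \<eta> \<beta> \<gamma>. \<exists>r>0. \<phi> \<in> test_space d \<mu> A0 x r \<beta> \<gamma> \<and>
                 test_norm d \<mu> A0 x r \<beta> \<gamma> \<phi> \<le> 1}.
        ennreal (cmod (\<Lambda> \<phi>)))"

text \<open>The Hardy space attached to a maximal operator \<open>M\<close> has norm
  \<open>upper_Lp_norm \<mu> p (M \<Lambda>)\<close>.\<close>

definition Hardy_space ::
  "(('a \<Rightarrow> complex) \<Rightarrow> complex) set \<Rightarrow> ((('a \<Rightarrow> complex) \<Rightarrow> complex) \<Rightarrow> 'a \<Rightarrow> ennreal) \<Rightarrow>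
   'a measure \<Rightarrow> ennreal \<Rightarrow> (('a \<Rightarrow> complex) \<Rightarrow> complex) set" where
  "Hardy_space \<D> M \<mu> p = {\<Lambda> \<in> \<D>. upper_Lp_norm \<mu> p (M \<Lambda>) < \<infinity>}"

end

theory Submission
  imports Defs
begin

text \<open>
  For \<open>f \<in> L\<^sup>p\<close> the pairing with a test function at scale \<open>r\<close> around \<open>x\<close> splits over dyadic annuli and is
  therefore at most a constant times the Hardy--Littlewood maximal function of \<open>f\<close> at \<open>x\<close>; this bounds the grand
  maximal function on \<open>L\<^sup>p\<close>. Only finite Vitali families are needed for the weak type estimate, since the dyadic
  points make every union of balls a countable one. The kernels \<open>P\<^sub>k(y, \<cdot>)\<close> are uniformly normalised test functions
  around each \<open>x\<close> with \<open>d(x, y) < \<theta>\<delta>\<^sup>k\<close>, so the grand maximal function dominates the other two.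

  Conversely, let \<open>h\<close> be the radial maximal function of a distribution \<open>\<Lambda>\<close>. The functions \<open>\<Lambda>(P\<^sub>k(x, \<cdot>))\<close> are bounded
  by \<open>h\<close>, hence their quotients by \<open>h\<close> have a weak-star cluster point \<open>g\<close> in the unit ball of \<open>L\<^sup>\<infinity>\<close>, obtained from
  Tychonoff's theorem and Radon--Nikodym. The function \<open>g h\<close> represents \<open>\<Lambda>\<close> and has norm at most that of \<open>h\<close>,
  without any appeal to duality of \<open>L\<^sup>p\<close>. Indeed, for boundedly supported Hoelder functions \<open>\<phi>\<close>, which are dense,
  \<open>\<Lambda>(\<integral> P\<^sub>k(x, \<cdot>) \<phi>(x) d\<mu>(x)) = \<integral> \<Lambda>(P\<^sub>k(x, \<cdot>)) \<phi>(x) d\<mu>(x)\<close> by finite Riemann sums, and the averages on the left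
  converge to \<open>\<phi>\<close> in \<open>\<G>(\<beta>, \<gamma>)\<close> because a uniform \<open>\<eta>\<close>-Hoelder bound interpolates with rapid decay of the error.
\<close>

section \<open>Volumes of balls in spaces of homogeneous type\<close>

text \<open>Each strict inequality in the hypotheses is spent once. The gap \<eta> - \<beta> pays
  for interpolation: a Hoelder bound of order \<eta> and a small size bound combine to a small bound
  of order \<beta>. The gap \<eta> - \<gamma> pays for truncation: outside a large ball the size
  factor of order \<eta> is a small multiple of the one of order \<gamma>. The condition p > 1 lets
  the sum over dyadic levels in the strong type estimate converge at its lower end. Norm equivalence
  also needs uniqueness, since the function produced from the distribution of \<open>f\<close> must
  be \<open>f\<close> again. Integrals against test functions determine a function because cutoff
  functions approximate open sets, open sets generate the Borel sets, and Borel regularity reaches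
  every measurable set. The four norms are then linked in a cycle: the L^p norm is at most the
  radial norm, which is at most the nontangential one, which is at most a multiple of the grand one,
  which the maximal theorem returns to the L^p norm.\<close>

locale hts =
  fixes d :: "'a::topological_space \<Rightarrow> 'a \<Rightarrow> real" and \<mu> :: "'a measure" and A0 C\<mu> :: real
  assumes hts: "homogeneous_type_space d \<mu> A0 C\<mu>"
begin

abbreviation "B \<equiv> qball d"
abbreviation "V \<equiv> Vol d \<mu>"

lemma A0_ge1: "1 \<le> A0"
  and d_nonneg [simp]: "0 \<le> d x y"
  and d_eq0 [simp]: "d x y = 0 \<longleftrightarrow> x = y"
  and d_tri: "d x z \<le> A0 * (d x y + d y z)"
  using hts by (simp_all add: homogeneous_type_space_def quasi_metric_def)

lemma d_self [simp]: "d x x = 0"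
  by simp

lemma d_sym: "d x y = d y x"
  using hts by (simp add: homogeneous_type_space_def quasi_metric_def)

lemma space_\<mu> [simp]: "space \<mu> = UNIV"
  and borel_sub: "sets borel \<subseteq> sets \<mu>"
  using hts by (simp_all add: homogeneous_type_space_def)

lemma ball_empty: "r \<le> 0 \<Longrightarrow> B x r = {}"
  using d_nonneg[of x] unfolding qball_def by (simp add: not_less order_trans[of r 0])

lemma open_ball: "open (B x r)"
proof (cases "r > 0")
  case False
  then have "B x r = {}" by (simp add: ball_empty)
  then show ?thesis by simp
qed (use hts in \<open>simp add: homogeneous_type_space_def\<close>)

lemma ball_in_open: "open U \<Longrightarrow> x \<in> U \<Longrightarrow> \<exists>r>0. B x r \<subseteq> U"
  using hts by (simp add: homogeneous_type_space_def)

lemma borel_hull: "\<exists>E\<in>sets borel. A \<subseteq> E \<and> outer_measure_of \<mu> A = emeasure \<mu> E"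
  using hts by (simp add: homogeneous_type_space_def)

lemma open_sets [measurable]: "open U \<Longrightarrow> U \<in> sets \<mu>"
  by (rule subsetD[OF borel_sub borel_open])

lemma ball_sets [measurable]: "B x r \<in> sets \<mu>"
  by (simp add: open_ball open_sets)

lemma borel_measurable_from_borel: "f \<in> borel_measurable borel \<Longrightarrow> f \<in> borel_measurable \<mu>"
  using measurable_mono[of borel borel borel \<mu>] borel_sub by auto

lemma emeasure_ball_pos: "r > 0 \<Longrightarrow> 0 < emeasure \<mu> (B x r)"
  and emeasure_ball_fin: "emeasure \<mu> (B x r) < \<infinity>"
  and emeasure_ball_double: "r > 0 \<Longrightarrow> emeasure \<mu> (B x (2 * r)) \<le> ennreal C\<mu> * emeasure \<mu> (B x r)"
proof -
  show "emeasure \<mu> (B x r) < \<infinity>"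
  proof (cases "r > 0")
    case False
    then have "B x r = {}" by (simp add: ball_empty)
    then show ?thesis by simp
  qed (use hts in \<open>simp add: homogeneous_type_space_def\<close>)
qed (use hts in \<open>simp_all add: homogeneous_type_space_def\<close>)

lemma emeasure_ball: "emeasure \<mu> (B x r) = ennreal (V r x)"
  unfolding Vol_def using emeasure_ball_fin[of x r] by (intro emeasure_eq_ennreal_measure) auto

lemma V_pos: "r > 0 \<Longrightarrow> 0 < V r x"
  using emeasure_ball_pos[of r x] emeasure_ball[of x r] by simp

lemma V_nonneg [simp]: "0 \<le> V r x"
  by (simp add: Vol_def)

lemma V2_eq: "Vol2 d \<mu> x y = V (d x y) x"
  by (simp add: Vol2_def Vol_def)

section \<open>Monotonicity and polynomial growth of ball volumes\<close>

lemma ball_mono: "r \<le> s \<Longrightarrow> B x r \<subseteq> B x s"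
  by (auto simp: qball_def)

lemma V_leI: "B x r \<subseteq> B y s \<Longrightarrow> V r x \<le> V s y"
  using emeasure_mono[of "B x r" "B y s" \<mu>] by (simp add: emeasure_ball)

lemma V_mono: "r \<le> s \<Longrightarrow> V r x \<le> V s x"
  by (intro V_leI ball_mono)

lemma V_double: "r > 0 \<Longrightarrow> V (2 * r) x \<le> C\<mu> * V r x" and C\<mu>_ge1: "1 \<le> C\<mu>"
proof -
  have *: "0 < C\<mu> \<and> V (2 * r) x \<le> C\<mu> * V r x" if "r > 0" for r x
  proof -
    have "ennreal (V (2*r) x) \<le> ennreal C\<mu> * ennreal (V r x)"
      using emeasure_ball_double[OF that, of x] by (simp add: emeasure_ball)
    moreover have "0 < V (2*r) x" using that by (simp add: V_pos)
    ultimately have "0 < C\<mu>"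
      by (metis ennreal_eq_0_iff le_zero_eq linorder_not_less mult_zero_left)
    with \<open>ennreal (V (2*r) x) \<le> _\<close> show ?thesis
      by (simp add: ennreal_mult[symmetric])
  qed
  then show "r > 0 \<Longrightarrow> V (2 * r) x \<le> C\<mu> * V r x" by blast
  have "V 1 x \<le> C\<mu> * V 1 x" for x
    using *[of 1 x] V_mono[of 1 2 x] by simp
  then show "1 \<le> C\<mu>" using V_pos[of 1] by (metis mult_le_cancel_right1 order.asym zero_less_one)
qed

text \<open>An integer in the role of the upper dimension \<open>\<omega> = log\<^sub>2 C\<^sub>\<mu>\<close>, so that only natural powers occur below.\<close>

definition dm :: nat where "dm = nat \<lceil>C\<mu>\<rceil>"

lemma C\<mu>_le: "C\<mu> \<le> 2 ^ dm"
proof -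
  have "C\<mu> \<le> real dm" unfolding dm_def by (metis of_nat_ceiling)
  also have "\<dots> \<le> 2 ^ dm" by (metis less_imp_le of_nat_less_two_power)
  finally show ?thesis .
qed

lemma V_pow2: "r > 0 \<Longrightarrow> V (2 ^ j * r) x \<le> (2 ^ j) ^ dm * V r x"
proof (induction j)
  case (Suc j)
  have "V (2 ^ Suc j * r) x = V (2 * (2 ^ j * r)) x" by (simp add: mult.assoc)
  also have "\<dots> \<le> C\<mu> * V (2 ^ j * r) x" using Suc.prems by (intro V_double) simp
  also have "\<dots> \<le> 2 ^ dm * V (2 ^ j * r) x" by (intro mult_right_mono C\<mu>_le) simp
  also have "\<dots> \<le> 2 ^ dm * ((2 ^ j) ^ dm * V r x)" using Suc by (intro mult_left_mono) auto
  also have "\<dots> = (2 ^ Suc j) ^ dm * V r x" by (simp add: power_mult_distrib)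
  finally show ?case .
qed simp

text \<open>Rounding \<open>t\<close> up to a power of two costs at most a factor 2, which is the 2
  in \<open>2 * t\<close>; then doubling is iterated.\<close>

lemma V_scale:
  assumes "1 \<le> t" "0 < r"
  shows "V (t * r) x \<le> (2 * t) ^ dm * V r x"
proof -
  define j where "j = nat \<lceil>log 2 t\<rceil>"
  have l: "0 \<le> log 2 t" using assms by simp
  have j1: "log 2 t \<le> real j" and j2: "real j \<le> log 2 t + 1"
    unfolding j_def using l by linarith+
  have t1: "t \<le> 2 ^ j" using j1 assms by (simp add: log_le_iff powr_realpow)
  have "2 powr (real j) \<le> 2 powr (log 2 t + 1)" using j2 by simp
  then have t2: "2 ^ j \<le> 2 * t" using assms by (simp add: powr_realpow powr_add)
  have "V (t * r) x \<le> V (2 ^ j * r) x" using t1 assms by (intro V_mono mult_right_mono) auto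
  also have "\<dots> \<le> (2 ^ j) ^ dm * V r x" using assms by (intro V_pow2)
  also have "\<dots> \<le> (2 * t) ^ dm * V r x" using t2 by (intro mult_right_mono power_mono) auto
  finally show ?thesis .
qed

text \<open>The ball around \<open>y\<close> lies in the ball around \<open>x\<close> of radius A0
  (d(x,y) + s). Adding \<open>r\<close> inside the bracket makes this radius at least
  \<open>r\<close>, so that \<open>V_scale\<close> applies for every \<open>s\<close>.\<close>

lemma V_comp:
  assumes "0 < r" "0 \<le> s"
  shows "V s y \<le> (2 * A0 * (1 + (d x y + s) / r)) ^ dm * V r x"
proof -
  let ?t = "A0 * (1 + (d x y + s) / r)"
  have "B y s \<subseteq> B x (?t * r)"
  proof
    fix w assume "w \<in> B y s"
    then have w: "d y w < s" by (simp add: qball_def)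
    have "d x w \<le> A0 * (d x y + d y w)" by (rule d_tri)
    also have "\<dots> < A0 * (d x y + s)" using w A0_ge1 by simp
    also have "\<dots> \<le> ?t * r" using assms A0_ge1 by (simp add: field_simps)
    finally show "w \<in> B x (?t * r)" by (simp add: qball_def)
  qed
  then have "V s y \<le> V (?t * r) x" by (rule V_leI)
  also have "1 * 1 \<le> ?t" using assms A0_ge1 by (intro mult_mono) auto
  then have "V (?t * r) x \<le> (2 * ?t) ^ dm * V r x" using assms by (intro V_scale) auto
  finally show ?thesis by (simp add: mult_ac)
qed

lemma sigma_finite: "sigma_finite_measure \<mu>"
proof
  \<comment> \<open>Any point can serve as the centre of the exhausting balls;
    \<open>undefined\<close> merely names one.\<close>
  have "\<exists>n::nat. y \<in> B undefined (real n)" for y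
    unfolding qball_def mem_Collect_eq by (rule reals_Archimedean2)
  then show "\<exists>A. countable A \<and> A \<subseteq> sets \<mu> \<and> \<Union> A = space \<mu> \<and> (\<forall>a\<in>A. emeasure \<mu> a \<noteq> \<infinity>)"
    using emeasure_ball_fin
    by (intro exI[of _ "range (\<lambda>n::nat. B undefined (real n))"]) (auto simp: less_top)
qed

sublocale sigma_finite_measure \<mu> by (rule sigma_finite)

text \<open>The topology is known only through quasi-metric balls, so continuity is checked on
  these. The constant may depend on the point because the regularity of test functions is local and
  weighted.\<close>

lemma continuous_hoelder:
  fixes f :: "'a \<Rightarrow> 'b::metric_space"
  assumes "0 < s" and h: "\<And>x. \<exists>\<rho>>0. \<exists>C. \<forall>y. d x y < \<rho> \<longrightarrow> dist (f x) (f y) \<le> C * d x y powr s"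
  shows "continuous_on UNIV f"
  unfolding continuous_on_topological
proof safe
  fix x U assume U: "open U" "f x \<in> U"
  then obtain e where e: "e > 0" "ball (f x) e \<subseteq> U" by (meson openE)
  obtain \<rho> C where r: "\<rho> > 0" and C: "\<And>y. d x y < \<rho> \<Longrightarrow> dist (f x) (f y) \<le> C * d x y powr s"
    using h by blast
  \<comment> \<open>Solves (|C| + 1) t^s = e; the summand 1 avoids a division by zero.\<close>
  define t where "t = (e / (\<bar>C\<bar> + 1)) powr (1/s)"
  have t: "t > 0" using e by (simp add: t_def)
  have "f y \<in> U" if "y \<in> B x (min \<rho> t)" for y
  proof -
    have y: "d x y < \<rho>" "d x y < t" using that by (auto simp: qball_def)
    have "d x y powr s < t powr s" using y \<open>0 < s\<close> by (intro powr_less_mono2) auto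
    also have "\<dots> = e / (\<bar>C\<bar> + 1)" using e \<open>0 < s\<close> by (simp add: t_def powr_powr)
    finally have "(\<bar>C\<bar> + 1) * d x y powr s < e" by (simp add: field_simps)
    moreover have "C * d x y powr s \<le> (\<bar>C\<bar> + 1) * d x y powr s" by (intro mult_right_mono) auto
    ultimately have "dist (f x) (f y) < e" using C[OF y(1)] by linarith
    then show ?thesis using e by auto
  qed
  then show "\<exists>A. open A \<and> x \<in> A \<and> (\<forall>y\<in>UNIV. y \<in> A \<longrightarrow> f y \<in> U)"
    using r t by (intro exI[of _ "B x (min \<rho> t)"]) (auto simp: open_ball, simp add: qball_def)
qed

lemma measurable_continuous:
  fixes f :: "'a \<Rightarrow> 'b::metric_space"
  shows "continuous_on UNIV f \<Longrightarrow> f \<in> borel_measurable \<mu>"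
  by (intro borel_measurable_from_borel borel_measurable_continuous_onI)

section \<open>Integrals of the size function over dyadic balls\<close>

definition size_const :: "real \<Rightarrow> real" where
  "size_const \<gamma> = C\<mu> / ((1/2) powr \<gamma> * (1 - (1/2) powr \<gamma>))"

lemma size_const_pos: "0 < \<gamma> \<Longrightarrow> 0 < size_const \<gamma>"
proof -
  assume "0 < \<gamma>"
  have "(1/2::real) powr \<gamma> < 1 powr \<gamma>" using \<open>0 < \<gamma>\<close> by (intro powr_less_mono2) auto
  then show ?thesis using C\<mu>_ge1 by (simp add: size_const_def)
qed

abbreviation "sz \<equiv> test_size d \<mu>"

lemma size_nonneg [simp]: "0 < r \<Longrightarrow> 0 \<le> sz x r \<gamma> y"
  by (simp add: test_size_def V2_eq)

lemma size_pos [simp]: "0 < r \<Longrightarrow> 0 < sz x r \<gamma> y"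
  using V_pos[of r x] V_nonneg[of "d x y" x] d_nonneg[of x y]
  unfolding test_size_def V2_eq
  by (intro mult_pos_pos divide_pos_pos add_pos_nonneg) (auto simp: add_nonneg_eq_0_iff)

lemma powr_size_le1: "0 < r \<Longrightarrow> 0 \<le> \<gamma> \<Longrightarrow> (r / (r + d x y)) powr \<gamma> \<le> 1"
  by (intro powr_le1) (auto simp: divide_le_eq_1 add_pos_nonneg)

text \<open>Take the first dyadic ball around \<open>x\<close> that contains \<open>y\<close>.
  Unless it is the smallest one, \<open>y\<close> lies outside the preceding ball, so one doubling
  bounds the volume of the chosen ball by V(x,y), and the decay factor is at most q^(j-1) with q =
  2^(-\<gamma>). Dividing by q turns this into q^j.\<close>

lemma size_dyadic:
  assumes "0 < r" "0 < \<gamma>"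
  shows "\<exists>j. d x y < 2 ^ j * r \<and> sz x r \<gamma> y \<le> C\<mu> / (1/2) powr \<gamma> * ((1/2) powr \<gamma>) ^ j / V (2 ^ j * r) x"
proof -
  let ?q = "(1/2::real) powr \<gamma>"
  have q: "0 < ?q" by simp
  have q1: "?q \<le> 1" using assms powr_mono2[of \<gamma> "1/2" 1] by simp
  define j where "j = (LEAST j. d x y < 2 ^ j * r)"
  obtain n :: nat where "d x y / r < real n" using reals_Archimedean2 by blast
  then have "d x y / r < 2 ^ n" using of_nat_less_two_power[of n] by (meson less_trans)
  then have "d x y < 2 ^ n * r" using assms by (simp add: field_simps)
  then have j: "d x y < 2 ^ j * r" unfolding j_def by (rule LeastI)
  show ?thesis
  proof (intro exI[of _ j] conjI j)
    show "sz x r \<gamma> y \<le> C\<mu> / ?q * ?q ^ j / V (2 ^ j * r) x"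
    proof (cases j)
      case 0
      have "sz x r \<gamma> y \<le> 1 / V r x * 1"
        unfolding test_size_def using assms V_pos[of r x]
        by (intro mult_mono divide_left_mono powr_size_le1) (auto simp: V2_eq intro!: add_pos_nonneg mult_pos_pos)
      also have "\<dots> \<le> C\<mu> / ?q * 1 / V r x"
      proof -
        have "1 \<le> C\<mu> / ?q" using q q1 C\<mu>_ge1 by (simp add: field_simps)
        then have "1 / V r x \<le> C\<mu> / ?q / V r x" by (intro divide_right_mono) auto
        then show ?thesis by simp
      qed
      finally show ?thesis using 0 by simp
    next
      case (Suc i)
      have "\<not> d x y < 2 ^ i * r" using Suc not_less_Least[of i "\<lambda>j. d x y < 2 ^ j * r"] by (simp add: j_def)
      then have i: "2 ^ i * r \<le> d x y" by simp
      have Vp: "0 < V (2 ^ j * r) x" using assms by (intro V_pos) simp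
      have "V (2 ^ j * r) x = V (2 * (2 ^ i * r)) x" using Suc by (simp add: mult.assoc)
      also have "\<dots> \<le> C\<mu> * V (2 ^ i * r) x" using assms by (intro V_double) simp
      also have "\<dots> \<le> C\<mu> * Vol2 d \<mu> x y" using C\<mu>_ge1 i by (intro mult_left_mono) (auto simp: V2_eq V_mono)
      finally have a: "V (2 ^ j * r) x / C\<mu> \<le> V r x + Vol2 d \<mu> x y"
        using C\<mu>_ge1 V_nonneg[of r x] by (simp add: field_simps add_increasing)
      have "r / (r + d x y) \<le> r / (2 ^ i * r)" using i assms by (intro frac_le) auto
      also have "\<dots> = 1 / 2 ^ i" using assms by simp
      finally have "(r / (r + d x y)) powr \<gamma> \<le> (1 / 2 ^ i) powr \<gamma>"
        using assms by (intro powr_mono2) auto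
      also have "\<dots> = ?q ^ i"
        by (simp add: powr_realpow[symmetric] powr_powr powr_divide mult.commute)
      also have "\<dots> = ?q ^ j / ?q" using Suc q by simp
      finally have b: "(r / (r + d x y)) powr \<gamma> \<le> ?q ^ j / ?q" .
      have "sz x r \<gamma> y \<le> 1 / (V (2 ^ j * r) x / C\<mu>) * (?q ^ j / ?q)"
        unfolding test_size_def using a b Vp C\<mu>_ge1 assms
        by (intro mult_mono divide_left_mono) (auto intro!: mult_pos_pos divide_pos_pos intro: less_le_trans[OF _ a])
      then show ?thesis by (simp add: mult_ac)
    qed
  qed
qed

text \<open>Only averages over balls concentric with the size function enter, so the lemma serves
  with \<open>m\<close> a value of the maximal function, an essential supremum, or 1.
  \<open>size_const\<close> is the sum of the geometric series of ratio 2^(-\<gamma>) that results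
  from \<open>size_dyadic\<close>.\<close>

lemma nn_integral_size_le:
  assumes u: "u \<in> borel_measurable \<mu>" and "0 < r" "0 < \<gamma>"
    and m: "\<And>j::nat. (\<integral>\<^sup>+y. u y * indicator (B x (2 ^ j * r)) y \<partial>\<mu>) \<le> m * emeasure \<mu> (B x (2 ^ j * r))"
  shows "(\<integral>\<^sup>+y. u y * ennreal (sz x r \<gamma> y) \<partial>\<mu>) \<le> ennreal (size_const \<gamma>) * m"
proof -
  let ?q = "(1/2::real) powr \<gamma>"
  have q: "0 < ?q" by simp
  have q1: "?q < 1" using assms powr_less_mono2[of \<gamma> "1/2" 1] by simp
  let ?c = "\<lambda>j. C\<mu> / ?q * ?q ^ j / V (2 ^ j * r) x"
  let ?B = "\<lambda>j. B x (2 ^ j * r)"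
  have Vp: "0 < V (2 ^ j * r) x" for j :: nat using assms by (intro V_pos) simp
  have c0: "0 \<le> ?c j" for j using C\<mu>_ge1 by simp
  have "(\<integral>\<^sup>+y. u y * ennreal (sz x r \<gamma> y) \<partial>\<mu>)
      \<le> (\<integral>\<^sup>+y. (\<Sum>j. ennreal (?c j) * (u y * indicator (?B j) y)) \<partial>\<mu>)"
  proof (rule nn_integral_mono)
    fix y
    obtain j where j: "d x y < 2 ^ j * r" "sz x r \<gamma> y \<le> ?c j" using size_dyadic assms by blast
    have "u y * ennreal (sz x r \<gamma> y) \<le> u y * ennreal (?c j)"
      using j by (intro mult_left_mono ennreal_leI) auto
    also have "\<dots> = (\<Sum>j\<in>{j}. ennreal (?c j) * (u y * indicator (?B j) y))"
      using j by (simp add: qball_def mult.commute)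
    also have "\<dots> \<le> (\<Sum>j. ennreal (?c j) * (u y * indicator (?B j) y))"
      by (intro sum_le_suminf) auto
    finally show "u y * ennreal (sz x r \<gamma> y) \<le> (\<Sum>j. ennreal (?c j) * (u y * indicator (?B j) y))" .
  qed
  also have "\<dots> = (\<Sum>j. ennreal (?c j) * (\<integral>\<^sup>+y. u y * indicator (?B j) y \<partial>\<mu>))"
    using u by (subst nn_integral_suminf) (auto simp: nn_integral_cmult)
  also have "\<dots> \<le> (\<Sum>j. ennreal (C\<mu> / ?q * ?q ^ j) * m)"
  proof (intro suminf_le)
    fix j
    have "ennreal (?c j) * (\<integral>\<^sup>+y. u y * indicator (?B j) y \<partial>\<mu>) \<le> ennreal (?c j) * (m * ennreal (V (2 ^ j * r) x))"
      using m[of j] by (intro mult_left_mono) (auto simp: emeasure_ball)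
    also have "\<dots> = ennreal (?c j * V (2 ^ j * r) x) * m"
      using c0 by (simp only: ennreal_mult V_nonneg mult_ac)
    also have "?c j * V (2 ^ j * r) x = C\<mu> / ?q * ?q ^ j" using Vp[of j] by simp
    finally show "ennreal (?c j) * (\<integral>\<^sup>+y. u y * indicator (?B j) y \<partial>\<mu>) \<le> ennreal (C\<mu> / ?q * ?q ^ j) * m" .
  qed auto
  also have "\<dots> = (\<Sum>j. ennreal (C\<mu> / ?q * ?q ^ j)) * m" by simp
  also have "(\<Sum>j. ennreal (C\<mu> / ?q * ?q ^ j)) = ennreal (size_const \<gamma>)"
  proof -
    have "(\<lambda>j. ?q ^ j) sums (1 / (1 - ?q))" using q1 by (intro geometric_sums) simp
    then have "(\<lambda>j. C\<mu> / ?q * ?q ^ j) sums (C\<mu> / ?q * (1 / (1 - ?q)))" by (rule sums_mult)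
    then have "(\<lambda>j. C\<mu> / ?q * ?q ^ j) sums size_const \<gamma>" by (simp add: size_const_def)
    then show ?thesis using C\<mu>_ge1 by (intro suminf_ennreal_eq) auto
  qed
  finally show ?thesis .
qed

lemma nn_integral_size_const:
  assumes "0 < r" "0 < \<gamma>"
  shows "(\<integral>\<^sup>+y. ennreal (sz x r \<gamma> y) \<partial>\<mu>) \<le> ennreal (size_const \<gamma>)"
  using nn_integral_size_le[of "\<lambda>_. 1" r \<gamma> x 1] assms by simp

end

section \<open>The Hardy--Littlewood maximal function\<close>

lemma epowr_top [simp]: "epowr top s = top"
  by (simp add: epowr_def)

lemma epowr_ennreal: "0 \<le> a \<Longrightarrow> epowr (ennreal a) s = ennreal (a powr s)"
  by (simp add: epowr_def)

lemma epowr_measurable [measurable]: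
  assumes [measurable]: "f \<in> borel_measurable M"
  shows "(\<lambda>x. epowr (f x) s) \<in> borel_measurable M"
proof -
  have "{x \<in> space M. f x = \<infinity>} \<in> sets M"
    using measurable_sets[OF assms, of "{\<infinity>}"] by (simp add: vimage_def Int_def conj_commute)
  moreover have "(\<lambda>x. ennreal (enn2real (f x) powr s)) \<in> borel_measurable M" by measurable
  ultimately show ?thesis unfolding epowr_def by (intro measurable_If) auto
qed

lemma epowr_cmult:
  assumes "0 < c" "0 < s"
  shows "epowr (ennreal c * t) s = ennreal (c powr s) * epowr t s"
proof (cases t)
  case (real r)
  then show ?thesis using assms
    by (simp add: epowr_ennreal powr_mult flip: ennreal_mult)
next
  case top
  then show ?thesis using assms by (simp add: epowr_def ennreal_mult_top)
qed

lemma eLp_norm_cmult: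
  assumes "0 < c" "1 < p" and h: "h \<in> borel_measurable M"
  shows "eLp_norm M p (\<lambda>x. ennreal c * h x) \<le> ennreal c * eLp_norm M p h"
proof (cases "p = \<infinity>")
  case True
  have "AE x in M. ennreal c * h x \<le> ennreal c * esssup M h"
    using esssup_AE[of h M] by eventually_elim (rule mult_left_mono, auto)
  then show ?thesis using True h by (auto simp: eLp_norm_def intro!: esssup_I)
next
  case False
  then have q: "0 < enn2real p" using assms by (simp add: enn2real_positive_iff less_top less_trans[of 0 1 p])
  have "epowr (\<integral>\<^sup>+ x. epowr (ennreal c * h x) (enn2real p) \<partial>M) (1 / enn2real p)
     = epowr (ennreal (c powr enn2real p) * (\<integral>\<^sup>+ x. epowr (h x) (enn2real p) \<partial>M)) (1 / enn2real p)"
    using h q assms by (simp add: epowr_cmult nn_integral_cmult)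
  also have "\<dots> = ennreal c * epowr (\<integral>\<^sup>+ x. epowr (h x) (enn2real p) \<partial>M) (1 / enn2real p)"
    using q assms by (subst epowr_cmult) (auto simp: powr_powr)
  finally show ?thesis using False by (simp add: eLp_norm_def)
qed

lemma dyadic_int_exists:
  assumes "0 < (x::real)"
  shows "\<exists>j::int. 2 powr j < x \<and> x \<le> 2 powr (real_of_int j + 1)"
proof (intro exI[of _ "\<lceil>log 2 x\<rceil> - 1"] conjI)
  have a: "real_of_int (\<lceil>log 2 x\<rceil> - 1) < log 2 x" by linarith
  show "2 powr (real_of_int (\<lceil>log 2 x\<rceil> - 1)) < x"
    using a assms by (simp only: less_log_iff[of 2 x])
  have b: "log 2 x \<le> real_of_int (\<lceil>log 2 x\<rceil> - 1) + 1" by linarith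
  then show "x \<le> 2 powr (real_of_int (\<lceil>log 2 x\<rceil> - 1) + 1)"
    using assms by (simp only: log_le_iff[of 2 x])
qed

text \<open>A discrete layer cake formula: among the levels 2^j below a finite positive
  \<open>w\<close>, the highest alone contributes at least w^q, and for infinite \<open>w\<close>
  the terms are unbounded. The sum is an integral over \<open>count_space\<close>, so that it can be
  exchanged with the integral over the space.\<close>

lemma epowr_le_dyadic_sum:
  fixes w :: ennreal
  assumes "0 < q"
  shows "epowr w q \<le> (\<integral>\<^sup>+ j. ennreal (2 powr ((real_of_int j + 1) * q)) * indicator {j. ennreal (2 powr real_of_int j) < w} j \<partial>count_space UNIV)"
    (is "_ \<le> integral\<^sup>N _ ?f")
proof -
  have single: "?f j \<le> integral\<^sup>N (count_space UNIV) ?f" for j :: int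
    using nn_integral_ge_point[of j UNIV ?f] by simp
  show ?thesis
  proof (cases w)
    case (real r)
    show ?thesis
    proof (cases "r = 0")
      case False
      then obtain j :: int where j: "2 powr j < r" "r \<le> 2 powr (real_of_int j + 1)"
        using real dyadic_int_exists[of r] by auto
      have "epowr w q = ennreal (r powr q)" using real by (simp add: epowr_ennreal)
      also have "\<dots> \<le> ennreal ((2 powr (real_of_int j + 1)) powr q)"
        using j False real assms by (intro ennreal_leI powr_mono2) auto
      also have "\<dots> = ?f j" using j real by (simp add: powr_powr ennreal_less_iff)
      finally show ?thesis using single[of j] by simp
    qed (use real assms in \<open>simp add: epowr_def\<close>)
  next
    case top
    have nle: "of_nat n \<le> integral\<^sup>N (count_space UNIV) ?f" for n
    proof -
      \<comment> \<open>With this index the single term 2^((j+1)q) is at least 2^n, hence at least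
        \<open>n\<close>.\<close>
      define j where "j = \<lceil>real n / q\<rceil>"
      have "real n / q \<le> real_of_int j" by (simp add: j_def)
      then have "real n \<le> (real_of_int j + 1) * q" using assms by (simp add: field_simps)
      have "real n \<le> 2 ^ n" by (metis less_imp_le of_nat_less_two_power)
      also have "\<dots> = 2 powr (real n)" by (simp add: powr_realpow)
      also have "\<dots> \<le> 2 powr ((real_of_int j + 1) * q)"
        using \<open>real n \<le> (real_of_int j + 1) * q\<close> by simp
      finally have "of_nat n \<le> ?f j" using top by (simp add: ennreal_of_nat_eq_real_of_nat)
      then show ?thesis using single[of j] order_trans by blast
    qed
    have "integral\<^sup>N (count_space UNIV) ?f = \<infinity>"
    proof (rule ccontr)
      assume "integral\<^sup>N (count_space UNIV) ?f \<noteq> \<infinity>"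
      then obtain n :: nat where "integral\<^sup>N (count_space UNIV) ?f < of_nat n"
        using ennreal_Ex_less_of_nat[of "integral\<^sup>N (count_space UNIV) ?f"] by (auto simp: less_top)
      with nle[of n] show False by simp
    qed
    then show ?thesis by simp
  qed
qed

lemma two_powr_neg_less1: "0 < s \<Longrightarrow> 2 powr (- s) < (1::real)"
  using powr_less_mono[of "- s" 0 "2::real"] by simp

text \<open>The levels below \<open>2 * u\<close> form a geometric series of ratio 2^(-(q-1)) when
  counted downwards; it converges because q > 1, and its leading term is comparable to u^(q-1). The
  factor 2 in the level condition matches the truncation at half height in the weak type
  estimate.\<close>

lemma dyadic_sum_le_epowr:
  fixes u :: ennreal
  assumes "1 < q"
  shows "u * (\<integral>\<^sup>+ j. ennreal (2 powr (real_of_int j * (q - 1))) * indicator {j. ennreal (2 powr real_of_int j) < 2 * u} j \<partial>count_space UNIV)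
     \<le> ennreal (2 powr (q - 1) / (1 - 2 powr (- (q - 1)))) * epowr u q"
proof (cases u)
  case (real r)
  show ?thesis
  proof (cases "r = 0")
    case False
    let ?s = "q - 1"
    let ?g = "\<lambda>j::int. ennreal (2 powr (real_of_int j * ?s))"
    obtain J :: int where J: "2 powr J < 2 * r" "2 * r \<le> 2 powr (real_of_int J + 1)"
      using real False dyadic_int_exists[of "2 * r"] by auto
    have set: "{j::int. ennreal (2 powr real_of_int j) < 2 * u} = {..J}"
    proof -
      have u2: "2 * u = ennreal (2 * r)" using real by (simp add: ennreal_mult')
      have "2 powr (real_of_int j) < 2 * r \<longleftrightarrow> j \<le> J" for j
      proof
        assume "2 powr (real_of_int j) < 2 * r"
        then have "2 powr (real_of_int j) < (2::real) powr (real_of_int J + 1)" by (rule less_le_trans[OF _ J(2)])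
        then have "real_of_int j < real_of_int J + 1" by (simp only: powr_less_cancel_iff one_less_numeral_iff semiring_norm)
        then show "j \<le> J" by linarith
      next
        assume "j \<le> J"
        then have "2 powr (real_of_int j) \<le> (2::real) powr J" by simp
        then show "2 powr (real_of_int j) < 2 * r" using J(1) by linarith
      qed
      then show ?thesis using u2 by (auto simp: ennreal_less_iff)
    qed
    \<comment> \<open>Counts the levels downwards from the highest one \<open>J\<close>, which turns
      the sum over integers into a series over naturals.\<close>
    have b: "bij_betw (\<lambda>i. J - int i) UNIV {..J}"
      by (rule bij_betwI[where g="\<lambda>j. nat (J - j)"]) auto
    have q1: "(2::real) powr (- ?s) < 1" using assms by (intro two_powr_neg_less1) simp
    have "(\<integral>\<^sup>+ j. ?g j * indicator {j. ennreal (2 powr real_of_int j) < 2 * u} j \<partial>count_space UNIV)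
        = (\<integral>\<^sup>+ j. ?g j \<partial>count_space {..J})"
      unfolding set by (simp add: nn_integral_count_space_indicator)
    also have "\<dots> = (\<Sum>i. ?g (J - int i))"
      using nn_integral_bij_count_space[OF b, of ?g] by (simp add: nn_integral_count_space_nat)
    also have "\<dots> = (\<Sum>i. ennreal (2 powr (J * ?s) * (2 powr (- ?s)) ^ i))"
      by (simp add: powr_realpow[symmetric] powr_powr powr_add[symmetric] algebra_simps)
    also have "\<dots> = ennreal (2 powr (J * ?s) * (1 / (1 - 2 powr (- ?s))))"
      using q1 by (intro suminf_ennreal_eq sums_mult geometric_sums) auto
    also have "\<dots> \<le> ennreal ((2 * r) powr ?s * (1 / (1 - 2 powr (- ?s))))"
    proof (intro ennreal_leI mult_right_mono)
      have "2 powr (J * ?s) = (2 powr J) powr ?s" by (simp add: powr_powr)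
      also have "\<dots> \<le> (2 * r) powr ?s" using J assms by (intro powr_mono2) auto
      finally show "2 powr (J * ?s) \<le> (2 * r) powr ?s" .
    qed (use q1 in simp)
    finally have le: "u * (\<integral>\<^sup>+ j. ?g j * indicator {j. ennreal (2 powr real_of_int j) < 2 * u} j \<partial>count_space UNIV)
        \<le> u * ennreal ((2 * r) powr ?s * (1 / (1 - 2 powr (- ?s))))" by (rule mult_left_mono) simp
    also have "\<dots> = ennreal (r * ((2 * r) powr ?s * (1 / (1 - 2 powr (- ?s)))))"
      unfolding real(2) using real(1) q1 by (intro ennreal_mult[symmetric]) auto
    also have "r * ((2 * r) powr ?s * (1 / (1 - 2 powr (- ?s)))) = 2 powr ?s / (1 - 2 powr (- ?s)) * r powr q"
    proof -
      have "r * r powr ?s = r powr q" using real False powr_mult_base[of r ?s] by simp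
      then show ?thesis using real by (simp add: powr_mult)
    qed
    also have "ennreal (2 powr ?s / (1 - 2 powr (- ?s)) * r powr q) = ennreal (2 powr ?s / (1 - 2 powr (- ?s))) * epowr u q"
      using real q1 by (simp only: epowr_ennreal) (intro ennreal_mult; simp)
    finally show ?thesis .
  qed (use real in simp)
next
  case top
  have "(2::real) powr (- (q - 1)) < 1" using assms by (intro two_powr_neg_less1) simp
  then show ?thesis using top assms by (simp add: epowr_def ennreal_mult_top)
qed

section \<open>Covering arguments with a countable dense set\<close>

locale hts_sep = hts d \<mu> A0 C\<mu>
  for d :: "'a::topological_space \<Rightarrow> 'a \<Rightarrow> real" and \<mu> :: "'a measure" and A0 C\<mu> :: real +
  fixes D :: "'a set"
  assumes countable_D: "countable D" and dense_D: "\<And>x r. 0 < r \<Longrightarrow> \<exists>w\<in>D. d x w < r"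
begin

text \<open>Balls with centre in \<open>D\<close> and radius 1/(n+1) form a countable base. Two
  points of such a ball are closer than 2 A0/(n+1), whence the choice of \<open>n\<close>.\<close>

lemma small_ball_in_open:
  assumes "open U" "x \<in> U"
  shows "\<exists>w\<in>D. \<exists>n::nat. x \<in> B w (inverse (real (Suc n))) \<and> B w (inverse (real (Suc n))) \<subseteq> U"
proof -
  obtain r where r: "r > 0" "B x r \<subseteq> U" using ball_in_open assms by blast
  obtain n :: nat where n: "inverse (real (Suc n)) < r / (2 * A0)"
    using reals_Archimedean[of "r / (2 * A0)"] r A0_ge1 by auto
  let ?e = "inverse (real (Suc n))"
  obtain w where w: "w \<in> D" "d x w < ?e" using dense_D[of ?e x] by auto
  have "B w ?e \<subseteq> B x r"
  proof
    fix y assume "y \<in> B w ?e"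
    then have y: "d w y < ?e" by (simp add: qball_def)
    have "d x y \<le> A0 * (d x w + d w y)" by (rule d_tri)
    also have "\<dots> < A0 * (?e + ?e)" using w y A0_ge1 by (intro mult_strict_left_mono) auto
    also have "\<dots> = 2 * A0 * ?e" by simp
    also have "\<dots> < r" using n A0_ge1 by (simp only: less_divide_eq) (simp add: mult.commute)
    finally show "y \<in> B x r" by (simp add: qball_def)
  qed
  with w r show ?thesis by (auto simp: qball_def d_sym[of w x] intro!: bexI[of _ w] exI[of _ n])
qed

text \<open>One index is chosen for every basis ball that is contained in some member of the family.
  The result speaks of indices rather than sets because the covering argument needs the centres and
  radii of the selected balls.\<close>

lemma Lindelof_index:
  fixes U :: "'i \<Rightarrow> 'a set"
  assumes "\<And>i. i \<in> I \<Longrightarrow> open (U i)"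
  shows "\<exists>I'\<subseteq>I. countable I' \<and> (\<Union>i\<in>I'. U i) = (\<Union>i\<in>I. U i)"
proof -
  define S where "S = {(w, n::nat). w \<in> D \<and> (\<exists>i\<in>I. B w (inverse (real (Suc n))) \<subseteq> U i)}"
  have "S \<subseteq> D \<times> UNIV" by (auto simp: S_def)
  then have S: "countable S" using countable_D by (meson countable_SIGMA countableI_type countable_subset)
  define c where "c = (\<lambda>(w, n::nat). SOME i. i \<in> I \<and> B w (inverse (real (Suc n))) \<subseteq> U i)"
  have c: "c (w, n) \<in> I \<and> B w (inverse (real (Suc n))) \<subseteq> U (c (w, n))" if "(w, n) \<in> S" for w n
    using that someI_ex[of "\<lambda>i. i \<in> I \<and> B w (inverse (real (Suc n))) \<subseteq> U i"] by (auto simp: S_def c_def)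
  have sub: "c ` S \<subseteq> I" using c by auto
  show ?thesis
  proof (intro exI[of _ "c ` S"] conjI)
    show "(\<Union>i\<in>c ` S. U i) = (\<Union>i\<in>I. U i)"
    proof (intro equalityI UN_least)
      fix i assume i: "i \<in> I"
      show "U i \<subseteq> (\<Union>i\<in>c ` S. U i)"
      proof
        fix x assume "x \<in> U i"
        then obtain w n where wn: "w \<in> D" "x \<in> B w (inverse (real (Suc n)))" "B w (inverse (real (Suc n))) \<subseteq> U i"
          using small_ball_in_open assms i by blast
        then have "(w, n) \<in> S" using i by (auto simp: S_def)
        then show "x \<in> (\<Union>i\<in>c ` S. U i)" using c wn by blast
      qed
    next
      fix i assume "i \<in> c ` S"
      then show "U i \<subseteq> (\<Union>i\<in>I. U i)" using sub by blast
    qed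
  qed (use sub S in auto)
qed

text \<open>Greedy selection: keep a ball of largest radius, discard all balls that meet it, and
  continue with the rest. If B(w,r) meets the kept ball of radius s \<ge> r, two uses of the
  quasi-triangle inequality place it within A0 (s + 2 A0 r) \<le> 3 A0^2 s of the kept
  centre.\<close>

lemma finite_Vitali:
  fixes I :: "('a \<times> real) set"
  assumes "finite I" "\<And>w r. (w, r) \<in> I \<Longrightarrow> 0 < r"
  shows "\<exists>J\<subseteq>I. disjoint_family_on (\<lambda>(w, r). B w r) J \<and>
     (\<Union>(w, r)\<in>I. B w r) \<subseteq> (\<Union>(w, r)\<in>J. B w (3 * A0\<^sup>2 * r))"
  using assms
proof (induction I rule: finite_psubset_induct)
  case (psubset I)
  show ?case
  proof (cases "I = {}")
    case False
    then obtain m where m: "m \<in> I" "\<And>i. i \<in> I \<Longrightarrow> snd i \<le> snd m"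
      using psubset.hyps Max_in[of "snd ` I"] Max_ge[of "snd ` I"] by (metis (no_types, lifting) finite_imageI image_iff image_is_empty)
    define I' where "I' = {i\<in>I. (case i of (w, r) \<Rightarrow> B w r) \<inter> B (fst m) (snd m) = {}}"
    have mm: "fst m \<in> B (fst m) (snd m)" using m psubset.prems[of "fst m" "snd m"] by (simp add: qball_def)
    then have "m \<notin> I'" unfolding I'_def by (auto simp: split_beta)
    then have "I' \<subset> I" using m unfolding I'_def by blast
    then obtain J' where J': "J' \<subseteq> I'" "disjoint_family_on (\<lambda>(w, r). B w r) J'"
       "(\<Union>(w, r)\<in>I'. B w r) \<subseteq> (\<Union>(w, r)\<in>J'. B w (3 * A0\<^sup>2 * r))"
      using psubset.IH[of I'] psubset.prems by blast
    have disj: "disjoint_family_on (\<lambda>(w, r). B w r) (insert m J')"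
    proof -
      have "\<And>i. i \<in> J' \<Longrightarrow> (case i of (w, r) \<Rightarrow> B w r) \<inter> (case m of (w, r) \<Rightarrow> B w r) = {}"
        using J'(1) by (auto simp: I'_def split_beta)
      then show ?thesis using J'(2) unfolding disjoint_family_on_def by (metis Int_commute insert_iff)
    qed
    have step: "B w r \<subseteq> B (fst m) (3 * A0\<^sup>2 * snd m)" if wr: "(w, r) \<in> I" "(w, r) \<notin> I'" for w r
    proof
      fix x assume "x \<in> B w r"
      then have x: "d w x < r" by (simp add: qball_def)
      obtain v where v: "d w v < r" "d (fst m) v < snd m" using wr by (auto simp: I'_def qball_def)
      have r: "r \<le> snd m" "0 < r" using m(2)[OF wr(1)] psubset.prems wr by auto
      have a: "d v x \<le> A0 * (r + r)"
      proof -
        have "d v w + d w x \<le> r + r" using v x by (simp add: d_sym[of v w])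
        then have "A0 * (d v w + d w x) \<le> A0 * (r + r)" using A0_ge1 by (intro mult_left_mono) auto
        then show ?thesis using d_tri[of v x w] by linarith
      qed
      have "d (fst m) x \<le> A0 * (d (fst m) v + d v x)" by (rule d_tri)
      also have "\<dots> < A0 * (snd m + A0 * (r + r))"
        using a v A0_ge1 by (intro mult_strict_left_mono) auto
      also have "\<dots> \<le> A0 * (A0 * snd m + A0 * (snd m + snd m))"
        using r A0_ge1 mult_right_mono[of 1 A0 "snd m"] by (intro mult_left_mono add_mono) auto
      also have "\<dots> = 3 * A0\<^sup>2 * snd m" by (simp add: power2_eq_square)
      finally show "x \<in> B (fst m) (3 * A0\<^sup>2 * snd m)" by (simp add: qball_def)
    qed
    have "(\<Union>(w, r)\<in>I. B w r) \<subseteq> (\<Union>(w, r)\<in>I'. B w r) \<union> B (fst m) (3 * A0\<^sup>2 * snd m)"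
      using step by blast
    also have "\<dots> \<subseteq> (\<Union>(w, r)\<in>J'. B w (3 * A0\<^sup>2 * r)) \<union> B (fst m) (3 * A0\<^sup>2 * snd m)"
      using J'(3) by (rule Un_mono) simp
    also have "\<dots> = (\<Union>(w, r)\<in>insert m J'. B w (3 * A0\<^sup>2 * r))"
      by (simp add: split_beta Un_commute)
    finally have "(\<Union>(w, r)\<in>I. B w r) \<subseteq> (\<Union>(w, r)\<in>insert m J'. B w (3 * A0\<^sup>2 * r))" .
    moreover have "insert m J' \<subseteq> I" using J' m by (auto simp: I'_def)
    ultimately show ?thesis using disj by blast
  qed (auto simp: disjoint_family_on_def)
qed

section \<open>The uncentred maximal function: weak and strong type\<close>

definition hl :: "('a \<Rightarrow> ennreal) \<Rightarrow> 'a \<Rightarrow> ennreal" where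
  "hl u x = (SUP (w, r) \<in> {(w, r). 0 < r \<and> x \<in> B w r}.
     (\<integral>\<^sup>+y. u y * indicator (B w r) y \<partial>\<mu>) / emeasure \<mu> (B w r))"

lemma less_div_ball:
  "0 < r \<Longrightarrow> (t < a / emeasure \<mu> (B w r)) = (t * emeasure \<mu> (B w r) < a)"
proof -
  assume r: "0 < r"
  let ?v = "emeasure \<mu> (B w r)"
  have v: "?v \<noteq> 0" "?v < top" using emeasure_ball_pos[OF r, of w] emeasure_ball_fin[of w r] by auto
  have "a / ?v \<le> t \<longleftrightarrow> a \<le> t * ?v"
  proof
    assume "a / ?v \<le> t"
    then have "a / ?v * ?v \<le> t * ?v" by (rule mult_right_mono) simp
    then show "a \<le> t * ?v" using v by (simp add: ennreal_divide_times)
  qed (use v in \<open>auto intro!: divide_le_posI_ennreal simp: zero_less_iff_neq_zero mult.commute\<close>)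
  then show ?thesis by (meson not_le)
qed

lemma hl_ball:
  assumes "0 < r" "x \<in> B w r"
  shows "(\<integral>\<^sup>+y. u y * indicator (B w r) y \<partial>\<mu>) \<le> hl u x * emeasure \<mu> (B w r)"
proof -
  let ?a = "\<integral>\<^sup>+y. u y * indicator (B w r) y \<partial>\<mu>"
  have "?a / emeasure \<mu> (B w r) \<le> hl u x"
    unfolding hl_def using assms by (intro SUP_upper2[of "(w, r)"]) auto
  then show ?thesis using less_div_ball[OF assms(1)] by (meson leD leI)
qed

definition big_balls :: "('a \<Rightarrow> ennreal) \<Rightarrow> ennreal \<Rightarrow> ('a \<times> real) set" where
  "big_balls u t = {(w, r). 0 < r \<and> t * emeasure \<mu> (B w r) < (\<integral>\<^sup>+y. u y * indicator (B w r) y \<partial>\<mu>)}"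

text \<open>This is the purpose of the uncentred form of \<open>hl\<close>: superlevel sets are
  unions of open balls, hence open and measurable for every \<open>u\<close>.\<close>

lemma hl_superlevel: "{x. t < hl u x} = (\<Union>(w, r)\<in>big_balls u t. B w r)"
  unfolding hl_def big_balls_def less_SUP_iff
  by (auto simp: less_div_ball) (metis less_div_ball)

lemma open_hl_superlevel: "open {x. t < hl u x}"
  unfolding hl_superlevel by (intro open_UN) (auto simp: open_ball)

lemma hl_measurable [measurable]: "hl u \<in> borel_measurable \<mu>"
  by (intro borel_measurableI_greater) (simp add: open_hl_superlevel open_sets)

text \<open>The power comes from \<open>V_scale\<close> for the Vitali enlargement 3 A0^2, the outer
  2 from cutting \<open>u\<close> at half the level.\<close>

definition hl_const :: real where "hl_const = 2 * (6 * A0\<^sup>2) ^ dm"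

text \<open>The part of \<open>u\<close> not exceeding t/2 contributes at most t/2 times the measure
  of the ball, so the part above t/2 must supply the other half.\<close>

lemma big_ball_truncate:
  assumes u [measurable]: "u \<in> borel_measurable \<mu>" and "(w, r) \<in> big_balls u (ennreal t)" "0 < t"
  shows "ennreal (t / 2) * emeasure \<mu> (B w r) \<le>
     (\<integral>\<^sup>+y. u y * indicator {y. ennreal (t / 2) < u y} y * indicator (B w r) y \<partial>\<mu>)" (is "_ \<le> ?R")
proof -
  have r: "0 < r" and big: "ennreal t * emeasure \<mu> (B w r) < (\<integral>\<^sup>+y. u y * indicator (B w r) y \<partial>\<mu>)"
    using assms by (auto simp: big_balls_def)
  have "(\<integral>\<^sup>+y. u y * indicator (B w r) y \<partial>\<mu>) \<le>
     (\<integral>\<^sup>+y. u y * indicator {y. ennreal (t / 2) < u y} y * indicator (B w r) y + ennreal (t/2) * indicator (B w r) y \<partial>\<mu>)"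
    by (intro nn_integral_mono) (auto simp: indicator_def)
  also have "\<dots> = ?R + ennreal (t/2) * emeasure \<mu> (B w r)"
    by (subst nn_integral_add) (auto simp: nn_integral_cmult)
  finally have "ennreal t * emeasure \<mu> (B w r) \<le> ?R + ennreal (t/2) * emeasure \<mu> (B w r)" using big by simp
  moreover have "ennreal t * emeasure \<mu> (B w r) = ennreal (t/2) * emeasure \<mu> (B w r) + ennreal (t/2) * emeasure \<mu> (B w r)"
    using assms unfolding distrib_right[symmetric] by (subst ennreal_plus[symmetric]) auto
  moreover have "ennreal (t/2) * emeasure \<mu> (B w r) \<noteq> top" using assms by (simp add: emeasure_ball ennreal_mult_eq_top_iff)
  ultimately show ?thesis
    by (simp add: add.commute ennreal_add_left_cancel_le)
qed

text \<open>The disjoint Vitali subfamily is charged to the integral of \<open>u\<close>, but only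
  where \<open>u\<close> exceeds t/2. This truncated form already contains the interpolation with
  the trivial L^\<infinity> bound and can be summed over dyadic levels.\<close>

lemma hl_weak_type:
  assumes u [measurable]: "u \<in> borel_measurable \<mu>" and t: "0 < t"
  shows "ennreal t * emeasure \<mu> {x. ennreal t < hl u x} \<le>
     ennreal hl_const * (\<integral>\<^sup>+y. u y * indicator {y. ennreal (t / 2) < u y} y \<partial>\<mu>)" (is "_ \<le> ?R")
proof -
  let ?v = "\<lambda>y. u y * indicator {y. ennreal (t / 2) < u y} y"
  obtain F where F: "F \<subseteq> big_balls u (ennreal t)" "countable F"
    "(\<Union>(w, r)\<in>F. B w r) = {x. ennreal t < hl u x}"
    using Lindelof_index[of "big_balls u (ennreal t)" "\<lambda>(w, r). B w r"]
    unfolding hl_superlevel by (auto simp: open_ball)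
  have fin: "ennreal t * emeasure \<mu> (\<Union>(w, r)\<in>I. B w r) \<le> ?R" if I: "finite I" "I \<subseteq> F" for I
  proof -
    have pos: "0 < r" if "(w, r) \<in> I" for w r using that I F by (auto simp: big_balls_def)
    obtain J where J: "J \<subseteq> I" "disjoint_family_on (\<lambda>(w, r). B w r) J"
      "(\<Union>(w, r)\<in>I. B w r) \<subseteq> (\<Union>(w, r)\<in>J. B w (3 * A0\<^sup>2 * r))"
      using finite_Vitali[OF I(1)] pos by blast
    have fJ: "finite J" using J I finite_subset by blast
    have "emeasure \<mu> (\<Union>(w, r)\<in>I. B w r) \<le> emeasure \<mu> (\<Union>(w, r)\<in>J. B w (3 * A0\<^sup>2 * r))"
      using J fJ by (intro emeasure_mono) auto
    also have "\<dots> \<le> (\<Sum>(w, r)\<in>J. emeasure \<mu> (B w (3 * A0\<^sup>2 * r)))"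
      using emeasure_subadditive_finite[OF fJ, of "\<lambda>i. B (fst i) (3 * A0\<^sup>2 * snd i)" \<mu>]
      by (simp add: split_beta image_subset_iff)
    finally have "ennreal t * emeasure \<mu> (\<Union>(w, r)\<in>I. B w r)
        \<le> (\<Sum>(w, r)\<in>J. ennreal t * emeasure \<mu> (B w (3 * A0\<^sup>2 * r)))"
      by (simp add: sum_distrib_left[symmetric] split_beta mult_left_mono)
    also have "\<dots> \<le> (\<Sum>(w, r)\<in>J. ennreal hl_const * (\<integral>\<^sup>+y. ?v y * indicator (B w r) y \<partial>\<mu>))"
    proof (intro sum_mono, safe)
      fix w r assume wr: "(w, r) \<in> J"
      have r: "0 < r" using wr J pos by blast
      have "1 \<le> 3 * A0\<^sup>2" using A0_ge1 one_le_power[of A0 2] by linarith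
      then have "V (3 * A0\<^sup>2 * r) w \<le> (6 * A0\<^sup>2) ^ dm * V r w"
        using V_scale[of "3 * A0\<^sup>2" r w] r by simp
      then have "ennreal t * emeasure \<mu> (B w (3 * A0\<^sup>2 * r)) \<le> ennreal t * ennreal ((6 * A0\<^sup>2) ^ dm * V r w)"
        unfolding emeasure_ball by (intro mult_left_mono ennreal_leI) auto
      also have "\<dots> = ennreal hl_const * (ennreal (t / 2) * emeasure \<mu> (B w r))"
        using t by (simp add: emeasure_ball hl_const_def ennreal_mult'[symmetric])
      also have "\<dots> \<le> ennreal hl_const * (\<integral>\<^sup>+y. ?v y * indicator (B w r) y \<partial>\<mu>)"
        using wr J I F t by (intro mult_left_mono big_ball_truncate) auto
      finally show "ennreal t * emeasure \<mu> (B w (3 * A0\<^sup>2 * r))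
        \<le> ennreal hl_const * (\<integral>\<^sup>+y. ?v y * indicator (B w r) y \<partial>\<mu>)" .
    qed
    also have "\<dots> = ennreal hl_const * (\<integral>\<^sup>+y. (\<Sum>(w, r)\<in>J. ?v y * indicator (B w r) y) \<partial>\<mu>)"
      by (simp add: split_beta sum_distrib_left nn_integral_sum)
    also have "\<dots> \<le> ?R"
    proof (intro mult_left_mono nn_integral_mono)
      fix y
      have "(\<Sum>(w, r)\<in>J. ?v y * indicator (B w r) y) = ?v y * (\<Sum>i\<in>J. indicator (case i of (w, r) \<Rightarrow> B w r) y)"
        by (simp add: split_beta sum_distrib_left)
      also have "(\<Sum>i\<in>J. indicator (case i of (w, r) \<Rightarrow> B w r) y) = (indicator (\<Union>i\<in>J. case i of (w, r) \<Rightarrow> B w r) y :: ennreal)"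
        using fJ J(2) by (rule indicator_UN_disjoint[symmetric])
      also have "?v y * \<dots> \<le> ?v y" by (simp add: indicator_def)
      finally show "(\<Sum>(w, r)\<in>J. ?v y * indicator (B w r) y) \<le> ?v y" .
    qed simp
    finally show ?thesis .
  qed
  show ?thesis
  proof (cases "F = {}")
    case True
    then show ?thesis using F(3) by simp
  next
    case False
    define e where "e = from_nat_into F"
    have e: "range e = F" using False F(2) by (simp add: e_def)
    \<comment> \<open>Finite unions increase to the countable one, so the estimate for finite
      subfamilies passes to the limit.\<close>
    let ?A = "\<lambda>n. \<Union>i\<in>{..n}. B (fst (e i)) (snd (e i))"
    have "(\<Union>n. ?A n) = (\<Union>(w, r)\<in>F. B w r)" unfolding e[symmetric] by (auto simp: split_beta)
    then have "emeasure \<mu> {x. ennreal t < hl u x} = (SUP n. emeasure \<mu> (?A n))"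
      unfolding F(3)[symmetric] by (subst SUP_emeasure_incseq) (auto simp: incseq_def intro: order_trans)
    also have "ennreal t * \<dots> = (SUP n. ennreal t * emeasure \<mu> (?A n))"
      by (simp add: SUP_mult_left_ennreal)
    also have "\<dots> \<le> ?R"
    proof (rule SUP_least)
      fix n show "ennreal t * emeasure \<mu> (?A n) \<le> ?R"
        using fin[of "e ` {..n}"] e by (auto simp: split_beta)
    qed
    finally show ?thesis .
  qed
qed

lemma nn_integral_count_space_int_swap:
  fixes f :: "'a \<Rightarrow> int \<Rightarrow> ennreal"
  assumes "\<And>j. (\<lambda>x. f x j) \<in> borel_measurable \<mu>"
  shows "(\<integral>\<^sup>+x. \<integral>\<^sup>+j. f x j \<partial>count_space UNIV \<partial>\<mu>) = (\<integral>\<^sup>+j. \<integral>\<^sup>+x. f x j \<partial>\<mu> \<partial>count_space UNIV)"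
proof -
  interpret c: sigma_finite_measure "count_space (UNIV :: int set)"
    by (rule sigma_finite_measure_count_space)
  interpret pair_sigma_finite "count_space (UNIV :: int set)" \<mu> ..
  have "(\<lambda>(j, x). f x j) \<in> borel_measurable (count_space (UNIV :: int set) \<Otimes>\<^sub>M \<mu>)"
    using assms by (intro measurable_pair_measure_countable1) auto
  then show ?thesis by (rule Fubini')
qed

definition hl_strong_const :: "real \<Rightarrow> real" where
  "hl_strong_const q = hl_const * 2 powr q * (2 powr (q - 1) / (1 - 2 powr (- (q - 1))))"

lemma hl_const_pos: "0 < hl_const"
  using A0_ge1 by (auto simp: hl_const_def)

lemma hl_strong_const_pos: "1 < q \<Longrightarrow> 0 < hl_strong_const q"
  using hl_const_pos two_powr_neg_less1[of "q - 1"] by (simp add: hl_strong_const_def)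

text \<open>Marcinkiewicz interpolation by hand: the weak type estimate is applied on each dyadic
  level, and after exchanging sum and integral the levels below \<open>2 * u x\<close> are summed at
  each point.\<close>

lemma hl_strong_type:
  assumes u [measurable]: "u \<in> borel_measurable \<mu>" and q: "1 < q"
  shows "(\<integral>\<^sup>+x. epowr (hl u x) q \<partial>\<mu>) \<le> ennreal (hl_strong_const q) * (\<integral>\<^sup>+x. epowr (u x) q \<partial>\<mu>)"
proof -
  let ?c = "\<lambda>j::int. ennreal (2 powr ((real_of_int j + 1) * q))"
  let ?e = "\<lambda>j::int. ennreal (2 powr (real_of_int j * (q - 1)))"
  let ?K = "ennreal (2 powr q * hl_const)"
  let ?U = "\<lambda>j::int. {x. ennreal (2 powr real_of_int j) < 2 * u x}"
  have "(\<integral>\<^sup>+x. epowr (hl u x) q \<partial>\<mu>) \<le>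
     (\<integral>\<^sup>+x. \<integral>\<^sup>+j. ?c j * indicator {x. ennreal (2 powr real_of_int j) < hl u x} x \<partial>count_space UNIV \<partial>\<mu>)"
    using q epowr_le_dyadic_sum[of q] by (intro nn_integral_mono) (auto simp: indicator_def)
  also have "\<dots> = (\<integral>\<^sup>+j. \<integral>\<^sup>+x. ?c j * indicator {x. ennreal (2 powr real_of_int j) < hl u x} x \<partial>\<mu> \<partial>count_space UNIV)"
    using open_hl_superlevel[THEN open_sets] by (intro nn_integral_count_space_int_swap) auto
  also have "\<dots> = (\<integral>\<^sup>+j. ?c j * emeasure \<mu> {x. ennreal (2 powr real_of_int j) < hl u x} \<partial>count_space UNIV)"
    using open_hl_superlevel[THEN open_sets] by (simp add: nn_integral_cmult)
  also have "\<dots> \<le> (\<integral>\<^sup>+j. \<integral>\<^sup>+x. ?K * (?e j * (u x * indicator (?U j) x)) \<partial>\<mu> \<partial>count_space UNIV)"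
  proof (rule nn_integral_mono)
    fix j :: int
    let ?t = "2 powr real_of_int j :: real"
    have U: "{y. ennreal (?t / 2) < u y} = ?U j"
    proof -
      have "ennreal (?t / 2) < v \<longleftrightarrow> ennreal ?t < 2 * v" for v
      proof (cases v)
        case (real r)
        then have "2 * v = ennreal (2 * r)" by (simp add: ennreal_mult')
        then show ?thesis using real by (auto simp: ennreal_less_iff)
      qed (auto simp: ennreal_mult_top)
      then show ?thesis by simp
    qed
    \<comment> \<open>One factor 2^j is split off for the weak type estimate; the remaining
      2^(j(q-1)) is what \<open>dyadic_sum_le_epowr\<close> sums.\<close>
    have "?c j = ennreal (2 powr q) * ?e j * ennreal ?t"
      by (simp add: ennreal_mult[symmetric] powr_add[symmetric] algebra_simps)
    then have "?c j * emeasure \<mu> {x. ennreal ?t < hl u x} = ennreal (2 powr q) * ?e j * (ennreal ?t * emeasure \<mu> {x. ennreal ?t < hl u x})"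
      by (simp add: mult_ac)
    also have "\<dots> \<le> ennreal (2 powr q) * ?e j * (ennreal hl_const * (\<integral>\<^sup>+y. u y * indicator (?U j) y \<partial>\<mu>))"
      using hl_weak_type[OF u, of ?t] unfolding U by (intro mult_left_mono) auto
    also have "\<dots> = ?K * (?e j * (\<integral>\<^sup>+y. u y * indicator (?U j) y \<partial>\<mu>))"
      using hl_const_pos by (simp add: ennreal_mult mult_ac)
    also have "\<dots> = (\<integral>\<^sup>+x. ?K * (?e j * (u x * indicator (?U j) x)) \<partial>\<mu>)"
      by (simp add: nn_integral_cmult)
    finally show "?c j * emeasure \<mu> {x. ennreal ?t < hl u x} \<le> (\<integral>\<^sup>+x. ?K * (?e j * (u x * indicator (?U j) x)) \<partial>\<mu>)" .
  qed
  also have "\<dots> = (\<integral>\<^sup>+x. \<integral>\<^sup>+j. ?K * (?e j * (u x * indicator (?U j) x)) \<partial>count_space UNIV \<partial>\<mu>)"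
    by (intro nn_integral_count_space_int_swap[symmetric]) auto
  also have "\<dots> \<le> (\<integral>\<^sup>+x. ?K * (ennreal (2 powr (q - 1) / (1 - 2 powr (- (q - 1)))) * epowr (u x) q) \<partial>\<mu>)"
  proof (rule nn_integral_mono)
    fix x
    have "(\<integral>\<^sup>+j. ?K * (?e j * (u x * indicator (?U j) x)) \<partial>count_space UNIV) =
       ?K * (u x * (\<integral>\<^sup>+j. ?e j * indicator {j. ennreal (2 powr real_of_int j) < 2 * u x} j \<partial>count_space UNIV))"
      by (simp add: nn_integral_cmult[symmetric] indicator_def mult_ac)
    also have "\<dots> \<le> ?K * (ennreal (2 powr (q - 1) / (1 - 2 powr (- (q - 1)))) * epowr (u x) q)"
      using dyadic_sum_le_epowr[OF q, of "u x"] by (rule mult_left_mono) simp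
    finally show "(\<integral>\<^sup>+j. ?K * (?e j * (u x * indicator (?U j) x)) \<partial>count_space UNIV) \<le> \<dots>" .
  qed
  also have "\<dots> = ennreal (hl_strong_const q) * (\<integral>\<^sup>+x. epowr (u x) q \<partial>\<mu>)"
  proof -
    have "ennreal (hl_strong_const q) = ?K * ennreal (2 powr (q - 1) / (1 - 2 powr (- (q - 1))))"
      using hl_const_pos two_powr_neg_less1[of "q - 1"] q
      unfolding hl_strong_const_def by (subst ennreal_mult[symmetric]) (auto simp: mult_ac)
    then show ?thesis by (simp add: nn_integral_cmult mult.assoc)
  qed
  finally show ?thesis .
qed

lemma hl_le_esssup:
  assumes [measurable]: "u \<in> borel_measurable \<mu>"
  shows "hl u x \<le> esssup \<mu> u"
  unfolding hl_def
proof (safe intro!: SUP_least)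
  fix w and r :: real assume r: "0 < r"
  have "(\<integral>\<^sup>+y. u y * indicator (B w r) y \<partial>\<mu>) \<le> (\<integral>\<^sup>+y. esssup \<mu> u * indicator (B w r) y \<partial>\<mu>)"
    using esssup_AE[of u \<mu>]
    by (intro nn_integral_mono_AE) (auto elim!: eventually_mono intro: mult_right_mono)
  also have "\<dots> = esssup \<mu> u * emeasure \<mu> (B w r)" by (simp add: nn_integral_cmult)
  finally show "(\<integral>\<^sup>+y. u y * indicator (B w r) y \<partial>\<mu>) / emeasure \<mu> (B w r) \<le> esssup \<mu> u"
    using less_div_ball[OF r] by (meson not_le)
qed

theorem hl_Lp_bounded:
  assumes "1 < p"
  shows "\<exists>C>0. \<forall>u \<in> borel_measurable \<mu>. eLp_norm \<mu> p (hl u) \<le> ennreal C * eLp_norm \<mu> p u"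
proof (cases "p = \<infinity>")
  case True
  show ?thesis
  proof (intro exI[of _ 1] conjI ballI)
    fix u :: "'a \<Rightarrow> ennreal" assume "u \<in> borel_measurable \<mu>"
    then show "eLp_norm \<mu> p (hl u) \<le> ennreal 1 * eLp_norm \<mu> p u"
      using True by (auto simp: eLp_norm_def intro!: esssup_I hl_le_esssup)
  qed simp
next
  case False
  define q where "q = enn2real p"
  have q: "1 < q"
    using assms False unfolding q_def by (cases p) (auto simp: ennreal_less_iff simp flip: ennreal_1)
  let ?C = "hl_strong_const q powr (1 / q)"
  show ?thesis
  proof (intro exI[of _ ?C] conjI ballI)
    fix u :: "'a \<Rightarrow> ennreal" assume u: "u \<in> borel_measurable \<mu>"
    have "epowr (\<integral>\<^sup>+x. epowr (hl u x) q \<partial>\<mu>) (1 / q) \<le> epowr (ennreal (hl_strong_const q) * (\<integral>\<^sup>+x. epowr (u x) q \<partial>\<mu>)) (1 / q)"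
      using hl_strong_type[OF u q] q by (intro epowr_mono) auto
    also have "\<dots> = ennreal ?C * epowr (\<integral>\<^sup>+x. epowr (u x) q \<partial>\<mu>) (1 / q)"
      using q hl_strong_const_pos[OF q] by (intro epowr_cmult) auto
    finally show "eLp_norm \<mu> p (hl u) \<le> ennreal ?C * eLp_norm \<mu> p u"
      using False by (simp add: eLp_norm_def q_def)
  qed (use hl_strong_const_pos[OF q] in simp)
qed

end

section \<open>Weak-star compactness of the unit ball of \<open>L\<^sup>\<infinity>\<close>\<close>

text \<open>Tychonoff's theorem gives a cluster point of the sequence in a product of discs. Pulling
  its neighbourhoods back to the indices yields a single filter along which all coordinates converge
  at once.\<close>

lemma cluster_filter_coordinatewise:
  fixes a :: "nat \<Rightarrow> 'b \<Rightarrow> complex"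
  assumes "\<And>n A. cmod (a n A) \<le> R A"
  shows "\<exists>F L. F \<noteq> bot \<and> F \<le> sequentially \<and> (\<forall>A. ((\<lambda>n. a n A) \<longlongrightarrow> L A) F)"
proof -
  let ?K = "PiE UNIV (\<lambda>A. cball (0::complex) (R A))"
  have "compactin (product_topology (\<lambda>_. euclidean) UNIV) ?K"
    by (subst compactin_PiE) auto
  then have "compact ?K" by (simp add: euclidean_product_topology)
  moreover have "eventually (\<lambda>x. x \<in> ?K) (filtermap a sequentially)"
    using assms by (auto simp: eventually_filtermap PiE_def extensional_def Pi_def intro!: always_eventually)
  moreover have "filtermap a sequentially \<noteq> bot" by (simp add: filtermap_bot_iff)
  ultimately obtain L where L: "inf (nhds L) (filtermap a sequentially) \<noteq> bot"
    unfolding compact_filter by blast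
  define F where "F = inf sequentially (filtercomap a (nhds L))"
  have "F \<noteq> bot"
  proof
    assume "F = bot"
    then have "eventually (\<lambda>_. False) F" by simp
    then obtain P Q where P: "eventually P sequentially" and Q: "eventually Q (filtercomap a (nhds L))"
      and PQ: "\<And>n. P n \<Longrightarrow> Q n \<Longrightarrow> False"
      unfolding F_def eventually_inf by auto
    obtain Q' where Q': "eventually Q' (nhds L)" "\<And>n. Q' (a n) \<Longrightarrow> Q n"
      using Q unfolding eventually_filtercomap by blast
    have "eventually (\<lambda>y. \<exists>n. P n \<and> a n = y) (filtermap a sequentially)"
      unfolding eventually_filtermap using P by eventually_elim blast
    then have "eventually (\<lambda>_. False) (inf (nhds L) (filtermap a sequentially))"
      unfolding eventually_inf using Q' PQ by blast
    then show False using L by (simp add: eventually_False)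
  qed
  moreover have "F \<le> sequentially" by (simp add: F_def)
  moreover have "((\<lambda>n. a n A) \<longlongrightarrow> L A) F" for A
  proof -
    have "filterlim a (nhds L) F"
      unfolding F_def filterlim_iff_le_filtercomap by simp
    then show ?thesis
      using continuous_on_tendsto_compose[of UNIV "\<lambda>f. f A" a L F] by simp
  qed
  ultimately show ?thesis by blast
qed

lemma (in finite_measure) integrable_indicator_sets:
  "A \<in> sets M \<Longrightarrow> integrable M (indicat_real A)"
  by (simp add: emeasure_eq_measure)

text \<open>The limit set function inherits additivity and the domination \<nu> A \<le> M A from
  functions with values in [0,1]. Domination yields continuity at the empty set, hence countable
  additivity, and also absolute continuity, so that Radon--Nikodym applies.\<close>

lemma (in finite_measure) density_limit:
  fixes v :: "nat \<Rightarrow> 'a \<Rightarrow> real"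
  assumes v [measurable]: "\<And>n. v n \<in> borel_measurable M"
    and v01: "\<And>n x. 0 \<le> v n x" "\<And>n x. v n x \<le> 1"
    and F: "F \<noteq> bot"
    and lim: "\<And>A. A \<in> sets M \<Longrightarrow> ((\<lambda>n. \<integral>x. indicator A x * v n x \<partial>M) \<longlongrightarrow> \<nu> A) F"
  shows "\<exists>\<rho>. integrable M \<rho> \<and> (\<forall>A\<in>sets M. \<nu> A = (\<integral>x. indicator A x * \<rho> x \<partial>M))"
proof -
  have int: "integrable M (\<lambda>x. indicator A x * v n x)" if "A \<in> sets M" for A n
    using that v01 by (intro integrable_const_bound[of _ 1]) (auto split: split_indicator)
  have \<nu>0: "0 \<le> \<nu> A" if "A \<in> sets M" for A
    using v01 by (intro tendsto_lowerbound[OF lim[OF that] _ F]) (auto intro!: always_eventually integral_nonneg)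
  have \<nu>le: "\<nu> A \<le> measure M A" if A: "A \<in> sets M" for A
  proof (rule tendsto_upperbound[OF lim[OF A] _ F], intro always_eventually allI)
    fix n
    have "(\<integral>x. indicator A x * v n x \<partial>M) \<le> (\<integral>x. indicator A x \<partial>M)"
      using v01 A by (intro integral_mono int integrable_indicator_sets) (auto split: split_indicator)
    then show "(\<integral>x. indicator A x * v n x \<partial>M) \<le> measure M A" using A by simp
  qed
  have \<nu>add: "\<nu> (A \<union> A') = \<nu> A + \<nu> A'" if "A \<in> sets M" "A' \<in> sets M" "A \<inter> A' = {}" for A A'
  proof (rule tendsto_unique[OF F lim])
    have "(\<integral>x. indicator (A \<union> A') x * v n x \<partial>M) = (\<integral>x. indicator A x * v n x \<partial>M) + (\<integral>x. indicator A' x * v n x \<partial>M)" for n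
      using that by (subst Bochner_Integration.integral_add[symmetric])
        (auto intro!: int Bochner_Integration.integral_cong split: split_indicator)
    then show "((\<lambda>n. \<integral>x. indicator (A \<union> A') x * v n x \<partial>M) \<longlongrightarrow> \<nu> A + \<nu> A') F"
      using tendsto_add[OF lim lim] that by simp
  qed (use that in auto)
  have ca: "countably_additive (sets M) (\<lambda>A. ennreal (\<nu> A))"
  proof (rule sets.empty_continuous_imp_countably_additive)
    show "positive (sets M) (\<lambda>A. ennreal (\<nu> A))"
      using \<nu>0[of "{}"] \<nu>le[of "{}"] by (simp add: positive_def)
    show "additive (sets M) (\<lambda>A. ennreal (\<nu> A))"
      by (auto simp: additive_def \<nu>add \<nu>0)
    fix A :: "nat \<Rightarrow> 'a set" assume A: "range A \<subseteq> sets M" "decseq A" "(\<Inter>i. A i) = {}"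
    have "(\<lambda>i. measure M (A i)) \<longlonglongrightarrow> measure M (\<Inter>i. A i)"
      using A by (intro finite_Lim_measure_decseq) auto
    then have m: "(\<lambda>i. measure M (A i)) \<longlonglongrightarrow> 0" using A by simp
    have "(\<lambda>i. \<nu> (A i)) \<longlonglongrightarrow> 0"
      by (rule tendsto_sandwich[OF _ _ tendsto_const m]) (use A \<nu>0 \<nu>le in \<open>auto intro!: always_eventually\<close>)
    then show "(\<lambda>i. ennreal (\<nu> (A i))) \<longlonglongrightarrow> 0"
      using tendsto_ennrealI by fastforce
  qed auto
  define N where "N = measure_of (space M) (sets M) (\<lambda>A. ennreal (\<nu> A))"
  have sets_N: "sets N = sets M" by (simp add: N_def sets.sets_measure_of_eq)
  have emN: "emeasure N A = ennreal (\<nu> A)" if "A \<in> sets M" for A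
    unfolding N_def using ca \<nu>0[of "{}"] \<nu>le[of "{}"] that
    by (intro emeasure_measure_of_sigma) (auto simp: positive_def sets.sigma_algebra_axioms)
  have "absolutely_continuous M N"
    using \<nu>le \<nu>0 unfolding absolutely_continuous_def null_sets_def
    by (auto simp: sets_N emN emeasure_eq_measure) (metis ennreal_eq_0_iff order_antisym)
  then obtain f where f [measurable]: "f \<in> borel_measurable M" and fN: "density M f = N"
    using Radon_Nikodym sets_N by blast
  have emf: "(\<integral>\<^sup>+x. f x * indicator A x \<partial>M) = ennreal (\<nu> A)" if "A \<in> sets M" for A
    using that emN[OF that] unfolding fN[symmetric] by (simp add: emeasure_density)
  have "(\<integral>\<^sup>+x. f x \<partial>M) = (\<integral>\<^sup>+x. f x * indicator (space M) x \<partial>M)"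
    by (intro nn_integral_cong) simp
  then have fin: "(\<integral>\<^sup>+x. f x \<partial>M) < \<infinity>" using emf[of "space M"] by simp
  then have f_AE: "AE x in M. f x = ennreal (enn2real (f x))"
    using nn_integral_PInf_AE[of f M] by (auto elim!: eventually_mono simp: less_top)
  define \<rho> where "\<rho> = (\<lambda>x. enn2real (f x))"
  have \<rho> [measurable]: "\<rho> \<in> borel_measurable M" unfolding \<rho>_def by measurable
  have "(\<integral>\<^sup>+x. ennreal (\<rho> x) \<partial>M) = (\<integral>\<^sup>+x. f x \<partial>M)"
    using f_AE by (intro nn_integral_cong_AE) (auto elim!: eventually_mono simp: \<rho>_def)
  then have "integrable M \<rho>" using fin by (intro integrableI_nonneg) (auto simp: \<rho>_def)
  moreover have "\<nu> A = (\<integral>x. indicator A x * \<rho> x \<partial>M)" if A: "A \<in> sets M" for A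
  proof -
    have "ennreal (\<nu> A) = (\<integral>\<^sup>+x. ennreal (indicator A x * \<rho> x) \<partial>M)"
      unfolding emf[OF A, symmetric] using f_AE
      by (intro nn_integral_cong_AE) (auto elim!: eventually_mono simp: \<rho>_def split: split_indicator)
    then have "enn2real (\<integral>\<^sup>+x. ennreal (indicator A x * \<rho> x) \<partial>M) = \<nu> A"
      using \<nu>0[OF A] by (metis enn2real_ennreal)
    moreover have "(\<integral>x. indicator A x * \<rho> x \<partial>M) = enn2real (\<integral>\<^sup>+x. ennreal (indicator A x * \<rho> x) \<partial>M)"
      using A by (intro integral_eq_nn_integral) (auto simp: \<rho>_def)
    ultimately show ?thesis by simp
  qed
  ultimately show ?thesis by blast
qed

text \<open>The functionals \<psi> \<mapsto> \<integral> u_n \<psi> are bounded on L^1 by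
  \<open>K\<close> uniformly in n, so convergence on a dense set suffices; simple functions reduce
  to indicators of sets of finite measure.\<close>

lemma tendsto_integral_L1:
  fixes u :: "nat \<Rightarrow> 'a \<Rightarrow> complex"
  assumes [measurable]: "\<And>n. u n \<in> borel_measurable M" "g \<in> borel_measurable M"
    and u: "\<And>n x. cmod (u n x) \<le> K" and g: "\<And>x. cmod (g x) \<le> K"
    and lim: "\<And>A. A \<in> sets M \<Longrightarrow> emeasure M A < \<infinity> \<Longrightarrow>
      ((\<lambda>n. \<integral>x. u n x * indicator A x \<partial>M) \<longlongrightarrow> (\<integral>x. g x * indicator A x \<partial>M)) F"
    and \<psi>: "integrable M (\<psi> :: 'a \<Rightarrow> complex)"
  shows "((\<lambda>n. \<integral>x. u n x * \<psi> x \<partial>M) \<longlongrightarrow> (\<integral>x. g x * \<psi> x \<partial>M)) F"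
proof -
  have K: "0 \<le> K" using g[of undefined] norm_ge_zero order_trans by blast
  have bdd: "integrable M (\<lambda>x. w x * \<psi> x)" "cmod (\<integral>x. w x * \<psi> x \<partial>M) \<le> K * (\<integral>x. cmod (\<psi> x) \<partial>M)"
    if [measurable]: "w \<in> borel_measurable M" and w: "\<And>x. cmod (w x) \<le> K" and \<psi>: "integrable M \<psi>"
    for w \<psi> :: "'a \<Rightarrow> complex"
  proof -
    have [measurable]: "\<psi> \<in> borel_measurable M" using \<psi> by (rule borel_measurable_integrable)
    have le: "cmod (w x * \<psi> x) \<le> K * cmod (\<psi> x)" for x
      unfolding norm_mult by (intro mult_right_mono w) simp
    show i: "integrable M (\<lambda>x. w x * \<psi> x)"
    proof (rule Bochner_Integration.integrable_bound)
      show "integrable M (\<lambda>x. K * cmod (\<psi> x))" using \<psi> by simp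
    qed (use le K in \<open>auto intro!: AE_I2\<close>)
    have "cmod (\<integral>x. w x * \<psi> x \<partial>M) \<le> (\<integral>x. cmod (w x * \<psi> x) \<partial>M)" by (rule integral_norm_bound)
    also have "\<dots> \<le> (\<integral>x. K * cmod (\<psi> x) \<partial>M)"
      using i \<psi> le by (intro integral_mono) auto
    finally show "cmod (\<integral>x. w x * \<psi> x \<partial>M) \<le> K * (\<integral>x. cmod (\<psi> x) \<partial>M)" by simp
  qed
  show ?thesis
    using \<psi>
  proof (induction \<psi> rule: integrable_induct)
    case (base A c)
    have "((\<lambda>n. (\<integral>x. u n x * indicator A x \<partial>M) * c) \<longlongrightarrow> (\<integral>x. g x * indicator A x \<partial>M) * c) F"
      using base by (intro tendsto_mult lim tendsto_const) auto
    moreover have "(\<integral>x. w x * (indicat_real A x *\<^sub>R c) \<partial>M) = (\<integral>x. w x * indicator A x \<partial>M) * c" for w :: "'a \<Rightarrow> complex"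
      by (subst integral_mult_left_zero[symmetric]) (rule Bochner_Integration.integral_cong, auto simp: indicator_def)
    ultimately show ?case by simp
  next
    case (add f h)
    have "(\<integral>x. w x * (f x + h x) \<partial>M) = (\<integral>x. w x * f x \<partial>M) + (\<integral>x. w x * h x \<partial>M)"
      if "w \<in> borel_measurable M" "\<And>x. cmod (w x) \<le> K" for w
      using bdd(1)[of w f] bdd(1)[of w h] that add by (simp add: distrib_left)
    then show ?case using tendsto_add[OF add.IH] u g by simp
  next
    case (lim f s)
    show ?case
    proof (rule tendstoI)
      fix e :: real assume e: "0 < e"
      have "(\<lambda>i. \<integral>x. cmod (f x - s i x) \<partial>M) \<longlonglongrightarrow> (\<integral>x. 0 \<partial>M)"
      proof (rule integral_dominated_convergence)
        \<comment> \<open>The approximants satisfy |s_i| \<le> 2|f|, so |f - s_i| \<le>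
          3|f|.\<close>
        show "integrable M (\<lambda>x. 3 * cmod (f x))" using lim by auto
        show "AE x in M. (\<lambda>i. cmod (f x - s i x)) \<longlonglongrightarrow> 0"
        proof (rule AE_I2)
          fix x assume "x \<in> space M"
          then have "(\<lambda>i. s i x) \<longlonglongrightarrow> f x" using lim by auto
          then have "(\<lambda>i. cmod (f x - s i x)) \<longlonglongrightarrow> cmod (f x - f x)" by (intro tendsto_intros)
          then show "(\<lambda>i. cmod (f x - s i x)) \<longlonglongrightarrow> 0" by simp
        qed
        fix i
        show "AE x in M. norm (cmod (f x - s i x)) \<le> 3 * cmod (f x)"
        proof (rule AE_I2)
          fix x assume "x \<in> space M"
          then have "cmod (s i x) \<le> 2 * cmod (f x)" using lim by auto
          then show "norm (cmod (f x - s i x)) \<le> 3 * cmod (f x)"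
            using norm_triangle_ineq4[of "f x" "s i x"] by simp
        qed
      qed (use lim in \<open>auto intro!: borel_measurable_integrable\<close>)
      then have "\<forall>\<^sub>F i in sequentially. (\<integral>x. cmod (f x - s i x) \<partial>M) < e / (3 * (K + 1))"
        using e K by (intro order_tendstoD(2)[where y="\<integral>x. 0 \<partial>M"]) auto
      then obtain i where i: "(\<integral>x. cmod (f x - s i x) \<partial>M) < e / (3 * (K + 1))"
        using eventually_happens by force
      have fs: "integrable M (\<lambda>x. f x - s i x)" using lim by auto
      have close: "cmod ((\<integral>x. w x * f x \<partial>M) - (\<integral>x. w x * s i x \<partial>M)) < e / 3"
        if w: "w \<in> borel_measurable M" "\<And>x. cmod (w x) \<le> K" for w
      proof -
        have "(\<integral>x. w x * f x \<partial>M) - (\<integral>x. w x * s i x \<partial>M) = (\<integral>x. w x * (f x - s i x) \<partial>M)"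
          using bdd(1)[OF w, of f] bdd(1)[OF w, of "s i"] lim by (simp add: right_diff_distrib)
        also have "cmod \<dots> \<le> K * (\<integral>x. cmod (f x - s i x) \<partial>M)" by (rule bdd(2)[OF w fs])
        also have "\<dots> \<le> (K + 1) * (\<integral>x. cmod (f x - s i x) \<partial>M)" by (intro mult_right_mono) auto
        also have "\<dots> < (K + 1) * (e / (3 * (K + 1)))" using i K by (intro mult_strict_left_mono) auto
        also have "\<dots> = e / 3" using K by (simp add: divide_simps)
        finally show ?thesis .
      qed
      have "\<forall>\<^sub>F n in F. dist (\<integral>x. u n x * s i x \<partial>M) (\<integral>x. g x * s i x \<partial>M) < e / 3"
        using lim.IH[of i] e by (intro tendstoD) auto
      then show "\<forall>\<^sub>F n in F. dist (\<integral>x. u n x * f x \<partial>M) (\<integral>x. g x * f x \<partial>M) < e"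
      proof eventually_elim
        case (elim n)
        have "cmod ((\<integral>x. u n x * f x \<partial>M) - (\<integral>x. g x * f x \<partial>M))
          \<le> cmod ((\<integral>x. u n x * f x \<partial>M) - (\<integral>x. u n x * s i x \<partial>M))
           + cmod ((\<integral>x. u n x * s i x \<partial>M) - (\<integral>x. g x * s i x \<partial>M))
           + cmod ((\<integral>x. g x * f x \<partial>M) - (\<integral>x. g x * s i x \<partial>M))"
          by norm
        then show ?case
          using elim close[of "u n"] close[of g] u g by (simp add: dist_norm)
      qed
    qed
  qed
qed

text \<open>This is the Banach--Alaoglu theorem for the unit ball of \<open>L\<^sup>\<infinity>\<close>; cluster points along a filter
  replace subsequences, so that separability of \<open>L\<^sup>1\<close> plays no role.\<close>

theorem (in sigma_finite_measure) weak_star_cluster: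
  fixes u :: "nat \<Rightarrow> 'a \<Rightarrow> complex"
  assumes u [measurable]: "\<And>n. u n \<in> borel_measurable M" and u1: "\<And>n x. cmod (u n x) \<le> 1"
  shows "\<exists>F g. F \<noteq> bot \<and> F \<le> sequentially \<and> g \<in> borel_measurable M \<and> (\<forall>x. cmod (g x) \<le> 1) \<and>
    (\<forall>\<psi> :: 'a \<Rightarrow> complex. integrable M \<psi> \<longrightarrow> ((\<lambda>n. \<integral>x. u n x * \<psi> x \<partial>M) \<longlongrightarrow> (\<integral>x. g x * \<psi> x \<partial>M)) F)"
proof -
  obtain w :: "'a \<Rightarrow> real" where w [measurable]: "w \<in> borel_measurable M"
    and w0: "\<And>x. 0 < w x" and wi: "integrable M w"
    by (rule obtain_positive_integrable_function) metis
  \<comment> \<open>Weighting by a positive integrable function gives a finite measure with the same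
    null sets, for which every measurable set has an integrable indicator.\<close>
  define N where "N = density M (\<lambda>x. ennreal (w x))"
  have [measurable_cong]: "sets N = sets M" by (simp add: N_def)
  interpret N: finite_measure N
  proof
    have "emeasure N (space N) = (\<integral>\<^sup>+x. ennreal (w x) \<partial>M)"
      by (simp add: N_def emeasure_density cong: nn_integral_cong)
    also have "\<dots> < \<infinity>" using wi w0 less_imp_le by (subst nn_integral_eq_integral) auto
    finally show "emeasure N (space N) \<noteq> \<infinity>" by simp
  qed
  have intN: "integrable N (\<lambda>x. h x * indicator A x)" "cmod (\<integral>x. h x * indicator A x \<partial>N) \<le> K * measure N A"
    if [measurable]: "h \<in> borel_measurable M" and h: "\<And>x. cmod (h x) \<le> K" and A [measurable]: "A \<in> sets M"
    for h :: "'a \<Rightarrow> complex" and A K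
  proof -
    show i: "integrable N (\<lambda>x. h x * indicator A x)"
    proof (rule N.integrable_const_bound[of _ K])
      have "0 \<le> K" using norm_ge_zero h by (rule order_trans)
      then show "AE x in N. cmod (h x * indicator A x) \<le> K"
        using h by (intro AE_I2) (simp split: split_indicator)
    qed measurable
    have "cmod (\<integral>x. h x * indicator A x \<partial>N) \<le> (\<integral>x. cmod (h x * indicator A x) \<partial>N)" by (rule integral_norm_bound)
    also have "\<dots> \<le> (\<integral>x. K * indicator A x \<partial>N)"
      using i h by (intro integral_mono integrable_mult_right N.integrable_indicator_sets) (auto split: split_indicator)
    finally show "cmod (\<integral>x. h x * indicator A x \<partial>N) \<le> K * measure N A" by simp
  qed
  \<comment> \<open>All subsets index the product space; the value 0 off the sigma-algebra keeps the
    bound by \<open>measure N\<close> true for each of them.\<close>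
  define a where "a = (\<lambda>n A. if A \<in> sets M then \<integral>x. u n x * indicator A x \<partial>N else 0)"
  have "cmod (a n A) \<le> measure N A" for n A
    using intN(2)[OF u u1] by (simp add: a_def)
  from cluster_filter_coordinatewise[of a "measure N", OF this]
  obtain F L where F: "F \<noteq> bot" "F \<le> sequentially" and L: "\<And>A. ((\<lambda>n. a n A) \<longlongrightarrow> L A) F"
    by (metis (no_types))
  have limA: "((\<lambda>n. \<integral>x. u n x * indicator A x \<partial>N) \<longlongrightarrow> L A) F" if "A \<in> sets M" for A
    using L[of A] that by (simp add: a_def)
  \<comment> \<open>Stated for a real-linear \<open>r\<close>, so that real and imaginary parts are
    covered together.\<close>
  have part: "\<exists>\<rho>. integrable N \<rho> \<and> (\<forall>A\<in>sets M. r (L A) = (\<integral>x. indicator A x * \<rho> x \<partial>N))"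
    if r: "bounded_linear r" "\<And>z. \<bar>r z\<bar> \<le> cmod z" and r_meas [measurable]: "r \<in> borel_measurable borel"
    for r :: "complex \<Rightarrow> real"
  proof -
    have ru: "\<bar>r (u n x)\<bar> \<le> 1" for n x using r(2) u1 order_trans by blast
    have ir: "(\<integral>x. indicator A x * r (u n x) \<partial>N) = r (\<integral>x. u n x * indicator A x \<partial>N)"
      "integrable N (\<lambda>x. indicator A x * r (u n x))" if A: "A \<in> sets M" for A n
    proof -
      have e: "indicator A x * r (u n x) = r (u n x * indicator A x)" for x
        using bounded_linear.linear[OF r(1)] by (auto simp: indicator_def linear_0)
      show "(\<integral>x. indicator A x * r (u n x) \<partial>N) = r (\<integral>x. u n x * indicator A x \<partial>N)"
        unfolding e by (rule integral_bounded_linear[OF r(1) intN(1)[OF u u1 A]])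
      show "integrable N (\<lambda>x. indicator A x * r (u n x))"
        unfolding e by (rule integrable_bounded_linear[OF r(1) intN(1)[OF u u1 A]])
    qed
    have "\<exists>\<rho>. integrable N \<rho> \<and> (\<forall>A\<in>sets N. (r (L A) + measure N A) / 2 = (\<integral>x. indicator A x * \<rho> x \<partial>N))"
    \<comment> \<open>The affine map t \<mapsto> (t+1)/2 carries [-1,1] into [0,1], as
      \<open>density_limit\<close> requires; it is undone afterwards by 2\<rho> - 1.\<close>
    proof (rule N.density_limit[where v="\<lambda>n x. (r (u n x) + 1) / 2" and F=F])
      fix A assume "A \<in> sets N"
      then have A [measurable]: "A \<in> sets M" by (simp add: N_def)
      have "(\<integral>x. indicator A x * ((r (u n x) + 1) / 2) \<partial>N) = (r (\<integral>x. u n x * indicator A x \<partial>N) + measure N A) / 2" for n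
      proof -
        have "(\<integral>x. indicator A x * ((r (u n x) + 1) / 2) \<partial>N) = (\<integral>x. (indicator A x * r (u n x) + indicator A x) / 2 \<partial>N)"
          by (rule Bochner_Integration.integral_cong) (auto split: split_indicator simp: field_simps)
        also have "\<dots> = ((\<integral>x. indicator A x * r (u n x) \<partial>N) + measure N A) / 2"
          using ir(2)[OF A] by (simp add: N.emeasure_eq_measure)
        finally show ?thesis using ir(1)[OF A] by simp
      qed
      moreover have "((\<lambda>n. (r (\<integral>x. u n x * indicator A x \<partial>N) + measure N A) / 2) \<longlongrightarrow> (r (L A) + measure N A) / 2) F"
        by (intro tendsto_intros bounded_linear.tendsto[OF r(1)] limA A) auto
      ultimately show "((\<lambda>n. \<integral>x. indicator A x * ((r (u n x) + 1) / 2) \<partial>N) \<longlongrightarrow> (r (L A) + measure N A) / 2) F"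
        by simp
    next
      fix n x show "0 \<le> (r (u n x) + 1) / 2" "(r (u n x) + 1) / 2 \<le> 1" using ru[of n x] by (auto simp: abs_le_iff)
    next
      fix n show "(\<lambda>x. (r (u n x) + 1) / 2) \<in> borel_measurable N" by measurable
    qed (rule F(1))
    then obtain \<rho> where i\<rho>: "integrable N \<rho>"
      and \<rho>L: "\<And>A. A \<in> sets M \<Longrightarrow> (r (L A) + measure N A) / 2 = (\<integral>x. indicator A x * \<rho> x \<partial>N)"
      by (auto simp: N_def)
    have "r (L A) = (\<integral>x. indicator A x * (2 * \<rho> x - 1) \<partial>N)" if A [measurable]: "A \<in> sets M" for A
    proof -
      have i: "integrable N (\<lambda>x. indicator A x * \<rho> x)"
        using integrable_real_mult_indicator[OF _ i\<rho>, of A] by (simp add: mult.commute)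
      have "(\<integral>x. indicator A x * (2 * \<rho> x - 1) \<partial>N) = (\<integral>x. 2 * (indicator A x * \<rho> x) - indicator A x \<partial>N)"
        by (rule Bochner_Integration.integral_cong) (auto split: split_indicator)
      also have "\<dots> = 2 * (\<integral>x. indicator A x * \<rho> x \<partial>N) - measure N A"
        using i by (simp add: N.emeasure_eq_measure)
      finally show ?thesis using \<rho>L[OF A] by simp
    qed
    then show ?thesis using i\<rho> by (intro exI[of _ "\<lambda>x. 2 * \<rho> x - 1"]) auto
  qed
  obtain \<rho>1 where \<rho>1: "integrable N \<rho>1" "\<And>A. A \<in> sets M \<Longrightarrow> Re (L A) = (\<integral>x. indicator A x * \<rho>1 x \<partial>N)"
    using part[OF bounded_linear_Re abs_Re_le_cmod] by auto
  obtain \<rho>2 where \<rho>2: "integrable N \<rho>2" "\<And>A. A \<in> sets M \<Longrightarrow> Im (L A) = (\<integral>x. indicator A x * \<rho>2 x \<partial>N)"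
    using part[OF bounded_linear_Im abs_Im_le_cmod] by auto
  define g0 where "g0 = (\<lambda>x. complex_of_real (\<rho>1 x) + \<i> * complex_of_real (\<rho>2 x))"
  have g0: "integrable N g0" unfolding g0_def using \<rho>1(1) \<rho>2(1) by simp
  have LA: "set_lebesgue_integral N A g0 = L A" if A: "A \<in> sets M" for A
  proof -
    have i: "integrable N (\<lambda>x. indicator A x *\<^sub>R g0 x)" using A g0 by (intro integrable_mult_indicator) simp
    have "Re (set_lebesgue_integral N A g0) = (\<integral>x. Re (indicator A x *\<^sub>R g0 x) \<partial>N)"
      "Im (set_lebesgue_integral N A g0) = (\<integral>x. Im (indicator A x *\<^sub>R g0 x) \<partial>N)"
      unfolding set_lebesgue_integral_def by (rule integral_Re[OF i, symmetric], rule integral_Im[OF i, symmetric])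
    then show ?thesis using \<rho>1(2)[OF A] \<rho>2(2)[OF A] by (simp add: complex_eq_iff g0_def)
  qed
  have Lle: "cmod (L A) \<le> measure N A" if A: "A \<in> sets M" for A
    using intN(2)[OF u u1 A]
    by (intro tendsto_upperbound[OF tendsto_norm[OF limA[OF A]] _ F(1)] always_eventually) simp
  \<comment> \<open>All averages of \<open>g0\<close> over sets of positive measure lie in the
    closed unit disc, hence so do almost all of its values. Redefining it elsewhere gives a bound at
    every point.\<close>
  have "AE x in N. g0 x \<in> cball 0 1"
  proof (rule N.averaging_theorem[OF g0 closed_cball])
    fix A assume A: "A \<in> sets N" "0 < measure N A"
    then have "A \<in> sets M" by (simp add: N_def)
    then show "(1 / measure N A) *\<^sub>R set_lebesgue_integral N A g0 \<in> cball 0 1"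
      using Lle[of A] LA[of A] A(2) by simp
  qed
  then have g01: "AE x in N. cmod (g0 x) \<le> 1" by simp
  define g where "g = (\<lambda>x. if cmod (g0 x) \<le> 1 then g0 x else 0)"
  have [measurable]: "g0 \<in> borel_measurable M" using borel_measurable_integrable[OF g0] by (simp add: N_def)
  have [measurable]: "g \<in> borel_measurable M" unfolding g_def by measurable
  have g1: "cmod (g x) \<le> 1" for x by (simp add: g_def)
  have limN: "((\<lambda>n. \<integral>x. u n x * \<psi> x \<partial>N) \<longlongrightarrow> (\<integral>x. g x * \<psi> x \<partial>N)) F" if "integrable N \<psi>" for \<psi> :: "'a \<Rightarrow> complex"
  proof (rule tendsto_integral_L1[where K=1])
    fix A assume "A \<in> sets N"
    then have A [measurable]: "A \<in> sets M" by (simp add: N_def)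
    have "(\<integral>x. g x * indicator A x \<partial>N) = set_lebesgue_integral N A g0"
      unfolding set_lebesgue_integral_def
      using g01 by (intro integral_cong_AE) (auto elim!: eventually_mono simp: g_def split: split_indicator)
    then show "((\<lambda>n. \<integral>x. u n x * indicator A x \<partial>N) \<longlongrightarrow> (\<integral>x. g x * indicator A x \<partial>N)) F"
      using limA[OF A] LA[OF A] by simp
  qed (use that u1 g1 in auto)
  have "((\<lambda>n. \<integral>x. u n x * \<psi> x \<partial>M) \<longlongrightarrow> (\<integral>x. g x * \<psi> x \<partial>M)) F" if \<psi>: "integrable M \<psi>" for \<psi> :: "'a \<Rightarrow> complex"
  proof -
    have [measurable]: "\<psi> \<in> borel_measurable M" using \<psi> by auto
    \<comment> \<open>Dividing by the weight turns integrals over \<open>M\<close> into integrals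
      over \<open>N\<close>.\<close>
    define \<psi>' where "\<psi>' = (\<lambda>x. \<psi> x / complex_of_real (w x))"
    have [measurable]: "\<psi>' \<in> borel_measurable M" unfolding \<psi>'_def by measurable
    have w_ne: "w x \<noteq> 0" for x using w0[of x] by simp
    have "integrable N \<psi>'"
      unfolding N_def using \<psi> w0 w_ne by (subst integrable_density) (auto simp: \<psi>'_def scaleR_conv_of_real less_imp_le)
    moreover have conv: "(\<integral>x. h x * \<psi>' x \<partial>N) = (\<integral>x. h x * \<psi> x \<partial>M)" if [measurable]: "h \<in> borel_measurable M" for h
      unfolding N_def using w0 w_ne
      by (subst integral_density) (auto simp: \<psi>'_def scaleR_conv_of_real less_imp_le intro!: Bochner_Integration.integral_cong)
    ultimately show ?thesis using limN[of \<psi>'] by simp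
  qed
  then show ?thesis
    by (intro exI[of _ F] exI[of _ g] conjI allI impI F) (simp_all add: g_def)
qed

section \<open>Test functions\<close>

context hts
begin

section \<open>Linear operations and norms of test functions\<close>

abbreviation "tb \<equiv> test_bound d \<mu> A0"
abbreviation "ts \<equiv> test_space d \<mu> A0"
abbreviation "tn \<equiv> test_norm d \<mu> A0"

lemma test_bound_add:
  "tb x r \<beta> \<gamma> f C \<Longrightarrow> tb x r \<beta> \<gamma> g C' \<Longrightarrow> tb x r \<beta> \<gamma> (\<lambda>y. f y + g y) (C + C')"
  unfolding test_bound_def distrib_right
proof (intro conjI allI impI; elim conjE)
  fix y
  assume "\<forall>y. cmod (f y) \<le> C * sz x r \<gamma> y" "\<forall>y. cmod (g y) \<le> C' * sz x r \<gamma> y"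
  then show "cmod (f y + g y) \<le> C * sz x r \<gamma> y + C' * sz x r \<gamma> y"
    by (intro norm_triangle_le add_mono) auto
next
  fix y z
  let ?e = "\<lambda>C. C * (d y z / (r + d x y)) powr \<beta> * sz x r \<gamma> y"
  assume "d y z \<le> inverse (2 * A0) * (r + d x y)"
    and "\<forall>y z. d y z \<le> inverse (2 * A0) * (r + d x y) \<longrightarrow> cmod (f y - f z) \<le> C * (d y z / (r + d x y)) powr \<beta> * sz x r \<gamma> y"
    and "\<forall>y z. d y z \<le> inverse (2 * A0) * (r + d x y) \<longrightarrow> cmod (g y - g z) \<le> C' * (d y z / (r + d x y)) powr \<beta> * sz x r \<gamma> y"
  then have "cmod (f y - f z) + cmod (g y - g z) \<le> ?e C + ?e C'" by (intro add_mono) auto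
  moreover have "cmod (f y + g y - (f z + g z)) \<le> cmod (f y - f z) + cmod (g y - g z)"
    using norm_triangle_ineq[of "f y - f z" "g y - g z"] by (simp add: algebra_simps)
  ultimately show "cmod (f y + g y - (f z + g z)) \<le> ?e C + ?e C'" by linarith
qed

lemma test_bound_cmult:
  assumes "tb x r \<beta> \<gamma> f C"
  shows "tb x r \<beta> \<gamma> (\<lambda>y. c * f y) (cmod c * C)"
  unfolding test_bound_def
proof (intro conjI allI impI)
  fix y
  have "cmod c * cmod (f y) \<le> cmod c * (C * sz x r \<gamma> y)"
    using assms unfolding test_bound_def by (intro mult_left_mono) auto
  then show "cmod (c * f y) \<le> cmod c * C * sz x r \<gamma> y" by (simp add: norm_mult mult.assoc)
next
  fix y z assume "d y z \<le> inverse (2 * A0) * (r + d x y)"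
  then have "cmod c * cmod (f y - f z) \<le> cmod c * (C * (d y z / (r + d x y)) powr \<beta> * sz x r \<gamma> y)"
    using assms unfolding test_bound_def by (intro mult_left_mono) auto
  then show "cmod (c * f y - c * f z) \<le> cmod c * C * (d y z / (r + d x y)) powr \<beta> * sz x r \<gamma> y"
    by (simp add: norm_mult mult.assoc flip: right_diff_distrib)
qed

lemma test_bound_mono:
  assumes "tb x r \<beta> \<gamma> f C" "C \<le> C'" "0 < r"
  shows "tb x r \<beta> \<gamma> f C'"
  unfolding test_bound_def
proof (intro conjI allI impI)
  fix y
  have "cmod (f y) \<le> C * sz x r \<gamma> y" using assms(1) unfolding test_bound_def by blast
  also have "\<dots> \<le> C' * sz x r \<gamma> y" using assms by (intro mult_right_mono) auto
  finally show "cmod (f y) \<le> C' * sz x r \<gamma> y" .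
next
  fix y z assume "d y z \<le> inverse (2 * A0) * (r + d x y)"
  then have "cmod (f y - f z) \<le> C * (d y z / (r + d x y)) powr \<beta> * sz x r \<gamma> y"
    using assms(1) unfolding test_bound_def by blast
  also have "\<dots> \<le> C' * (d y z / (r + d x y)) powr \<beta> * sz x r \<gamma> y" using assms by (intro mult_right_mono) auto
  finally show "cmod (f y - f z) \<le> C' * (d y z / (r + d x y)) powr \<beta> * sz x r \<gamma> y" .
qed

lemma test_bound_diff:
  "tb x r \<beta> \<gamma> f C \<Longrightarrow> tb x r \<beta> \<gamma> g C' \<Longrightarrow> tb x r \<beta> \<gamma> (\<lambda>y. f y - g y) (C + C')"
  using test_bound_add[of x r \<beta> \<gamma> f C "\<lambda>y. - 1 * g y"] test_bound_cmult[of x r \<beta> \<gamma> g C' "- 1"] by simp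

lemma test_space_add: "f \<in> ts x r \<beta> \<gamma> \<Longrightarrow> g \<in> ts x r \<beta> \<gamma> \<Longrightarrow> (\<lambda>y. f y + g y) \<in> ts x r \<beta> \<gamma>"
  unfolding test_space_def by (blast intro: test_bound_add add_pos_pos)

lemma test_space_diff: "f \<in> ts x r \<beta> \<gamma> \<Longrightarrow> g \<in> ts x r \<beta> \<gamma> \<Longrightarrow> (\<lambda>y. f y - g y) \<in> ts x r \<beta> \<gamma>"
  unfolding test_space_def by (blast intro: test_bound_diff add_pos_pos)

lemma test_spaceI: "tb x r \<beta> \<gamma> f C \<Longrightarrow> 0 < r \<Longrightarrow> f \<in> ts x r \<beta> \<gamma>"
  unfolding test_space_def
  by (auto intro!: exI[of _ "max C 1"] elim: test_bound_mono)

lemma test_space_cmult: "f \<in> ts x r \<beta> \<gamma> \<Longrightarrow> 0 < r \<Longrightarrow> (\<lambda>y. c * f y) \<in> ts x r \<beta> \<gamma>"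
  using test_bound_cmult test_spaceI unfolding test_space_def by blast

lemma test_norm_le:
  assumes "tb x r \<beta> \<gamma> f C" "0 < C"
  shows "tn x r \<beta> \<gamma> f \<le> C"
  unfolding test_norm_def using assms by (intro cInf_lower bdd_belowI[of _ 0]) auto

text \<open>The strict inequality is essential: the infimum of the admissible constants need not be
  admissible, as the zero function shows.\<close>

lemma test_norm_lessD:
  assumes "f \<in> ts x r \<beta> \<gamma>" "tn x r \<beta> \<gamma> f < C" "0 < r"
  shows "tb x r \<beta> \<gamma> f C"
proof -
  have "{C. 0 < C \<and> tb x r \<beta> \<gamma> f C} \<noteq> {}" using assms by (auto simp: test_space_def)
  from cInf_lessD[OF this] assms(2) obtain C' where "tb x r \<beta> \<gamma> f C'" "C' < C"
    unfolding test_norm_def by blast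
  then show ?thesis using assms by (auto elim: test_bound_mono)
qed

lemma test_norm_nonneg:
  assumes "f \<in> ts x r \<beta> \<gamma>"
  shows "0 \<le> tn x r \<beta> \<gamma> f"
  unfolding test_norm_def using assms by (intro cInf_greatest) (auto simp: test_space_def)

lemma test_continuous:
  assumes "tb x r \<beta> \<gamma> f C" "0 < \<beta>" "0 < r"
  shows "continuous_on UNIV f"
proof (rule continuous_hoelder[OF assms(2)])
  fix y
  have pos: "0 < r + d x y" using assms(3) by (intro add_pos_nonneg) auto
  show "\<exists>\<rho>>0. \<exists>C. \<forall>z. d y z < \<rho> \<longrightarrow> dist (f y) (f z) \<le> C * d y z powr \<beta>"
  proof (intro exI conjI allI impI)
    show "0 < inverse (2 * A0) * (r + d x y)" using pos A0_ge1 by simp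
    fix z assume "d y z < inverse (2 * A0) * (r + d x y)"
    then have "cmod (f y - f z) \<le> C * (d y z / (r + d x y)) powr \<beta> * sz x r \<gamma> y"
      using assms(1) unfolding test_bound_def by (meson less_imp_le)
    then show "dist (f y) (f z) \<le> C * sz x r \<gamma> y / (r + d x y) powr \<beta> * d y z powr \<beta>"
      using pos by (simp add: dist_norm powr_divide mult_ac)
  qed
qed

text \<open>Both quotients that are raised to powers are at most 1, the one in the regularity
  condition because 1/(2 A0) \<le> 1; lowering exponents therefore enlarges the right-hand
  sides.\<close>

lemma test_bound_exponents:
  assumes "tb x r \<eta> \<eta>' f C" "0 < r" "\<beta> \<le> \<eta>" "0 < \<beta>" "0 < \<gamma>" "\<gamma> \<le> \<eta>'" "0 \<le> C"
  shows "tb x r \<beta> \<gamma> f C"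
proof -
  have pos: "0 < r + d x y" for y using assms(2) by (intro add_pos_nonneg) auto
  have sz: "sz x r \<eta>' y \<le> sz x r \<gamma> y" for y
    unfolding test_size_def using assms pos[of y]
    by (intro mult_left_mono powr_mono') (auto simp: V2_eq)
  show ?thesis
    unfolding test_bound_def
  proof (intro conjI allI impI)
    fix y
    show "cmod (f y) \<le> C * sz x r \<gamma> y"
      using assms(1) mult_left_mono[OF sz[of y] assms(7)] unfolding test_bound_def by (meson order_trans)
  next
    fix y z assume yz: "d y z \<le> inverse (2 * A0) * (r + d x y)"
    have "inverse (2 * A0) \<le> 1" using A0_ge1 by (intro inverse_le_1_iff[THEN iffD2]) simp
    then have "inverse (2 * A0) * (r + d x y) \<le> 1 * (r + d x y)" using pos[of y] by (intro mult_right_mono) auto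
    then have "d y z / (r + d x y) \<le> 1" using yz pos[of y] by simp
    then have p: "(d y z / (r + d x y)) powr \<eta> \<le> (d y z / (r + d x y)) powr \<beta>"
      using assms pos[of y] by (intro powr_mono') auto
    have "cmod (f y - f z) \<le> C * (d y z / (r + d x y)) powr \<eta> * sz x r \<eta>' y"
      using assms(1) yz unfolding test_bound_def by blast
    also have "\<dots> \<le> C * (d y z / (r + d x y)) powr \<beta> * sz x r \<gamma> y"
      using assms p sz by (intro mult_mono) auto
    finally show "cmod (f y - f z) \<le> C * (d y z / (r + d x y)) powr \<beta> * sz x r \<gamma> y" .
  qed
qed

section \<open>Polynomial decay weights and interpolation\<close>

definition decay :: "'a \<Rightarrow> real \<Rightarrow> 'a \<Rightarrow> real" where
  "decay x r y = 1 + d x y / r"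

lemma decay_ge1 [simp]: "0 < r \<Longrightarrow> 1 \<le> decay x r y"
  by (simp add: decay_def)

lemma decay_pos [simp]: "0 < r \<Longrightarrow> 0 < decay x r y"
  using decay_ge1[of r x y] by linarith

lemma decay_nonneg [simp]: "0 < r \<Longrightarrow> 0 \<le> decay x r y"
  and decay_ne0 [simp]: "0 < r \<Longrightarrow> decay x r y \<noteq> 0"
  using decay_ge1[of r x y] by (linarith, force simp del: decay_ge1)

lemma decay_eq: "0 < r \<Longrightarrow> r + d x y = r * decay x r y"
  by (simp add: decay_def field_simps)

text \<open>Doubling bounds V(x,y) by a multiple of decay^dm V_r(x), and one further power absorbs
  decay^\<gamma> since \<gamma> \<le> 1. Polynomial decay thus implies the size condition, in which
  the volume V(x,y) occurs.\<close>

lemma size_ge_decay: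
  assumes "0 < r" "0 < \<gamma>" "\<gamma> \<le> 1"
  shows "1 / (V r x * decay x r y ^ (dm + 1)) \<le> 2 ^ (dm + 1) * sz x r \<gamma> y"
proof -
  let ?t = "decay x r y"
  have t: "1 \<le> ?t" using assms by simp
  have V: "0 < V r x" using assms by (intro V_pos)
  have "V (d x y) x \<le> V (?t * r) x" using assms by (intro V_mono) (simp add: decay_def field_simps)
  also have "\<dots> \<le> (2 * ?t) ^ dm * V r x" using assms t by (intro V_scale)
  finally have v2: "V (d x y) x \<le> (2 * ?t) ^ dm * V r x" .
  have "1 \<le> (2 * ?t) ^ dm" using t by (intro one_le_power) linarith
  then have "V r x \<le> (2 * ?t) ^ dm * V r x" using mult_right_mono[of 1 "(2 * ?t) ^ dm" "V r x"] V by simp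
  with v2 have "V r x + V (d x y) x \<le> 2 * ((2 * ?t) ^ dm * V r x)" by linarith
  also have "\<dots> = 2 ^ (dm + 1) * ?t ^ dm * V r x" by (simp add: power_mult_distrib)
  finally have v: "V r x + V (d x y) x \<le> 2 ^ (dm + 1) * ?t ^ dm * V r x" .
  have "?t powr \<gamma> \<le> ?t powr 1" using t assms by (intro powr_mono) auto
  then have tg: "?t powr \<gamma> \<le> ?t" using t by simp
  have e: "(r / (r + d x y)) powr \<gamma> = 1 / ?t powr \<gamma>"
    using assms t by (simp add: decay_eq powr_divide)
  have "1 / (V r x * ?t ^ (dm + 1)) = 2 ^ (dm + 1) * (1 / (2 ^ (dm + 1) * ?t ^ dm * V r x) * (1 / ?t))"
    using t V by (simp add: field_simps)
  also have "\<dots> \<le> 2 ^ (dm + 1) * (1 / (V r x + V (d x y) x) * (1 / ?t powr \<gamma>))"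
    using v tg t V by (intro mult_left_mono mult_mono divide_left_mono mult_pos_pos add_pos_nonneg) auto
  also have "\<dots> = 2 ^ (dm + 1) * sz x r \<gamma> y"
    by (simp add: test_size_def V2_eq e)
  finally show ?thesis .
qed

text \<open>Of the dm + 2 powers, dm + 1 are used by \<open>size_ge_decay\<close>. The last one pays
  for replacing (d(y,z)/r)^\<beta> by the quotient with denominator r + d(x,y), which costs
  decay^\<beta> \<le> decay.\<close>

lemma test_boundI_decay:
  assumes r: "0 < r" and \<beta>: "0 < \<beta>" "\<beta> \<le> 1" and \<gamma>: "0 < \<gamma>" "\<gamma> \<le> 1" and \<epsilon>: "0 \<le> \<epsilon>"
    and size: "\<And>y. cmod (g y) \<le> \<epsilon> / (V r x * decay x r y ^ (dm + 2))"
    and reg: "\<And>y z. d y z \<le> inverse (2 * A0) * (r + d x y) \<Longrightarrow>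
       cmod (g y - g z) \<le> \<epsilon> * (d y z / r) powr \<beta> / (V r x * decay x r y ^ (dm + 2))"
  shows "tb x r \<beta> \<gamma> g (2 ^ (dm + 1) * \<epsilon>)"
  unfolding test_bound_def
proof (intro conjI allI impI)
  fix y
  have V: "0 < V r x" using r by (intro V_pos)
  let ?t = "decay x r y"
  have t: "1 \<le> ?t" using r by simp
  have "cmod (g y) \<le> \<epsilon> / (V r x * ?t ^ (dm + 2))" by (rule size)
  also have "\<dots> \<le> \<epsilon> / (V r x * ?t ^ (dm + 1))"
    using t V \<epsilon> by (intro divide_left_mono mult_left_mono power_increasing) auto
  also have "\<dots> = \<epsilon> * (1 / (V r x * ?t ^ (dm + 1)))" by simp
  also have "\<dots> \<le> \<epsilon> * (2 ^ (dm + 1) * sz x r \<gamma> y)" using \<epsilon> r \<gamma> by (intro mult_left_mono size_ge_decay)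
  finally show "cmod (g y) \<le> 2 ^ (dm + 1) * \<epsilon> * sz x r \<gamma> y" by (simp add: mult_ac)
  fix z assume yz: "d y z \<le> inverse (2 * A0) * (r + d x y)"
  have "(d y z / r) powr \<beta> = (d y z / (r + d x y)) powr \<beta> * ?t powr \<beta>"
    using t r by (simp add: decay_eq powr_mult[symmetric])
  also have "\<dots> \<le> (d y z / (r + d x y)) powr \<beta> * ?t"
    using t \<beta> powr_mono[of \<beta> 1 ?t] by (intro mult_left_mono) auto
  finally have p: "(d y z / r) powr \<beta> \<le> (d y z / (r + d x y)) powr \<beta> * ?t" .
  have "cmod (g y - g z) \<le> \<epsilon> * (d y z / r) powr \<beta> / (V r x * ?t ^ (dm + 2))" by (rule reg[OF yz])
  also have "\<dots> \<le> \<epsilon> * ((d y z / (r + d x y)) powr \<beta> * ?t) / (V r x * ?t ^ (dm + 2))"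
    using p \<epsilon> V t by (intro divide_right_mono mult_left_mono) auto
  also have "\<dots> = \<epsilon> * (d y z / (r + d x y)) powr \<beta> * (1 / (V r x * ?t ^ (dm + 1)))"
    using t V by (simp add: field_simps)
  also have "\<dots> \<le> \<epsilon> * (d y z / (r + d x y)) powr \<beta> * (2 ^ (dm + 1) * sz x r \<gamma> y)"
    using \<epsilon> r \<gamma> by (intro mult_left_mono size_ge_decay) auto
  finally show "cmod (g y - g z) \<le> 2 ^ (dm + 1) * \<epsilon> * (d y z / (r + d x y)) powr \<beta> * sz x r \<gamma> y"
    by (simp add: mult_ac)
qed

text \<open>In the quasi-triangle inequality for d(x,y) the term A0 d(z,y) is at most half of r +
  d(x,y) and is absorbed on the left.\<close>

lemma decay_comparable:
  assumes "0 < r" "d y z \<le> inverse (2 * A0) * (r + d x y)"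
  shows "decay x r y \<le> 2 * A0 * decay x r z"
proof -
  have "d x y \<le> A0 * (d x z + d z y)" by (rule d_tri)
  also have "\<dots> \<le> A0 * (d x z + inverse (2 * A0) * (r + d x y))"
    using assms A0_ge1 by (intro mult_left_mono add_left_mono) (auto simp: d_sym[of z y])
  also have "\<dots> = A0 * d x z + (r + d x y) / 2" using A0_ge1 by (simp add: distrib_left[of A0] field_simps)
  finally have "r + d x y \<le> 2 * r + 2 * A0 * d x z" by (simp add: field_simps)
  also have "\<dots> \<le> 2 * A0 * r + 2 * A0 * d x z" using A0_ge1 assms by simp
  also have "\<dots> = r * (2 * A0 * decay x r z)"
    using assms(1) by (simp add: decay_def field_simps)
  finally have "r * decay x r y \<le> r * (2 * A0 * decay x r z)"
    using assms(1) by (simp only: decay_eq)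
  then show ?thesis using assms(1) by simp
qed

text \<open>The exponent of decay sacrificed in interpolating between a uniform \<open>\<eta>\<close>-Hoelder bound
  and a rapidly decaying size bound.\<close>

definition interp_exp :: "real \<Rightarrow> real \<Rightarrow> nat" where
  "interp_exp \<beta> \<eta> = nat \<lceil>real (dm + 2) / (1 - \<beta> / \<eta>)\<rceil> + dm + 2"

text \<open>With s = 1 - \<beta>/\<eta>, a difference is the product of its s-th and (1-s)-th
  powers. The Hoelder bound turns the latter into a multiple of d(y,z)^\<beta>, the size bound makes
  the former small, and \<open>interp_exp\<close> is chosen so that s times it is at least dm +
  2.\<close>

lemma interpolation:
  assumes \<beta>: "0 < \<beta>" "\<beta> < \<eta>" "\<eta> \<le> 1" and \<gamma>: "0 < \<gamma>" "\<gamma> \<le> 1" and L: "0 \<le> L" and \<tau>: "0 < \<tau>"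
  shows "\<exists>\<epsilon>>0. \<forall>g. (\<forall>y. cmod (g y) \<le> \<epsilon> / decay x 1 y ^ interp_exp \<beta> \<eta>) \<and>
      (\<forall>y z. cmod (g y - g z) \<le> L * d y z powr \<eta>) \<longrightarrow> tb x 1 \<beta> \<gamma> g \<tau>"
proof -
  let ?N = "interp_exp \<beta> \<eta>"
  define s where "s = 1 - \<beta> / \<eta>"
  have s: "0 < s" "s < 1" using \<beta> by (auto simp: s_def)
  have Ns: "real (dm + 2) \<le> real ?N * s"
  proof -
    have "real (dm + 2) / s \<le> real ?N" unfolding interp_exp_def s_def[symmetric] by linarith
    then show ?thesis using s by (simp add: field_simps)
  qed
  define W where "W = V 1 x"
  have W: "0 < W" unfolding W_def by (intro V_pos) simp
  \<comment> \<open>(2 A0)^N comes from comparing the weights at \<open>z\<close> and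
    \<open>y\<close>, the 2 from adding the two size bounds.\<close>
  define K where "K = (2 * (2 * A0) ^ ?N) powr s * L powr (\<beta> / \<eta>)"
  have K: "0 \<le> K" by (simp add: K_def)
  define \<tau>' where "\<tau>' = \<tau> / 2 ^ (dm + 1) / W"
  have \<tau>': "0 < \<tau>'" using \<tau> W by (simp add: \<tau>'_def)
  \<comment> \<open>The first entry serves the size condition; the second solves K \<epsilon>^s
    \<le> \<tau>' for the regularity condition.\<close>
  define \<epsilon> where "\<epsilon> = min \<tau>' ((\<tau>' / (K + 1)) powr (1 / s))"
  have \<epsilon>: "0 < \<epsilon>" using \<tau>' K by (simp add: \<epsilon>_def)
  have \<epsilon>s: "K * \<epsilon> powr s \<le> \<tau>'"
  proof -
    have "\<epsilon> powr s \<le> ((\<tau>' / (K + 1)) powr (1 / s)) powr s"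
      using \<epsilon> s by (intro powr_mono2) (auto simp: \<epsilon>_def)
    also have "\<dots> = \<tau>' / (K + 1)" using s \<tau>' K by (simp add: powr_powr)
    finally have "K * \<epsilon> powr s \<le> K * (\<tau>' / (K + 1))" using K by (rule mult_left_mono)
    also have "\<dots> \<le> \<tau>'" using K \<tau>' by (simp add: field_simps)
    finally show ?thesis .
  qed
  have "tb x 1 \<beta> \<gamma> g \<tau>" if size: "\<And>y. cmod (g y) \<le> \<epsilon> / decay x 1 y ^ ?N"
      and reg: "\<And>y z. cmod (g y - g z) \<le> L * d y z powr \<eta>" for g :: "'a \<Rightarrow> complex"
  proof -
    have "tb x 1 \<beta> \<gamma> g (2 ^ (dm + 1) * (\<tau>' * W))"
    proof (rule test_boundI_decay)
      fix y
      let ?t = "decay x 1 y"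
      have t: "1 \<le> ?t" by simp
      have "cmod (g y) \<le> \<epsilon> / ?t ^ ?N" by (rule size)
      also have "\<dots> \<le> \<tau>' / ?t ^ (dm + 2)"
        using t \<tau>' by (intro frac_le power_increasing) (auto simp: \<epsilon>_def interp_exp_def)
      finally show "cmod (g y) \<le> \<tau>' * W / (V 1 x * ?t ^ (dm + 2))" using W by (simp add: W_def)
      fix z assume yz: "d y z \<le> inverse (2 * A0) * (1 + d x y)"
      let ?E = "2 * (2 * A0) ^ ?N * \<epsilon> / ?t ^ ?N"
      let ?F = "L * d y z powr \<eta>"
      have "?t \<le> 2 * A0 * decay x 1 z" using yz by (intro decay_comparable) auto
      then have "?t ^ ?N \<le> (2 * A0) ^ ?N * decay x 1 z ^ ?N"
        unfolding power_mult_distrib[symmetric] using t by (intro power_mono) auto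
      then have "\<epsilon> / decay x 1 z ^ ?N \<le> (2 * A0) ^ ?N * \<epsilon> / ?t ^ ?N"
        using \<epsilon> t mult_left_mono[of "?t ^ ?N" "(2 * A0) ^ ?N * decay x 1 z ^ ?N" \<epsilon>]
        by (simp add: divide_le_eq pos_le_divide_eq mult_ac)
      then have gz: "cmod (g z) \<le> (2 * A0) ^ ?N * \<epsilon> / ?t ^ ?N" using size[of z] by linarith
      have "1 \<le> (2 * A0) ^ ?N" using A0_ge1 by (intro one_le_power) auto
      then have "\<epsilon> / ?t ^ ?N \<le> (2 * A0) ^ ?N * \<epsilon> / ?t ^ ?N"
        using \<epsilon> t by (intro divide_right_mono) auto
      then have gy: "cmod (g y) \<le> (2 * A0) ^ ?N * \<epsilon> / ?t ^ ?N" using size[of y] by linarith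
      have E: "cmod (g y - g z) \<le> ?E"
      proof -
        have "cmod (g y - g z) \<le> (2 * A0) ^ ?N * \<epsilon> / ?t ^ ?N + (2 * A0) ^ ?N * \<epsilon> / ?t ^ ?N"
          using gy gz norm_triangle_ineq4[of "g y" "g z"] by linarith
        then show ?thesis by (simp add: mult_ac)
      qed
      have F: "cmod (g y - g z) \<le> ?F" by (rule reg)
      have "cmod (g y - g z) = cmod (g y - g z) powr s * cmod (g y - g z) powr (1 - s)"
        by (simp add: powr_add[symmetric])
      also have "\<dots> \<le> ?E powr s * ?F powr (1 - s)"
        using E F s by (intro mult_mono powr_mono2) auto
      also have "?F powr (1 - s) = L powr (\<beta> / \<eta>) * d y z powr \<beta>"
        using \<beta> L by (simp add: s_def powr_mult powr_powr)
      also have "?E powr s = (2 * (2 * A0) ^ ?N) powr s * \<epsilon> powr s / (?t ^ ?N) powr s"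
        using \<epsilon> A0_ge1 t by (simp add: powr_mult powr_divide)
      also have "(2 * (2 * A0) ^ ?N) powr s * \<epsilon> powr s / (?t ^ ?N) powr s * (L powr (\<beta> / \<eta>) * d y z powr \<beta>)
          = K * \<epsilon> powr s * d y z powr \<beta> / (?t ^ ?N) powr s"
        by (simp add: K_def)
      also have "\<dots> \<le> \<tau>' * d y z powr \<beta> / ?t ^ (dm + 2)"
      proof (intro frac_le mult_right_mono \<epsilon>s)
        have "?t ^ (dm + 2) = ?t powr real (dm + 2)" using t by (intro powr_realpow[symmetric]) simp
        also have "\<dots> \<le> ?t powr (real ?N * s)" using Ns t by (intro powr_mono)
        also have "\<dots> = (?t ^ ?N) powr s" using t by (simp add: powr_realpow[symmetric] powr_powr)
        finally show "?t ^ (dm + 2) \<le> (?t ^ ?N) powr s" .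
      qed (use \<tau>' t in auto)
      finally show "cmod (g y - g z) \<le> \<tau>' * W * (d y z / 1) powr \<beta> / (V 1 x * ?t ^ (dm + 2))"
        using W by (simp add: W_def)
    qed (use \<beta> \<gamma> \<tau>' W in auto)
    also have "2 ^ (dm + 1) * (\<tau>' * W) = \<tau>" using W by (simp add: \<tau>'_def)
    finally show ?thesis .
  qed
  then show ?thesis using \<epsilon> by blast
qed

section \<open>Pairing of L^p functions with test functions\<close>

lemma d_measurable [measurable]: "d x \<in> borel_measurable \<mu>"
proof (rule borel_measurableI_less)
  fix a show "{y \<in> space \<mu>. d x y < a} \<in> sets \<mu>"
    using ball_sets[of x a] by (simp add: qball_def)
qed

text \<open>V(x,y) depends on \<open>y\<close> only through the radius d(x,y), and ball volume is
  monotone in the radius.\<close>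

lemma size_measurable [measurable]: "sz x r \<gamma> \<in> borel_measurable \<mu>"
proof -
  have "mono (\<lambda>s. V s x)" by (intro monoI V_mono)
  then have [measurable]: "(\<lambda>s. V s x) \<in> borel_measurable borel" by (rule borel_measurable_mono)
  show ?thesis unfolding test_size_def V2_eq by measurable
qed

text \<open>Only finiteness is wanted, so for finite exponents Hoelder's inequality is replaced by t
  \<le> 1 + t^q: the 1 is integrated against the size function, and t^q against its upper bound
  1/V_r(x).\<close>

lemma nn_integral_mult_size_finite:
  assumes h [measurable]: "h \<in> borel_measurable \<mu>" and fin: "eLp_norm \<mu> p h < \<infinity>"
    and "1 < p" "0 < r" "0 < \<gamma>"
  shows "(\<integral>\<^sup>+y. h y * ennreal (sz x r \<gamma> y) \<partial>\<mu>) < \<infinity>"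
proof (cases "p = \<infinity>")
  case True
  then have S: "esssup \<mu> h < \<infinity>" using fin by (simp add: eLp_norm_def)
  have "(\<integral>\<^sup>+y. h y * ennreal (sz x r \<gamma> y) \<partial>\<mu>) \<le> ennreal (size_const \<gamma>) * esssup \<mu> h"
  proof (rule nn_integral_size_le[OF h])
    fix j :: nat
    have "(\<integral>\<^sup>+y. h y * indicator (B x (2 ^ j * r)) y \<partial>\<mu>) \<le> (\<integral>\<^sup>+y. esssup \<mu> h * indicator (B x (2 ^ j * r)) y \<partial>\<mu>)"
      using esssup_AE[of h \<mu>] by (intro nn_integral_mono_AE) (auto elim!: eventually_mono intro: mult_right_mono)
    then show "(\<integral>\<^sup>+y. h y * indicator (B x (2 ^ j * r)) y \<partial>\<mu>) \<le> esssup \<mu> h * emeasure \<mu> (B x (2 ^ j * r))"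
      by (simp add: nn_integral_cmult)
  qed (use assms in auto)
  also have "\<dots> < \<infinity>" using S by (simp add: ennreal_mult_less_top)
  finally show ?thesis .
next
  case False
  define q where "q = enn2real p"
  have q: "1 < q"
    using assms False unfolding q_def by (cases p) (auto simp: ennreal_less_iff simp flip: ennreal_1)
  have I: "(\<integral>\<^sup>+y. epowr (h y) q \<partial>\<mu>) < \<infinity>"
  proof (rule ccontr)
    assume "\<not> (\<integral>\<^sup>+y. epowr (h y) q \<partial>\<mu>) < \<infinity>"
    then have "(\<integral>\<^sup>+y. epowr (h y) q \<partial>\<mu>) = \<infinity>"
      by (metis infinity_ennreal_def less_top)
    then have "eLp_norm \<mu> p h = \<infinity>" using False by (simp add: eLp_norm_def q_def)
    then show False using fin by simp
  qed
  have V: "0 < V r x" using assms by (intro V_pos)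
  have sz: "sz x r \<gamma> y \<le> 1 / V r x" for y
  proof -
    have "sz x r \<gamma> y \<le> 1 / V r x * 1"
      unfolding test_size_def using assms V
      by (intro mult_mono divide_left_mono powr_size_le1) (auto simp: V2_eq intro!: add_pos_nonneg mult_pos_pos)
    then show ?thesis by simp
  qed
  have le: "t \<le> 1 + epowr t q" for t :: ennreal
  proof (cases t)
    case (real a)
    have "a \<le> 1 + a powr q"
    proof (cases "a \<le> 1")
      case False
      then have "a powr 1 \<le> a powr q" using q by (intro powr_mono) auto
      then show ?thesis using False by simp
    qed (simp add: add_increasing2)
    then show ?thesis using real
      by (simp add: epowr_ennreal flip: ennreal_1 ennreal_plus)
  qed simp
  have "(\<integral>\<^sup>+y. h y * ennreal (sz x r \<gamma> y) \<partial>\<mu>)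
      \<le> (\<integral>\<^sup>+y. ennreal (sz x r \<gamma> y) + ennreal (1 / V r x) * epowr (h y) q \<partial>\<mu>)"
  proof (rule nn_integral_mono)
    fix y
    have "h y * ennreal (sz x r \<gamma> y) \<le> (1 + epowr (h y) q) * ennreal (sz x r \<gamma> y)"
      by (intro mult_right_mono le) simp
    also have "\<dots> = ennreal (sz x r \<gamma> y) + ennreal (sz x r \<gamma> y) * epowr (h y) q"
      by (simp add: distrib_right mult.commute)
    also have "\<dots> \<le> ennreal (sz x r \<gamma> y) + ennreal (1 / V r x) * epowr (h y) q"
      by (intro add_left_mono mult_right_mono ennreal_leI sz) simp
    finally show "h y * ennreal (sz x r \<gamma> y) \<le> ennreal (sz x r \<gamma> y) + ennreal (1 / V r x) * epowr (h y) q" .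
  qed
  also have "\<dots> = (\<integral>\<^sup>+y. ennreal (sz x r \<gamma> y) \<partial>\<mu>) + ennreal (1 / V r x) * (\<integral>\<^sup>+y. epowr (h y) q \<partial>\<mu>)"
    by (simp add: nn_integral_add nn_integral_cmult)
  also have "\<dots> < \<infinity>"
    using I nn_integral_size_const[OF assms(4,5), of x]
    by (auto simp: ennreal_mult_less_top intro: le_less_trans)
  finally show ?thesis .
qed

lemma test_pairing:
  assumes f [measurable]: "f \<in> borel_measurable \<mu>"
    and I: "(\<integral>\<^sup>+y. ennreal (cmod (f y)) * ennreal (sz x r \<gamma> y) \<partial>\<mu>) \<le> ennreal I" "0 \<le> I"
    and \<phi>: "tb x r \<beta> \<gamma> \<phi> C" and "0 \<le> C" "0 < r" "0 < \<beta>"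
  shows "integrable \<mu> (\<lambda>y. f y * \<phi> y)" "cmod (\<integral>y. f y * \<phi> y \<partial>\<mu>) \<le> C * I"
proof -
  have [measurable]: "\<phi> \<in> borel_measurable \<mu>"
    using test_continuous[OF \<phi>] assms by (intro measurable_continuous) auto
  have "(\<integral>\<^sup>+y. ennreal (cmod (f y * \<phi> y)) \<partial>\<mu>) \<le> (\<integral>\<^sup>+y. ennreal C * (ennreal (cmod (f y)) * ennreal (sz x r \<gamma> y)) \<partial>\<mu>)"
  proof (rule nn_integral_mono)
    fix y
    have "cmod (f y * \<phi> y) \<le> cmod (f y) * (C * sz x r \<gamma> y)"
      using \<phi> unfolding norm_mult test_bound_def by (intro mult_left_mono) auto
    then show "ennreal (cmod (f y * \<phi> y)) \<le> ennreal C * (ennreal (cmod (f y)) * ennreal (sz x r \<gamma> y))"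
      using assms by (simp add: ennreal_mult[symmetric] mult_ac)
  qed
  also have "\<dots> = ennreal C * (\<integral>\<^sup>+y. ennreal (cmod (f y)) * ennreal (sz x r \<gamma> y) \<partial>\<mu>)"
    by (simp add: nn_integral_cmult)
  also have "\<dots> \<le> ennreal C * ennreal I" using I by (intro mult_left_mono) auto
  finally have le: "(\<integral>\<^sup>+y. ennreal (cmod (f y * \<phi> y)) \<partial>\<mu>) \<le> ennreal (C * I)"
    using assms by (simp add: ennreal_mult)
  show i: "integrable \<mu> (\<lambda>y. f y * \<phi> y)"
    using le by (intro integrableI_bounded) (auto intro: le_less_trans)
  have "ennreal (cmod (\<integral>y. f y * \<phi> y \<partial>\<mu>)) \<le> (\<integral>\<^sup>+y. ennreal (cmod (f y * \<phi> y)) \<partial>\<mu>)"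
    by (rule integral_norm_bound_ennreal[OF i])
  with le have "ennreal (cmod (\<integral>y. f y * \<phi> y \<partial>\<mu>)) \<le> ennreal (C * I)" by (rule order_trans[rotated])
  then show "cmod (\<integral>y. f y * \<phi> y \<partial>\<mu>) \<le> C * I"
    using assms by (subst (asm) ennreal_le_iff) auto
qed

end

text \<open>Every ball centred at \<open>x\<close> contains \<open>x\<close>, so the uncentred
  maximal function at \<open>x\<close> bounds all averages required by
  \<open>nn_integral_size_le\<close>.\<close>

lemma (in hts_sep) test_pairing_hl:
  assumes f [measurable]: "f \<in> borel_measurable \<mu>"
    and \<phi>: "tb x r \<beta> \<gamma> \<phi> C" and "0 \<le> C" "0 < r" "0 < \<beta>" "0 < \<gamma>"
  shows "ennreal (cmod (\<integral>y. f y * \<phi> y \<partial>\<mu>)) \<le> ennreal (C * size_const \<gamma>) * hl (\<lambda>y. ennreal (cmod (f y))) x"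
proof (cases "hl (\<lambda>y. ennreal (cmod (f y))) x")
  case (real m)
  let ?K = "size_const \<gamma>"
  have K: "0 < ?K" using assms by (intro size_const_pos)
  have "(\<integral>\<^sup>+y. ennreal (cmod (f y)) * ennreal (sz x r \<gamma> y) \<partial>\<mu>) \<le> ennreal ?K * ennreal m"
    unfolding real(2)[symmetric]
    using assms by (intro nn_integral_size_le hl_ball) (auto simp: qball_def)
  then have "cmod (\<integral>y. f y * \<phi> y \<partial>\<mu>) \<le> C * (?K * m)"
    using K real assms by (intro test_pairing(2)[OF f _ _ \<phi>]) (auto simp: ennreal_mult')
  then show ?thesis
    using real K assms by (simp add: ennreal_mult[symmetric] ennreal_leI mult.assoc)
next
  case top
  have K: "0 < size_const \<gamma>" using assms by (intro size_const_pos)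
  show ?thesis
  \<comment> \<open>Here 0 times \<infinity> is 0, so the bound must come from the vanishing of
    \<phi>.\<close>
  proof (cases "C = 0")
    case True
    then have "\<phi> y = 0" for y using \<phi> unfolding test_bound_def by simp
    then show ?thesis by simp
  qed (use top K assms in \<open>simp add: ennreal_mult_top\<close>)
qed

section \<open>Distributions induced by functions\<close>

locale hts_cut = hts_sep d \<mu> A0 C\<mu> D
  for d :: "'a::topological_space \<Rightarrow> 'a \<Rightarrow> real" and \<mu> :: "'a measure" and A0 C\<mu> :: real and D :: "'a set" +
  fixes \<eta> \<beta> \<gamma> :: real and x0 :: 'a
  assumes \<eta>: "0 < \<eta>" "\<eta> < 1" and cutoff: "cutoff_index d A0 \<eta>"
    and \<beta>: "0 < \<beta>" "\<beta> < \<eta>" and \<gamma>: "0 < \<gamma>" "\<gamma> < \<eta>"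
begin

abbreviation "G0 \<equiv> test0 d \<mu> A0 x0 \<eta> \<beta> \<gamma>"
abbreviation "G\<eta> \<equiv> ts x0 1 \<eta> \<eta>"
abbreviation "\<D> \<equiv> distributions d \<mu> A0 x0 \<eta> \<beta> \<gamma>"
abbreviation "dist_of \<equiv> induced_distribution d \<mu> A0 x0 \<eta> \<beta> \<gamma>"

section \<open>The closure \<open>test0\<close> as a vector space\<close>

lemma G\<eta>_sub: "G\<eta> \<subseteq> ts x0 1 \<beta> \<gamma>"
proof
  fix f assume "f \<in> G\<eta>"
  then obtain C where "C > 0" and C: "tb x0 1 \<eta> \<eta> f C" unfolding test_space_def by blast
  have "tb x0 1 \<beta> \<gamma> f C" using \<eta> \<beta> \<gamma> \<open>C > 0\<close> by (intro test_bound_exponents[OF C]) auto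
  then show "f \<in> ts x0 1 \<beta> \<gamma>" by (rule test_spaceI) simp
qed

lemma test_bound_zero: "0 \<le> C \<Longrightarrow> 0 < r \<Longrightarrow> tb x r \<beta>' \<gamma>' (\<lambda>_. 0) C"
  by (simp add: test_bound_def)

lemma test0I:
  assumes "f \<in> ts x0 1 \<beta> \<gamma>" "\<And>\<epsilon>. 0 < \<epsilon> \<Longrightarrow> \<exists>g\<in>G\<eta>. tb x0 1 \<beta> \<gamma> (\<lambda>x. f x - g x) \<epsilon>"
  shows "f \<in> G0"
  unfolding test0_def
proof (safe intro!: assms(1))
  fix \<epsilon> :: real assume "0 < \<epsilon>"
  \<comment> \<open>Half of \<epsilon> produces the strict inequality of \<open>test0\<close>, since
    \<open>test_norm_le\<close> is not strict.\<close>
  then obtain g where g: "g \<in> G\<eta>" "tb x0 1 \<beta> \<gamma> (\<lambda>x. f x - g x) (\<epsilon> / 2)" using assms(2)[of "\<epsilon> / 2"] by auto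
  then have "tn x0 1 \<beta> \<gamma> (\<lambda>x. f x - g x) \<le> \<epsilon> / 2" using \<open>0 < \<epsilon>\<close> by (intro test_norm_le) auto
  then show "\<exists>g\<in>G\<eta> \<inter> ts x0 1 \<beta> \<gamma>. tn x0 1 \<beta> \<gamma> (\<lambda>x. f x - g x) < \<epsilon>"
    using g G\<eta>_sub \<open>0 < \<epsilon>\<close> by (intro bexI[of _ g]) auto
qed

lemma test0_sub: "G0 \<subseteq> ts x0 1 \<beta> \<gamma>"
  by (auto simp: test0_def)

lemma test0_approx:
  assumes "f \<in> G0" "0 < \<epsilon>"
  shows "\<exists>g\<in>G\<eta>. tb x0 1 \<beta> \<gamma> (\<lambda>x. f x - g x) \<epsilon>"
proof -
  obtain g where g: "g \<in> G\<eta>" "g \<in> ts x0 1 \<beta> \<gamma>" "tn x0 1 \<beta> \<gamma> (\<lambda>x. f x - g x) < \<epsilon>"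
    using assms by (auto simp: test0_def)
  have "f \<in> ts x0 1 \<beta> \<gamma>" using assms(1) test0_sub by auto
  then have "tb x0 1 \<beta> \<gamma> (\<lambda>x. f x - g x) \<epsilon>" using g by (intro test_norm_lessD test_space_diff) auto
  with g show ?thesis by auto
qed

lemma G\<eta>_test0: "g \<in> G\<eta> \<Longrightarrow> g \<in> G0"
  using G\<eta>_sub by (intro test0I) (auto intro!: bexI[of _ g] test_bound_zero)

lemma test0_add:
  assumes "f \<in> G0" "g \<in> G0"
  shows "(\<lambda>x. f x + g x) \<in> G0"
proof (rule test0I)
  show "(\<lambda>x. f x + g x) \<in> ts x0 1 \<beta> \<gamma>" using assms test0_sub by (intro test_space_add) auto
  fix \<epsilon> :: real assume "0 < \<epsilon>"
  then obtain f' g' where f': "f' \<in> G\<eta>" "tb x0 1 \<beta> \<gamma> (\<lambda>x. f x - f' x) (\<epsilon> / 2)"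
    and g': "g' \<in> G\<eta>" "tb x0 1 \<beta> \<gamma> (\<lambda>x. g x - g' x) (\<epsilon> / 2)"
    using test0_approx[of f "\<epsilon> / 2"] test0_approx[of g "\<epsilon> / 2"] assms by auto
  have "tb x0 1 \<beta> \<gamma> (\<lambda>x. f x + g x - (f' x + g' x)) \<epsilon>"
    using test_bound_add[OF f'(2) g'(2)] by (simp add: algebra_simps)
  then show "\<exists>h\<in>G\<eta>. tb x0 1 \<beta> \<gamma> (\<lambda>x. f x + g x - h x) \<epsilon>"
    using f' g' by (intro bexI[of _ "\<lambda>x. f' x + g' x"] test_space_add)
qed

lemma test0_cmult:
  assumes "f \<in> G0"
  shows "(\<lambda>x. c * f x) \<in> G0"
proof (rule test0I)
  show "(\<lambda>x. c * f x) \<in> ts x0 1 \<beta> \<gamma>" using assms test0_sub by (intro test_space_cmult) auto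
  fix \<epsilon> :: real assume \<epsilon>: "0 < \<epsilon>"
  define \<epsilon>' where "\<epsilon>' = \<epsilon> / (cmod c + 1)"
  have p: "0 < cmod c + 1" by (intro add_nonneg_pos) auto
  have \<epsilon>': "0 < \<epsilon>'" using \<epsilon> p by (simp add: \<epsilon>'_def)
  obtain f' where f': "f' \<in> G\<eta>" "tb x0 1 \<beta> \<gamma> (\<lambda>x. f x - f' x) \<epsilon>'"
    using test0_approx[OF assms \<epsilon>'] by auto
  have "cmod c * \<epsilon>' \<le> \<epsilon>" using \<epsilon> p by (simp add: \<epsilon>'_def field_simps)
  then have "tb x0 1 \<beta> \<gamma> (\<lambda>x. c * f x - c * f' x) \<epsilon>"
    using test_bound_mono[OF test_bound_cmult[OF f'(2), of c]] by (simp add: right_diff_distrib)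
  then show "\<exists>h\<in>G\<eta>. tb x0 1 \<beta> \<gamma> (\<lambda>x. c * f x - h x) \<epsilon>"
    using f' by (intro bexI[of _ "\<lambda>x. c * f' x"] test_space_cmult) auto
qed

section \<open>Functionals given by L^p functions\<close>

lemma Lp_pairing_const:
  assumes "f \<in> Lp_space \<mu> p" "1 < p"
  obtains I where "0 \<le> I" "(\<integral>\<^sup>+y. ennreal (cmod (f y)) * ennreal (sz x0 1 \<gamma> y) \<partial>\<mu>) \<le> ennreal I"
proof -
  have [measurable]: "f \<in> borel_measurable \<mu>" using assms by (simp add: Lp_space_def)
  have fin: "(\<integral>\<^sup>+y. ennreal (cmod (f y)) * ennreal (sz x0 1 \<gamma> y) \<partial>\<mu>) < \<infinity>"
    using assms \<gamma> by (intro nn_integral_mult_size_finite[of _ p]) (auto simp: Lp_space_def Lp_norm_def)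
  show ?thesis
    by (rule that[of "enn2real (\<integral>\<^sup>+y. ennreal (cmod (f y)) * ennreal (sz x0 1 \<gamma> y) \<partial>\<mu>)"])
      (use fin in \<open>auto simp: less_top\<close>)
qed

lemma test0_integrable:
  assumes "f \<in> Lp_space \<mu> p" "1 < p" "\<phi> \<in> G0"
  shows "integrable \<mu> (\<lambda>y. f y * \<phi> y)"
proof -
  obtain I where I: "0 \<le> I" "(\<integral>\<^sup>+y. ennreal (cmod (f y)) * ennreal (sz x0 1 \<gamma> y) \<partial>\<mu>) \<le> ennreal I"
    using Lp_pairing_const assms by blast
  obtain C where "0 < C" "tb x0 1 \<beta> \<gamma> \<phi> C" using assms test0_sub by (auto simp: test_space_def)
  then show ?thesis using assms I \<beta> by (intro test_pairing(1)[of f x0 1 \<gamma> I \<beta> \<phi> C]) (auto simp: Lp_space_def)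
qed

lemma induced_distribution_in:
  assumes f: "f \<in> Lp_space \<mu> p" "1 < p"
  shows "dist_of f \<in> \<D>"
proof -
  obtain I where I: "0 \<le> I" "(\<integral>\<^sup>+y. ennreal (cmod (f y)) * ennreal (sz x0 1 \<gamma> y) \<partial>\<mu>) \<le> ennreal I"
    using Lp_pairing_const f by blast
  have "cmod (dist_of f \<phi>) \<le> I * tn x0 1 \<beta> \<gamma> \<phi>" if \<phi>: "\<phi> \<in> G0" for \<phi>
  \<comment> \<open>The norm itself need not be an admissible constant, so it is exceeded by
    e/(I+1), which contributes at most e.\<close>
  proof (rule field_le_epsilon)
    fix e :: real assume e: "0 < e"
    let ?C = "tn x0 1 \<beta> \<gamma> \<phi> + e / (I + 1)"
    have ts: "\<phi> \<in> ts x0 1 \<beta> \<gamma>" using \<phi> test0_sub by auto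
    have e': "0 < e / (I + 1)" using e I by simp
    have "tb x0 1 \<beta> \<gamma> \<phi> ?C" using ts e' by (intro test_norm_lessD) auto
    moreover have "0 \<le> ?C" using test_norm_nonneg[OF ts] e' by linarith
    ultimately have "cmod (\<integral>y. f y * \<phi> y \<partial>\<mu>) \<le> ?C * I"
      using f I \<beta> by (intro test_pairing(2)[of f x0 1 \<gamma> I \<beta> \<phi> ?C]) (auto simp: Lp_space_def)
    also have "\<dots> = I * tn x0 1 \<beta> \<gamma> \<phi> + I * (e / (I + 1))" by (simp add: algebra_simps)
    also have "\<dots> \<le> I * tn x0 1 \<beta> \<gamma> \<phi> + e" using e I by (simp add: field_simps)
    finally show "cmod (dist_of f \<phi>) \<le> I * tn x0 1 \<beta> \<gamma> \<phi> + e"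
      using \<phi> by (simp add: induced_distribution_def)
  qed
  moreover have "dist_of f (\<lambda>x. \<phi> x + \<psi> x) = dist_of f \<phi> + dist_of f \<psi>" if "\<phi> \<in> G0" "\<psi> \<in> G0" for \<phi> \<psi>
    using that test0_integrable[OF f] test0_add by (simp add: induced_distribution_def distrib_left)
  moreover have "dist_of f (\<lambda>x. c * \<phi> x) = c * dist_of f \<phi>" if "\<phi> \<in> G0" for c \<phi>
  proof -
    have "(\<lambda>x. f x * (c * \<phi> x)) = (\<lambda>x. c * (f x * \<phi> x))" by (auto simp: mult_ac)
    then show ?thesis using that test0_cmult[OF that, of c] by (simp add: induced_distribution_def)
  qed
  ultimately show ?thesis
    unfolding distributions_def by (auto simp: induced_distribution_def)
qed

text \<open>Wherever the bounds are not trivial the decay weight is at most 2 A0 (1 + R). The factor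
  2 A0 covers differences with only \<open>z\<close> in the support, where the weight at
  \<open>y\<close> is compared with the one at \<open>z\<close>.\<close>

lemma bump_in_G\<eta>:
  assumes L: "0 \<le> L" and bd: "\<And>y. cmod (\<phi> y) \<le> L" and supp: "\<And>y. y \<notin> B x0 R \<Longrightarrow> \<phi> y = 0"
    and reg: "\<And>y z. cmod (\<phi> y - \<phi> z) \<le> L * d y z powr \<eta>" and R: "0 \<le> R"
  shows "\<phi> \<in> G\<eta>"
proof (rule test_spaceI)
  let ?M = "(2 * A0 * (1 + R)) ^ (dm + 2)"
  let ?\<epsilon> = "L * V 1 x0 * ?M"
  have t: "decay x0 1 y ^ (dm + 2) \<le> ?M" if z: "z \<in> B x0 R" and yz: "d y z \<le> inverse (2 * A0) * (1 + d x0 y)" for y z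
  proof (rule power_mono)
    have "decay x0 1 y \<le> 2 * A0 * decay x0 1 z" using yz by (intro decay_comparable) auto
    also have "\<dots> \<le> 2 * A0 * (1 + R)"
      using z A0_ge1 by (intro mult_left_mono) (auto simp: decay_def qball_def)
    finally show "decay x0 1 y \<le> 2 * A0 * (1 + R)" .
  qed simp
  have V: "0 < V 1 x0" by (intro V_pos) simp
  have frac: "a \<le> L * b * V 1 x0 * ?M / (V 1 x0 * decay x0 1 y ^ (dm + 2))"
    if "decay x0 1 y ^ (dm + 2) \<le> ?M" "a \<le> L * b" "0 \<le> b" for a b y
  proof -
    have "L * b * decay x0 1 y ^ (dm + 2) \<le> L * b * ?M" using that L by (intro mult_left_mono) auto
    then have "L * b \<le> L * b * ?M / decay x0 1 y ^ (dm + 2)"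
      by (subst pos_le_divide_eq) auto
    also have "\<dots> = L * b * V 1 x0 * ?M / (V 1 x0 * decay x0 1 y ^ (dm + 2))" using V by simp
    finally show ?thesis using that by linarith
  qed
  have M0: "0 \<le> ?M" using A0_ge1 R by simp
  show "tb x0 1 \<eta> \<eta> \<phi> (2 ^ (dm + 1) * ?\<epsilon>)"
  proof (rule test_boundI_decay)
    fix y
    show "cmod (\<phi> y) \<le> ?\<epsilon> / (V 1 x0 * decay x0 1 y ^ (dm + 2))"
    proof (cases "y \<in> B x0 R")
      case True
      have "decay x0 1 y ^ (dm + 2) \<le> ?M" using True A0_ge1 by (intro t[of y]) auto
      from frac[OF this, of "cmod (\<phi> y)" 1] bd show ?thesis by simp
    qed (use supp L V M0 in simp)
    fix z assume yz: "d y z \<le> inverse (2 * A0) * (1 + d x0 y)"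
    have "cmod (\<phi> y - \<phi> z) \<le> L * (d y z) powr \<eta> * V 1 x0 * ?M / (V 1 x0 * decay x0 1 y ^ (dm + 2))"
    proof (cases "y \<in> B x0 R \<or> z \<in> B x0 R")
      case True
      then have "decay x0 1 y ^ (dm + 2) \<le> ?M"
        using t[OF _ yz] t[of y y] A0_ge1 by auto
      from frac[OF this reg] show ?thesis by simp
    qed (use supp L V M0 in auto)
    then show "cmod (\<phi> y - \<phi> z) \<le> ?\<epsilon> * (d y z / 1) powr \<eta> / (V 1 x0 * decay x0 1 y ^ (dm + 2))"
      by (simp add: mult_ac)
  qed (use \<eta> L V M0 in auto)
qed simp

section \<open>Cutoff functions and uniqueness of the representing function\<close>

lemma cutoff_uniform:
  obtains C where "0 < C" "\<And>x r. 0 < r \<Longrightarrow> \<exists>\<psi> :: 'a \<Rightarrow> real. (\<forall>y. 0 \<le> \<psi> y) \<and> (\<forall>y. \<psi> y \<le> 1) \<and>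
    (\<forall>y\<in>B x r. \<psi> y = 1) \<and> (\<forall>y. y \<notin> B x (2 * A0 * r) \<longrightarrow> \<psi> y = 0) \<and>
    (\<forall>y z. \<bar>\<psi> y - \<psi> z\<bar> \<le> C * (d y z / r) powr \<eta>)"
proof -
  obtain C where C: "C > 0" "\<And>x r. 0 < r \<Longrightarrow> \<exists>\<psi> :: 'a \<Rightarrow> real.
        (\<forall>y. indicator (B x r) y \<le> \<psi> y \<and> \<psi> y \<le> indicator (B x (2 * A0 * r)) y) \<and>
        (\<forall>y y'. \<bar>\<psi> y - \<psi> y'\<bar> \<le> C * (d y y' / r) powr \<eta>)"
    using cutoff unfolding cutoff_index_def by meson
  show ?thesis
  proof (rule that[OF C(1)])
    fix x and r :: real assume "0 < r"
    from C(2)[OF this, of x] obtain \<psi> :: "'a \<Rightarrow> real" where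
      \<psi>: "\<And>y. indicator (B x r) y \<le> \<psi> y" "\<And>y. \<psi> y \<le> indicator (B x (2 * A0 * r)) y"
        "\<And>y y'. \<bar>\<psi> y - \<psi> y'\<bar> \<le> C * (d y y' / r) powr \<eta>" by metis
    have b: "0 \<le> \<psi> y" "\<psi> y \<le> 1" for y
      using \<psi>(1,2)[of y] by (auto split: split_indicator_asm)
    have "\<psi> y = 1" if "y \<in> B x r" for y using \<psi>(1)[of y] b(2)[of y] that by simp
    moreover have "\<psi> y = 0" if "y \<notin> B x (2 * A0 * r)" for y
      using \<psi>(2)[of y] b(1)[of y] that by simp
    ultimately show "\<exists>\<psi> :: 'a \<Rightarrow> real. (\<forall>y. 0 \<le> \<psi> y) \<and> (\<forall>y. \<psi> y \<le> 1) \<and>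
      (\<forall>y\<in>B x r. \<psi> y = 1) \<and> (\<forall>y. y \<notin> B x (2 * A0 * r) \<longrightarrow> \<psi> y = 0) \<and>
      (\<forall>y z. \<bar>\<psi> y - \<psi> z\<bar> \<le> C * (d y z / r) powr \<eta>)"
      using b \<psi>(3) by (intro exI[of _ \<psi>]) simp
  qed
qed

text \<open>For a single fixed radius its power is absorbed into the constant;
  \<open>cutoff_uniform\<close> retains the scaling that truncation at large radii needs.\<close>

lemma cutoff_fun:
  assumes "0 < r"
  obtains \<psi> :: "'a \<Rightarrow> real" and C where "0 < C" "\<And>y. 0 \<le> \<psi> y" "\<And>y. \<psi> y \<le> 1" "\<And>y. y \<in> B x r \<Longrightarrow> \<psi> y = 1"
    "\<And>y. y \<notin> B x (2 * A0 * r) \<Longrightarrow> \<psi> y = 0" "\<And>y z. \<bar>\<psi> y - \<psi> z\<bar> \<le> C * d y z powr \<eta>"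
proof -
  obtain C where C: "0 < C" "\<And>x r. 0 < r \<Longrightarrow> \<exists>\<psi> :: 'a \<Rightarrow> real. (\<forall>y. 0 \<le> \<psi> y) \<and> (\<forall>y. \<psi> y \<le> 1) \<and>
    (\<forall>y\<in>B x r. \<psi> y = 1) \<and> (\<forall>y. y \<notin> B x (2 * A0 * r) \<longrightarrow> \<psi> y = 0) \<and>
    (\<forall>y z. \<bar>\<psi> y - \<psi> z\<bar> \<le> C * (d y z / r) powr \<eta>)"
    by (rule cutoff_uniform) metis
  from C(2)[OF assms, of x] obtain \<psi> :: "'a \<Rightarrow> real" where \<psi>: "\<And>y. 0 \<le> \<psi> y" "\<And>y. \<psi> y \<le> 1"
    "\<And>y. y \<in> B x r \<Longrightarrow> \<psi> y = 1" "\<And>y. y \<notin> B x (2 * A0 * r) \<Longrightarrow> \<psi> y = 0"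
    "\<And>y z. \<bar>\<psi> y - \<psi> z\<bar> \<le> C * (d y z / r) powr \<eta>" by metis
  have "0 < C / r powr \<eta>" using C assms by simp
  moreover have "\<bar>\<psi> y - \<psi> z\<bar> \<le> C / r powr \<eta> * d y z powr \<eta>" for y z
    using \<psi>(5)[of y z] assms by (simp add: powr_divide)
  ultimately show ?thesis using \<psi>(1-4) that by metis
qed

text \<open>Cover \<open>U\<close> by countably many balls whose dilates by 2 A0 stay in
  \<open>U\<close>, and take running maxima of their cutoff functions. A finite maximum is Hoelder
  with the sum of the constants, and at each point of \<open>U\<close> the value is eventually
  exactly 1.\<close>

lemma open_set_bump_limit:
  assumes U: "open U" "U \<subseteq> B x0 R" and R: "0 \<le> R"
  obtains \<phi> :: "nat \<Rightarrow> 'a \<Rightarrow> complex" where "\<And>n. \<phi> n \<in> G\<eta>" "\<And>n y. cmod (\<phi> n y) \<le> indicator U y"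
    "\<And>y. (\<lambda>n. \<phi> n y) \<longlonglongrightarrow> indicator U y"
proof (cases "U = {}")
  case True
  show ?thesis
    by (rule that[of "\<lambda>_ _. 0"]) (use True in \<open>auto intro!: test_spaceI[of _ _ _ _ _ 1] test_bound_zero\<close>)
next
  case False
  define I where "I = {(w, r). 0 < r \<and> B w (2 * A0 * r) \<subseteq> U}"
  have cover: "(\<Union>(w, r)\<in>I. B w r) = U"
  proof (intro equalityI subsetI)
    fix y assume "y \<in> (\<Union>(w, r)\<in>I. B w r)"
    then obtain w r where wr: "0 < r" "B w (2 * A0 * r) \<subseteq> U" "y \<in> B w r" by (auto simp: I_def)
    have "r \<le> 2 * A0 * r" using wr A0_ge1 by simp
    then show "y \<in> U" using wr ball_mono by blast
  next
    fix y assume "y \<in> U"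
    then obtain r where r: "0 < r" "B y r \<subseteq> U" using ball_in_open U by blast
    have "(y, r / (2 * A0)) \<in> I" using r A0_ge1 by (auto simp: I_def)
    moreover have "y \<in> B y (r / (2 * A0))" using r A0_ge1 by (simp add: qball_def)
    ultimately show "y \<in> (\<Union>(w, r)\<in>I. B w r)" by blast
  qed
  obtain I' where I': "I' \<subseteq> I" "countable I'" "(\<Union>(w, r)\<in>I'. B w r) = U"
    using Lindelof_index[of I "\<lambda>(w, r). B w r"] cover by (auto simp: open_ball)
  then have "I' \<noteq> {}" using False by auto
  define e where "e = from_nat_into I'"
  have e: "range e = I'" using \<open>I' \<noteq> {}\<close> I'(2) by (simp add: e_def)
  have "\<exists>\<psi> :: 'a \<Rightarrow> real. \<exists>C>0. (\<forall>y. 0 \<le> \<psi> y) \<and> (\<forall>y. \<psi> y \<le> indicator U y) \<and>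
      (\<forall>y\<in>B (fst (e i)) (snd (e i)). \<psi> y = 1) \<and> (\<forall>y z. \<bar>\<psi> y - \<psi> z\<bar> \<le> C * d y z powr \<eta>)" for i
  proof -
    have "e i \<in> I" using e I' by blast
    then have pos: "0 < snd (e i)" and sub: "B (fst (e i)) (2 * A0 * snd (e i)) \<subseteq> U" by (auto simp: I_def)
    obtain \<psi> :: "'a \<Rightarrow> real" and C where "0 < C" "\<And>y. 0 \<le> \<psi> y" and le1: "\<And>y. \<psi> y \<le> 1"
      "\<And>y. y \<in> B (fst (e i)) (snd (e i)) \<Longrightarrow> \<psi> y = 1"
      and zero: "\<And>y. y \<notin> B (fst (e i)) (2 * A0 * snd (e i)) \<Longrightarrow> \<psi> y = 0"
      "\<And>y z. \<bar>\<psi> y - \<psi> z\<bar> \<le> C * d y z powr \<eta>"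
      using cutoff_fun[OF pos, of "fst (e i)"] by metis
    moreover have "\<psi> y \<le> indicator U y" for y
    proof (cases "y \<in> U")
      case False
      then have "y \<notin> B (fst (e i)) (2 * A0 * snd (e i))" using sub by blast
      then show ?thesis using zero(1) by simp
    qed (use le1 in simp)
    ultimately show ?thesis by metis
  qed
  then obtain \<psi> :: "nat \<Rightarrow> 'a \<Rightarrow> real" and C where C: "\<And>i. 0 < C i" and \<psi>: "\<And>i y. 0 \<le> \<psi> i y"
      "\<And>i y. \<psi> i y \<le> indicator U y" "\<And>i y. y \<in> B (fst (e i)) (snd (e i)) \<Longrightarrow> \<psi> i y = 1"
      "\<And>i y z. \<bar>\<psi> i y - \<psi> i z\<bar> \<le> C i * d y z powr \<eta>" by metis
  define \<phi> where "\<phi> = rec_nat (\<psi> 0) (\<lambda>n f y. max (f y) (\<psi> (Suc n) y))"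
  have \<phi>0: "\<phi> 0 = \<psi> 0" and \<phi>S: "\<phi> (Suc n) = (\<lambda>y. max (\<phi> n y) (\<psi> (Suc n) y))" for n
    by (simp_all add: \<phi>_def)
  have bounds: "0 \<le> \<phi> n y" "\<phi> n y \<le> indicator U y" for n y
    by (induction n) (use \<psi> in \<open>auto simp: \<phi>0 \<phi>S intro: max.coboundedI1\<close>)
  have lower: "\<psi> i y \<le> \<phi> n y" if "i \<le> n" for i n y
    using that by (induction n) (auto simp: \<phi>0 \<phi>S le_Suc_eq intro: max.coboundedI1)
  have hoelder: "\<bar>\<phi> n y - \<phi> n z\<bar> \<le> (\<Sum>i\<le>n. C i) * d y z powr \<eta>" for n y z
  proof (induction n)
    case (Suc n)
    have "\<bar>\<phi> (Suc n) y - \<phi> (Suc n) z\<bar> \<le> \<bar>\<phi> n y - \<phi> n z\<bar> + \<bar>\<psi> (Suc n) y - \<psi> (Suc n) z\<bar>"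
      unfolding \<phi>S by linarith
    also have "\<dots> \<le> (\<Sum>i\<le>n. C i) * d y z powr \<eta> + C (Suc n) * d y z powr \<eta>"
      by (intro add_mono Suc \<psi>)
    finally show ?case by (simp add: distrib_right)
  qed (simp add: \<phi>0 \<psi>)
  show ?thesis
  proof (rule that[of "\<lambda>n y. complex_of_real (\<phi> n y)"])
    fix n y
    show "cmod (complex_of_real (\<phi> n y)) \<le> indicator U y" using bounds[of n y] by simp
    have S0: "0 \<le> (\<Sum>i\<le>n. C i)" using C by (intro sum_nonneg) (auto intro: less_imp_le)
    show "(\<lambda>y. complex_of_real (\<phi> n y)) \<in> G\<eta>"
    proof (rule bump_in_G\<eta>[where L="1 + (\<Sum>i\<le>n. C i)" and R=R])
      fix y z
      have "indicator U y \<le> (1::real)" by (simp split: split_indicator)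
      then have "\<phi> n y \<le> 1" using bounds(2)[of n y] by linarith
      then show "cmod (complex_of_real (\<phi> n y)) \<le> 1 + (\<Sum>i\<le>n. C i)" using bounds(1)[of n y] S0 by simp
      have "(\<Sum>i\<le>n. C i) * d y z powr \<eta> \<le> (1 + (\<Sum>i\<le>n. C i)) * d y z powr \<eta>" by (intro mult_right_mono) auto
      then show "cmod (complex_of_real (\<phi> n y) - complex_of_real (\<phi> n z)) \<le> (1 + (\<Sum>i\<le>n. C i)) * d y z powr \<eta>"
        using hoelder[of n y z] by (simp flip: of_real_diff)
    next
      fix y assume "y \<notin> B x0 R"
      then show "complex_of_real (\<phi> n y) = 0" using bounds[of n y] U by (auto split: split_indicator_asm)
    qed (use S0 R in auto)
  next
    fix y
    show "(\<lambda>n. complex_of_real (\<phi> n y)) \<longlonglongrightarrow> indicator U y"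
    proof (cases "y \<in> U")
      case True
      then have "y \<in> (\<Union>v\<in>range e. B (fst v) (snd v))" using I'(3) e by (simp add: split_beta)
      then obtain i where i: "y \<in> B (fst (e i)) (snd (e i))" by blast
      have "\<phi> n y = 1" if "i \<le> n" for n
        using lower[OF that, of y] bounds(2)[of n y] \<psi>(3)[OF i] True by simp
      then have "eventually (\<lambda>n. complex_of_real (\<phi> n y) = indicator U y) sequentially"
        using True by (intro eventually_sequentiallyI[of i]) simp
      then show ?thesis by (rule tendsto_eventually)
    next
      case False
      then have "\<phi> n y = 0" for n using bounds[of n y] by simp
      then show ?thesis using False by simp
    qed
  qed
qed

text \<open>Vanishing passes from bump functions to open sets by dominated convergence, to Borel
  sets by the \<pi>-\<lambda> theorem, and to measurable sets by Borel regularity. All this happens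
  inside balls, where testing against a cutoff function shows \<open>f\<close> to be
  integrable.\<close>

theorem distribution_determines_function:
  assumes fm [measurable]: "f \<in> borel_measurable \<mu>"
    and int: "\<And>\<phi>. \<phi> \<in> G\<eta> \<Longrightarrow> integrable \<mu> (\<lambda>y. f y * \<phi> y)"
    and zero: "\<And>\<phi>. \<phi> \<in> G\<eta> \<Longrightarrow> (\<integral>y. f y * \<phi> y \<partial>\<mu>) = 0"
  shows "AE y in \<mu>. f y = 0"
proof -
  have "AE y in \<mu>. y \<in> B x0 (real n) \<longrightarrow> f y = 0" for n
  proof -
    let ?G = "B x0 (real n)"
    define F where "F = (\<lambda>y. f y * indicator ?G y)"
    have Fm [measurable]: "F \<in> borel_measurable \<mu>" unfolding F_def by measurable
    have F: "integrable \<mu> F"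
    proof -
      \<comment> \<open>The radius n + 1 is positive even for n = 0, and its ball contains the one
        of radius n.\<close>
      obtain \<psi> :: "'a \<Rightarrow> real" and C where C: "0 < C" and \<psi>: "\<And>y. 0 \<le> \<psi> y" "\<And>y. \<psi> y \<le> 1"
          "\<And>y. y \<in> B x0 (real n + 1) \<Longrightarrow> \<psi> y = 1" "\<And>y. y \<notin> B x0 (2 * A0 * (real n + 1)) \<Longrightarrow> \<psi> y = 0"
          "\<And>y z. \<bar>\<psi> y - \<psi> z\<bar> \<le> C * d y z powr \<eta>"
        using cutoff_fun[of "real n + 1" x0] by (metis add_nonneg_pos of_nat_0_le_iff zero_less_one)
      have "(\<lambda>y. complex_of_real (\<psi> y)) \<in> G\<eta>"
      proof (rule bump_in_G\<eta>[where L="1 + C" and R="2 * A0 * (real n + 1)"])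
        fix y z
        have "C * d y z powr \<eta> \<le> (1 + C) * d y z powr \<eta>" by (intro mult_right_mono) auto
        then show "cmod (complex_of_real (\<psi> y) - complex_of_real (\<psi> z)) \<le> (1 + C) * d y z powr \<eta>"
          using \<psi>(5)[of y z] by (simp flip: of_real_diff)
        show "cmod (complex_of_real (\<psi> y)) \<le> 1 + C" using \<psi>(1,2)[of y] C by simp
      qed (use C \<psi> A0_ge1 in auto)
      then have "integrable \<mu> (\<lambda>y. f y * complex_of_real (\<psi> y))"
        by (rule int)
      then show ?thesis
      proof (rule Bochner_Integration.integrable_bound)
        show "AE y in \<mu>. cmod (F y) \<le> cmod (f y * complex_of_real (\<psi> y))"
        proof (rule AE_I2)
          fix y
          have "y \<in> ?G \<Longrightarrow> \<psi> y = 1" using ball_mono[of "real n" "real n + 1" x0] by (intro \<psi>(3)) auto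
          then show "cmod (F y) \<le> cmod (f y * complex_of_real (\<psi> y))"
            by (simp add: F_def split: split_indicator)
        qed
      qed measurable
    qed
    have FA: "set_integrable \<mu> A F" if "A \<in> sets \<mu>" for A
      unfolding set_integrable_def using F that by (rule integrable_mult_indicator[rotated])
    have op: "set_lebesgue_integral \<mu> U F = 0" if U: "open U" for U
    proof -
      have UG: "open (U \<inter> ?G)" "U \<inter> ?G \<subseteq> ?G" using U by (auto intro: open_Int open_ball)
      obtain \<phi> :: "nat \<Rightarrow> 'a \<Rightarrow> complex" where \<phi>: "\<And>n. \<phi> n \<in> G\<eta>" "\<And>n y. cmod (\<phi> n y) \<le> indicator (U \<inter> ?G) y"
        "\<And>y. (\<lambda>n. \<phi> n y) \<longlonglongrightarrow> indicator (U \<inter> ?G) y"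
        using open_set_bump_limit[OF UG] by (metis of_nat_0_le_iff)
      have [measurable]: "\<phi> k \<in> borel_measurable \<mu>" for k
        using \<phi>(1)[of k] \<eta> unfolding test_space_def by (auto intro!: measurable_continuous elim: test_continuous)
      have [measurable]: "U \<in> sets \<mu>" using U by (rule open_sets)
      have "(\<lambda>k. \<integral>y. f y * \<phi> k y \<partial>\<mu>) \<longlonglongrightarrow> (\<integral>y. f y * indicator (U \<inter> ?G) y \<partial>\<mu>)"
      proof (rule integral_dominated_convergence[where w="\<lambda>y. cmod (F y)"])
        show "AE y in \<mu>. (\<lambda>k. f y * \<phi> k y) \<longlonglongrightarrow> f y * indicator (U \<inter> ?G) y"
          by (intro AE_I2 tendsto_mult_left \<phi>)
        fix k
        show "AE y in \<mu>. cmod (f y * \<phi> k y) \<le> cmod (F y)"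
        proof (rule AE_I2)
          fix y
          have "cmod (\<phi> k y) \<le> indicator ?G y"
            using \<phi>(2)[of k y] by (auto split: split_indicator split_indicator_asm)
          then show "cmod (f y * \<phi> k y) \<le> cmod (F y)"
            unfolding F_def norm_mult by (intro mult_left_mono) (auto split: split_indicator)
        qed
      qed (use F in \<open>auto intro!: integrable_norm\<close>)
      then have "(\<integral>y. f y * indicator (U \<inter> ?G) y \<partial>\<mu>) = 0"
        using zero[OF \<phi>(1)] by (simp add: LIMSEQ_const_iff)
      moreover have "(\<lambda>y. f y * indicator (U \<inter> ?G) y) = (\<lambda>y. indicator U y *\<^sub>R F y)"
        by (auto simp: F_def split: split_indicator)
      ultimately show ?thesis by (simp add: set_lebesgue_integral_def)
    qed
    have bor: "set_lebesgue_integral \<mu> A F = 0" if "A \<in> sets borel" for A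
    proof -
      have "Int_stable {S :: 'a set. open S}" "{S :: 'a set. open S} \<subseteq> Pow UNIV"
        "A \<in> sigma_sets UNIV {S. open S}"
        using that by (auto simp: Int_stable_def borel_def)
      then show ?thesis
      proof (induction rule: sigma_sets_induct_disjoint)
        case (basic A) then show ?case by (simp add: op)
      next
        case empty then show ?case by (simp add: set_lebesgue_integral_def)
      next
        case (compl A)
        have A: "A \<in> sets \<mu>" using compl(1) borel_sub by (auto simp: borel_def)
        have "set_lebesgue_integral \<mu> (A \<union> (UNIV - A)) F = set_lebesgue_integral \<mu> A F + set_lebesgue_integral \<mu> (UNIV - A) F"
          using A by (intro set_integral_Un FA) (use sets.compl_sets[of A \<mu>] in auto)
        moreover have "A \<union> (UNIV - A) = UNIV" by auto
        ultimately show ?case using compl op[of UNIV] by simp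
      next
        case (union A)
        have A: "A i \<in> sets \<mu>" for i using union(2) borel_sub by (auto simp: borel_def)
        have "set_lebesgue_integral \<mu> (\<Union>i. A i) F = (\<Sum>i. set_lebesgue_integral \<mu> (A i) F)"
          using union(1) A by (intro lebesgue_integral_countable_add FA) (auto simp: disjoint_family_on_def)
        then show ?case using union by simp
      qed
    qed
    have "AE y in \<mu>. F y = 0"
    proof (rule density_zero[OF F])
      fix A assume A [measurable]: "A \<in> sets \<mu>"
      \<comment> \<open>Intersecting with the ball makes the measure finite, so a Borel hull of
        equal measure differs from the set by a null set.\<close>
      obtain E where E: "E \<in> sets borel" "A \<inter> ?G \<subseteq> E" "outer_measure_of \<mu> (A \<inter> ?G) = emeasure \<mu> E"
        using borel_hull by blast
      have E\<mu> [measurable]: "E \<in> sets \<mu>" using E borel_sub by blast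
      have in_E: "f y = 0" if "y \<in> A" "y \<in> ?G" "y \<notin> E" for y using that E(2) by blast
      have eq: "emeasure \<mu> (A \<inter> ?G) = emeasure \<mu> E" using E(3) by simp
      have "emeasure \<mu> (A \<inter> ?G) \<le> emeasure \<mu> ?G" by (intro emeasure_mono) auto
      then have "emeasure \<mu> (A \<inter> ?G) \<noteq> \<infinity>" using emeasure_ball_fin[of x0 "real n"] by (auto simp: top_unique)
      then have "emeasure \<mu> (E - A \<inter> ?G) = 0"
        using E eq by (subst emeasure_Diff) auto
      then have "AE y in \<mu>. y \<notin> E - A \<inter> ?G" by (intro AE_not_in) (auto simp: null_sets_def)
      then have "set_lebesgue_integral \<mu> A F = set_lebesgue_integral \<mu> E F"
        unfolding set_lebesgue_integral_def
        by (intro integral_cong_AE) (auto elim!: eventually_mono simp: F_def split: split_indicator intro: in_E)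
      then show "set_lebesgue_integral \<mu> A F = 0" using bor[OF E(1)] by simp
    qed
    then show ?thesis by eventually_elim (auto simp: F_def)
  qed
  then have "AE y in \<mu>. \<forall>n. y \<in> B x0 (real n) \<longrightarrow> f y = 0" by (subst AE_all_countable) blast
  then show ?thesis
  proof eventually_elim
    case (elim y)
    obtain n where "d x0 y < real n" using reals_Archimedean2 by blast
    then have "y \<in> B x0 (real n)" by (simp add: qball_def)
    then show ?case using elim by blast
  qed
qed

end

section \<open>Kernels of approximations of the identity\<close>

lemma frac_le_cross:
  fixes b c s t :: real
  assumes "0 < s" "0 < t" "c * t \<le> b * s"
  shows "c / s \<le> b / t"
proof -
  have "c * t / (s * t) \<le> b * s / (s * t)" using assms by (intro divide_right_mono) auto
  then show ?thesis using assms by simp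
qed

text \<open>For t \<le> 1 the factor 2^m suffices because 1 + t \<le> 2. For t > 1 one term of the
  exponential series gives exp(-s) \<le> n!/s^n, with n so large that t^(an) \<ge> t^m.\<close>

lemma exp_powr_decay:
  fixes \<nu> a :: real
  assumes "0 < \<nu>" "0 < a"
  shows "\<exists>C>0. \<forall>t\<ge>0. exp (- \<nu> * t powr a) \<le> C / (1 + t) ^ m"
proof -
  define n where "n = nat \<lceil>real m / a\<rceil>"
  have n: "real m \<le> a * real n"
  proof -
    have "real m / a \<le> real n" unfolding n_def by linarith
    then show ?thesis using assms by (simp add: field_simps)
  qed
  define C where "C = max (2 ^ m) (2 ^ m * fact n / \<nu> ^ n)"
  have "exp (- \<nu> * t powr a) \<le> C / (1 + t) ^ m" if t: "0 \<le> t" for t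
  proof (cases "t \<le> 1")
    case True
    have "exp (- \<nu> * t powr a) \<le> 1" using assms by (simp add: mult_nonneg_nonneg)
    also have "\<dots> \<le> C / (1 + t) ^ m"
    proof -
      have "(1 + t) ^ m \<le> 2 ^ m" using True t by (intro power_mono) auto
      also have "\<dots> \<le> C" by (simp add: C_def)
      finally show ?thesis using t by (simp add: le_divide_eq)
    qed
    finally show ?thesis .
  next
    case False
    define s where "s = \<nu> * t powr a"
    have s: "0 < s" using False assms by (simp add: s_def)
    have "s ^ n / fact n \<le> exp s"
    proof -
      have "(\<Sum>i\<in>{n}. s ^ i /\<^sub>R fact i) \<le> (\<Sum>i. s ^ i /\<^sub>R fact i)"
        using s by (intro sum_le_suminf summable_exp_generic) auto
      then show ?thesis by (simp add: exp_def divide_inverse mult.commute)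
    qed
    then have "exp (- s) \<le> fact n / s ^ n"
      using s by (simp add: exp_minus field_simps)
    also have "s ^ n = \<nu> ^ n * t powr (a * real n)"
      using False by (simp add: s_def power_mult_distrib powr_powr powr_realpow[symmetric])
    also have "fact n / (\<nu> ^ n * t powr (a * real n)) \<le> fact n / (\<nu> ^ n * t ^ m)"
    proof -
      have "t ^ m = t powr real m" using False by (simp add: powr_realpow)
      also have "\<dots> \<le> t powr (a * real n)" using n False by (intro powr_mono) auto
      finally show ?thesis using False assms by (intro divide_left_mono mult_left_mono mult_pos_pos) auto
    qed
    also have "\<dots> \<le> 2 ^ m * fact n / \<nu> ^ n / (1 + t) ^ m"
    proof -
      have "(1 + t) ^ m \<le> (2 * t) ^ m" using False by (intro power_mono) auto
      then have "fact n / \<nu> ^ n * (1 + t) ^ m \<le> fact n / \<nu> ^ n * (2 * t) ^ m"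
        using assms by (intro mult_left_mono) auto
      then show ?thesis using False assms by (simp add: field_simps power_mult_distrib)
    qed
    also have "\<dots> \<le> C / (1 + t) ^ m" using False by (intro divide_right_mono) (auto simp: C_def)
    finally show ?thesis by (simp add: s_def)
  qed
  moreover have "0 < C" by (simp add: C_def less_max_iff_disj)
  ultimately show ?thesis by blast
qed

lemma (in hts) continuous_eps:
  fixes f :: "'a \<Rightarrow> 'b::metric_space"
  assumes "\<And>x e. 0 < e \<Longrightarrow> \<exists>\<rho>>0. \<forall>y. d x y < \<rho> \<longrightarrow> dist (f x) (f y) < e"
  shows "continuous_on UNIV f"
  unfolding continuous_on_topological
proof safe
  fix x U assume U: "open U" "f x \<in> U"
  then obtain e where e: "e > 0" "ball (f x) e \<subseteq> U" by (meson openE)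
  obtain \<rho> where r: "\<rho> > 0" "\<And>y. d x y < \<rho> \<Longrightarrow> dist (f x) (f y) < e"
    using assms[OF e(1), of x] by metis
  show "\<exists>A. open A \<and> x \<in> A \<and> (\<forall>y\<in>UNIV. y \<in> A \<longrightarrow> f y \<in> U)"
  proof (intro exI[of _ "B x \<rho>"] conjI ballI impI)
    fix y assume "y \<in> B x \<rho>"
    then have "f y \<in> ball (f x) e" using r(2) by (simp add: qball_def)
    then show "f y \<in> U" using e by auto
  qed (use r in \<open>auto simp: open_ball, simp add: qball_def\<close>)
qed

text \<open>The kernel is normalised in the variable over which the averages below integrate, so
  that they reproduce constants and differences of kernels have integral zero.\<close>

locale ati = hts_cut d \<mu> A0 C\<mu> D \<eta> \<beta> \<gamma> x0
  for d :: "'a::topological_space \<Rightarrow> 'a \<Rightarrow> real" and \<mu> :: "'a measure" and A0 C\<mu> :: real and D :: "'a set"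
    and \<eta> \<beta> \<gamma> :: real and x0 :: 'a +
  fixes \<delta> CP \<nu> a :: real and P :: "int \<Rightarrow> 'a \<Rightarrow> 'a \<Rightarrow> complex"
  assumes \<delta>: "0 < \<delta>" "\<delta> < 1" and CP: "0 < CP" and \<nu>: "0 < \<nu>" and a: "0 < a"
    and kernel: "kernel_estimates d \<delta> \<eta> P CP (Eker d \<mu> \<delta> \<nu> a)"
    and P_integral: "\<And>k y. (LINT x|\<mu>. P k x y) = 1"
begin

section \<open>Kernel estimates as bounds on test functions\<close>

abbreviation "E \<equiv> Eker d \<mu> \<delta> \<nu> a"

lemma scale_pos [simp]: "0 < \<delta> powi k"
  using \<delta> by simp

lemma scale_nonneg [simp]: "0 \<le> \<delta> powi k"
  using \<delta> by simp

lemma E_sym: "E k x y = E k y x"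
  by (simp add: Eker_def d_sym mult.commute)

lemma E_nonneg [simp]: "0 \<le> E k x y"
  by (simp add: Eker_def)

lemma P_size: "cmod (P k x y) \<le> CP * E k x y"
  using kernel unfolding kernel_estimates_def by (elim conjE) metis

lemma P_reg: "d x x' \<le> \<delta> powi k \<Longrightarrow> cmod (P k x y - P k x' y) + cmod (P k y x - P k y x') \<le> CP * (d x x' / \<delta> powi k) powr \<eta> * E k x y"
  using kernel unfolding kernel_estimates_def by (elim conjE) metis

lemma P_reg1: "d x x' \<le> \<delta> powi k \<Longrightarrow> cmod (P k x y - P k x' y) \<le> CP * (d x x' / \<delta> powi k) powr \<eta> * E k x y"
  using P_reg[of x x' k y] norm_ge_zero[of "P k y x - P k y x'"] by linarith

lemma P_reg2: "d y y' \<le> \<delta> powi k \<Longrightarrow> cmod (P k x y - P k x y') \<le> CP * (d y y' / \<delta> powi k) powr \<eta> * E k x y"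
  unfolding E_sym[of k x y]
  using P_reg[of y y' k x] norm_ge_zero[of "P k y x - P k y' x"] by linarith

lemma P_measurable1 [measurable]: "(\<lambda>x. P k x y) \<in> borel_measurable \<mu>"
proof (intro measurable_continuous continuous_hoelder[of \<eta>])
  fix x
  show "\<exists>\<rho>>0. \<exists>C. \<forall>x'. d x x' < \<rho> \<longrightarrow> dist (P k x y) (P k x' y) \<le> C * d x x' powr \<eta>"
  proof (rule exI[of _ "\<delta> powi k"], intro exI[of _ "CP * E k x y / (\<delta> powi k) powr \<eta>"] conjI allI impI)
    fix x' assume "d x x' < \<delta> powi k"
    then show "dist (P k x y) (P k x' y) \<le> CP * E k x y / (\<delta> powi k) powr \<eta> * d x x' powr \<eta>"
      using P_reg1[of x x' k y] \<delta> by (simp add: dist_norm powr_divide mult_ac)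
  qed simp
qed (use \<eta> in simp)

text \<open>The kernel weight mixes the volumes at \<open>x\<close> and \<open>y\<close>; here it is
  referred to a third point \<open>w\<close> near \<open>x\<close>. Doubling compares both volumes
  with the one at \<open>w\<close> at the cost of dm powers of the decay weight, and the exponential
  factor pays for these and for the m powers wanted.\<close>

lemma E_le:
  assumes "0 \<le> \<theta>"
  shows "\<exists>C>0. \<forall>k w x y. d w x \<le> \<theta> * \<delta> powi k \<longrightarrow> E k x y \<le> C / (V (\<delta> powi k) w * decay w (\<delta> powi k) y ^ m)"
proof -
  obtain Ce where Ce: "Ce > 0" "\<And>t. t \<ge> 0 \<Longrightarrow> exp (- \<nu> * t powr a) \<le> Ce / (1 + t) ^ (m + dm)"
    using exp_powr_decay[OF \<nu> a, of "m + dm"] by metis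
  define c1 where "c1 = (2 * A0 * (2 + \<theta>)) ^ dm * (4 * A0) ^ dm"
  have c1: "1 \<le> c1"
  proof -
    have "1 * 1 \<le> c1" unfolding c1_def
    proof (intro mult_mono one_le_power)
      have "1 * 1 \<le> 2 * A0 * (2 + \<theta>)" using A0_ge1 assms by (intro mult_mono) auto
      then show "1 \<le> 2 * A0 * (2 + \<theta>)" by simp
    qed (use A0_ge1 assms in auto)
    then show ?thesis by simp
  qed
  \<comment> \<open>From 1 + d(w,y)/r \<le> A0 (1 + \<theta>) (1 + d(x,y)/r).\<close>
  define c2 where "c2 = A0 * (1 + \<theta>)"
  have c2: "1 \<le> c2" using mult_mono[of 1 A0 1 "1 + \<theta>"] A0_ge1 assms by (simp add: c2_def)
  define C where "C = c1 * Ce * c2 ^ (m + dm)"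
  have C: "C > 0" using c1 c2 Ce by (simp add: C_def)
  have "E k x y \<le> C / (V (\<delta> powi k) w * decay w (\<delta> powi k) y ^ m)" if wx: "d w x \<le> \<theta> * \<delta> powi k" for k w x y
  proof -
    define r where "r = \<delta> powi k"
    have r: "0 < r" by (simp add: r_def)
    define t where "t = decay w r y"
    have t: "1 \<le> t" using r by (simp add: t_def)
    have Vw: "0 < V r w" and Vx: "0 < V r x" and Vy: "0 < V r y" using r by (auto intro: V_pos)
    have "V r w \<le> (2 * A0 * (1 + (d x w + r) / r)) ^ dm * V r x" using r by (intro V_comp) auto
    also have "\<dots> \<le> (2 * A0 * (2 + \<theta>)) ^ dm * V r x"
    proof (intro mult_right_mono power_mono mult_left_mono)
      have "(d x w + r) / r \<le> (\<theta> * r + r) / r"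
        using wx r by (intro divide_right_mono) (auto simp: r_def d_sym[of x w])
      also have "\<dots> = \<theta> + 1" using r by (simp add: add_divide_distrib)
      finally show "1 + (d x w + r) / r \<le> 2 + \<theta>" by simp
    qed (use A0_ge1 r assms in auto)
    finally have a1: "V r w \<le> (2 * A0 * (2 + \<theta>)) ^ dm * V r x" .
    have "V r w \<le> (2 * A0 * (1 + (d y w + r) / r)) ^ dm * V r y" using r by (intro V_comp) auto
    also have "\<dots> \<le> (4 * A0 * t) ^ dm * V r y"
    proof (intro mult_right_mono power_mono)
      have "1 + (d y w + r) / r = 1 + t" using r by (simp add: t_def decay_def d_sym[of y w] add_divide_distrib)
      also have "\<dots> \<le> 2 * t" using t by simp
      finally have "2 * A0 * (1 + (d y w + r) / r) \<le> 2 * A0 * (2 * t)" using A0_ge1 by (intro mult_left_mono) auto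
      then show "2 * A0 * (1 + (d y w + r) / r) \<le> 4 * A0 * t" by simp
    qed (use A0_ge1 r in auto)
    finally have a2: "V r w \<le> (4 * A0 * t) ^ dm * V r y" .
    have "V r w * V r w \<le> ((2 * A0 * (2 + \<theta>)) ^ dm * V r x) * ((4 * A0 * t) ^ dm * V r y)"
      using Vw Vx a1 A0_ge1 assms by (intro mult_mono a1 a2) auto
    also have "\<dots> = c1 * t ^ dm * (V r x * V r y)" by (simp add: c1_def power_mult_distrib)
    finally have "(V r w)\<^sup>2 \<le> c1 * t ^ dm * (V r x * V r y)" by (simp add: power2_eq_square)
    then have "sqrt ((V r w)\<^sup>2) \<le> sqrt (c1 * t ^ dm * (V r x * V r y))" by (rule real_sqrt_le_mono)
    then have "V r w \<le> sqrt (c1 * t ^ dm) * sqrt (V r x * V r y)" using Vw by (simp add: real_sqrt_mult)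
    \<comment> \<open>A number that is at least 1 dominates its square root; this keeps the
      exponents natural.\<close>
    also have "\<dots> \<le> c1 * t ^ dm * sqrt (V r x * V r y)"
    proof (intro mult_right_mono)
      have "1 * 1 \<le> c1 * t ^ dm" using c1 t by (intro mult_mono one_le_power) auto
      then have "c1 * t ^ dm \<le> (c1 * t ^ dm)\<^sup>2" by (simp add: power2_eq_square mult_le_cancel_left1)
      then show "sqrt (c1 * t ^ dm) \<le> c1 * t ^ dm" using c1 t by (intro real_le_lsqrt) auto
    qed (use Vx Vy in auto)
    finally have v: "V r w \<le> c1 * t ^ dm * sqrt (V r x * V r y)" .
    have "(V r x * V r y) powr (- (1/2)) = 1 / sqrt (V r x * V r y)"
    proof -
      have "(V r x * V r y) powr (1/2) = sqrt (V r x * V r y)"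
        using Vx Vy by (intro powr_half_sqrt) simp
      then show ?thesis by (simp only: powr_minus inverse_eq_divide)
    qed
    also have "\<dots> \<le> c1 * t ^ dm / V r w"
      using v Vx Vy Vw by (simp add: field_simps)
    finally have e1: "(V r x * V r y) powr (- (1/2)) \<le> c1 * t ^ dm / V r w" .
    let ?u = "d x y / r"
    have u: "0 \<le> ?u" using r by simp
    have "d w y \<le> A0 * (d w x + d x y)" by (rule d_tri)
    also have "\<dots> \<le> A0 * (\<theta> * r + d x y)" using wx A0_ge1 by (intro mult_left_mono) (auto simp: r_def)
    finally have "d w y / r \<le> A0 * (\<theta> * r + d x y) / r" using r by (intro divide_right_mono) auto
    also have "\<dots> = A0 * (\<theta> + ?u)" using r by (simp add: field_simps)
    finally have "t \<le> 1 + A0 * (\<theta> + ?u)" by (simp add: t_def decay_def)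
    also have "\<dots> \<le> A0 + A0 * (\<theta> + ?u)" using A0_ge1 by simp
    also have "\<dots> = A0 * (1 + \<theta> + ?u)" by (simp add: algebra_simps)
    also have "\<dots> \<le> A0 * ((1 + \<theta>) * (1 + ?u))"
    proof (rule mult_left_mono)
      have "(1 + \<theta>) * (1 + ?u) = 1 + \<theta> + ?u + \<theta> * ?u"
        by (simp only: distrib_left distrib_right mult_1_left mult_1_right add_ac)
      then show "1 + \<theta> + ?u \<le> (1 + \<theta>) * (1 + ?u)" using mult_nonneg_nonneg[OF assms u] by linarith
    qed (use A0_ge1 in simp)
    finally have tu: "t \<le> c2 * (1 + ?u)" by (simp add: c2_def)
    have "exp (- \<nu> * ?u powr a) \<le> Ce / (1 + ?u) ^ (m + dm)" by (rule Ce(2)[OF u])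
    also have "\<dots> \<le> Ce * c2 ^ (m + dm) / t ^ (m + dm)"
    proof -
      have "t ^ (m + dm) \<le> c2 ^ (m + dm) * (1 + ?u) ^ (m + dm)"
        unfolding power_mult_distrib[symmetric] using tu t by (intro power_mono) auto
      then have "Ce * t ^ (m + dm) \<le> Ce * (c2 ^ (m + dm) * (1 + ?u) ^ (m + dm))"
        using Ce by (intro mult_left_mono) auto
      moreover have "0 < (1 + ?u) ^ (m + dm)" "0 < t ^ (m + dm)" using u t by (auto intro!: zero_less_power)
      ultimately show ?thesis by (intro frac_le_cross) (simp_all only: mult.assoc)
    qed
    finally have e2: "exp (- \<nu> * ?u powr a) \<le> Ce * c2 ^ (m + dm) / t ^ (m + dm)" .
    have "E k x y = (V r x * V r y) powr (- (1/2)) * exp (- \<nu> * ?u powr a)"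
      by (simp add: Eker_def r_def)
    also have "\<dots> \<le> c1 * t ^ dm / V r w * (Ce * c2 ^ (m + dm) / t ^ (m + dm))"
      using c1 t Vw by (intro mult_mono e1 e2) auto
    also have "\<dots> = C / (V r w * t ^ m)"
      using t Vw by (simp add: C_def power_add field_simps)
    finally show ?thesis by (simp add: r_def t_def)
  qed
  with C show ?thesis by blast
qed

text \<open>The scale \<open>s\<close> of the test space need not be the scale of the kernel; only the constant depends on their ratio.\<close>

lemma P_test_bound:
  assumes s: "0 < s" and b: "0 < b" "b \<le> \<eta>" and g: "0 < g" "g \<le> 1"
    and CE: "0 < CE" "\<And>y. E k x y \<le> CE / (V s w * decay w s y ^ (dm + 2))"
  shows "tb w s b g (P k x) (2 ^ (dm + 1) * (CP * CE * (1 + (2 * A0) ^ (dm + 2)) * (1 + (s / \<delta> powi k) powr b)))"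
proof (rule test_boundI_decay)
  define r where "r = \<delta> powi k"
  have r: "0 < r" by (simp add: r_def)
  let ?den = "\<lambda>y. V s w * decay w s y ^ (dm + 2)"
  let ?Q = "(s / r) powr b"
  let ?A = "1 + (2 * A0) ^ (dm + 2)"
  let ?C = "CP * CE * ?A * (1 + ?Q)"
  have den: "0 < ?den y" for y using V_pos[OF s, of w] s by simp
  have p: "0 < CP * CE" using CP CE(1) by simp
  have A1: "1 \<le> ?A" "0 < ?A" using A0_ge1 by (auto intro: add_pos_nonneg)
  have C1: "CP * CE \<le> ?C" and CA: "CP * CE * ?Q \<le> ?C" "CP * CE * ?A * ?Q \<le> ?C"
  proof -
    have "CP * CE * 1 * 1 \<le> ?C" using CP CE(1) A1 by (intro mult_mono) auto
    then show "CP * CE \<le> ?C" by simp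
    have "CP * CE * 1 * ?Q \<le> ?C" using CP CE(1) A1 by (intro mult_mono) auto
    then show "CP * CE * ?Q \<le> ?C" by simp
    show "CP * CE * ?A * ?Q \<le> ?C" using CP CE(1) A1 by (intro mult_left_mono) auto
  qed
  have C0: "0 \<le> ?C" using C1 p by linarith
  then show "0 \<le> CP * CE * ?A * (1 + (s / \<delta> powi k) powr b)" by (simp only: r_def)
  have scale: "(d y z / r) powr b = (d y z / s) powr b * ?Q" for y z
    using s by (simp add: powr_mult[symmetric])
  have size: "cmod (P k x y) \<le> CP * CE / ?den y" for y
  proof -
    have "cmod (P k x y) \<le> CP * (CE / ?den y)"
      using P_size[of k x y] mult_left_mono[OF CE(2)[of y], of CP] CP by linarith
    then show ?thesis by simp
  qed
  fix y
  have "CP * CE / ?den y \<le> ?C / ?den y" using C1 den[of y] by (intro divide_right_mono) auto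
  then show "cmod (P k x y) \<le> CP * CE * ?A * (1 + (s / \<delta> powi k) powr b) / ?den y"
    using size[of y] unfolding r_def by linarith
  fix z assume yz: "d y z \<le> inverse (2 * A0) * (s + d w y)"
  have "cmod (P k x y - P k x z) \<le> ?C * ((d y z / s) powr b / ?den y)"
  proof (cases "d y z \<le> r")
    case True
    have "cmod (P k x y - P k x z) \<le> CP * (d y z / r) powr \<eta> * E k x y"
      using P_reg2[of y z k x] True by (simp add: r_def)
    also have "\<dots> \<le> CP * (d y z / r) powr b * (CE / ?den y)"
      using True r b CP CE(2) by (intro mult_mono powr_mono') auto
    also have "\<dots> = CP * CE * ?Q * ((d y z / s) powr b / ?den y)" unfolding scale by simp
    also have "\<dots> \<le> ?C * ((d y z / s) powr b / ?den y)"
      using CA(1) den[of y] by (intro mult_right_mono) auto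
    finally show ?thesis .
  next
    case False
    \<comment> \<open>Beyond the range of kernel regularity the two sizes are added, and the factor
      (d(y,z)/r)^b \<ge> 1 may be inserted.\<close>
    have "decay w s y \<le> 2 * A0 * decay w s z" using yz s by (intro decay_comparable) auto
    then have "decay w s y ^ (dm + 2) \<le> (2 * A0) ^ (dm + 2) * decay w s z ^ (dm + 2)"
      unfolding power_mult_distrib[symmetric] using s by (intro power_mono) auto
    then have "CP * CE * (V s w * decay w s y ^ (dm + 2)) \<le> CP * CE * (V s w * ((2 * A0) ^ (dm + 2) * decay w s z ^ (dm + 2)))"
      using less_imp_le[OF p] V_nonneg by (intro mult_left_mono)
    then have "CP * CE / ?den z \<le> CP * CE * (2 * A0) ^ (dm + 2) / ?den y"
      by (intro frac_le_cross den) (simp only: mult_ac)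
    then have "cmod (P k x y - P k x z) \<le> CP * CE / ?den y + CP * CE * (2 * A0) ^ (dm + 2) / ?den y"
      using size[of y] size[of z] norm_triangle_ineq4[of "P k x y" "P k x z"] by linarith
    also have "\<dots> = CP * CE * ?A * (1 / ?den y)" by (simp add: algebra_simps add_divide_distrib)
    also have "\<dots> \<le> CP * CE * ?A * ((d y z / r) powr b / ?den y)"
      using False r b p A1 den[of y] by (intro mult_left_mono divide_right_mono ge_one_powr_ge_zero) auto
    also have "\<dots> = CP * CE * ?A * ?Q * ((d y z / s) powr b / ?den y)" unfolding scale by simp
    also have "\<dots> \<le> ?C * ((d y z / s) powr b / ?den y)"
      using CA(2) den[of y] by (intro mult_right_mono) auto
    finally show ?thesis .
  qed
  then show "cmod (P k x y - P k x z) \<le> CP * CE * ?A * (1 + (s / \<delta> powi k) powr b) * (d y z / s) powr b / ?den y"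
    by (simp add: r_def)
qed (use s b g \<eta> in auto)

lemma P_test_bound_scaled:
  assumes "0 \<le> \<theta>" and b: "0 < b" "b \<le> \<eta>" and g: "0 < g" "g \<le> 1"
  shows "\<exists>C>0. \<forall>k w x. d w x \<le> \<theta> * \<delta> powi k \<longrightarrow> tb w (\<delta> powi k) b g (P k x) C"
proof -
  obtain CE where CE: "CE > 0" "\<And>k w x y. d w x \<le> \<theta> * \<delta> powi k \<Longrightarrow>
      E k x y \<le> CE / (V (\<delta> powi k) w * decay w (\<delta> powi k) y ^ (dm + 2))"
    using E_le[OF assms(1), of "dm + 2"] by metis
  let ?C = "2 ^ (dm + 1) * (CP * CE * (1 + (2 * A0) ^ (dm + 2)) * 2)"
  have "tb w (\<delta> powi k) b g (P k x) ?C" if "d w x \<le> \<theta> * \<delta> powi k" for k w x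
  proof -
    have "\<delta> powi k / \<delta> powi k = 1" using \<delta> by simp
    then show ?thesis using P_test_bound[OF scale_pos b g CE(1) CE(2)[OF that]] by simp
  qed
  moreover have "0 < ?C" using CP CE(1) A0_ge1 by (intro mult_pos_pos add_pos_nonneg) auto
  ultimately show ?thesis by blast
qed

text \<open>At a fixed level \<open>k\<close> everything can be referred to the base point and scale
  1, with a constant depending on \<open>k\<close> and \<open>R\<close>; changing the scale from r
  to 1 costs max(1,r) for each power of the weight.\<close>

lemma E_local:
  assumes "0 \<le> R"
  shows "\<exists>C>0. \<forall>x y. d x0 x \<le> R \<longrightarrow> E k x y \<le> C / decay x0 1 y ^ m"
proof -
  define r where "r = \<delta> powi k"
  have r: "0 < r" by (simp add: r_def)
  obtain CE where CE: "CE > 0" "\<And>w x y. d w x \<le> R / r * \<delta> powi k \<Longrightarrow> E k x y \<le> CE / (V r w * decay w r y ^ m)"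
    using E_le[of "R / r" m] assms r unfolding r_def by (metis divide_nonneg_pos)
  have V: "0 < V r x0" using r by (rule V_pos)
  let ?C = "CE * (max 1 r) ^ m / V r x0"
  have "E k x y \<le> ?C / decay x0 1 y ^ m" if "d x0 x \<le> R" for x y
  proof -
    have "d x0 x \<le> R / r * \<delta> powi k" using that \<delta> by (simp add: r_def)
    then have "E k x y \<le> CE / (V r x0 * decay x0 r y ^ m)" by (rule CE(2))
    also have "\<dots> \<le> ?C / decay x0 1 y ^ m"
    proof -
      have "d x0 y \<le> max 1 r * (d x0 y / r)"
      proof -
        have "r * (d x0 y / r) \<le> max 1 r * (d x0 y / r)" using r by (intro mult_right_mono) auto
        then show ?thesis using r by simp
      qed
      then have "decay x0 1 y \<le> max 1 r * decay x0 r y" by (simp add: decay_def distrib_left)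
      then have "decay x0 1 y ^ m \<le> (max 1 r) ^ m * decay x0 r y ^ m"
        unfolding power_mult_distrib[symmetric] by (intro power_mono) auto
      then have "CE * decay x0 1 y ^ m \<le> CE * ((max 1 r) ^ m * decay x0 r y ^ m)"
        using CE by (intro mult_left_mono) auto
      then have "CE * decay x0 1 y ^ m \<le> (CE * (max 1 r) ^ m / V r x0) * (V r x0 * decay x0 r y ^ m)"
        using V by (simp add: mult.assoc)
      then show ?thesis using V r by (intro frac_le_cross) auto
    qed
    finally show ?thesis .
  qed
  moreover have "0 < ?C" using CE V by simp
  ultimately show ?thesis by blast
qed

lemma P_local_test_bound:
  assumes "0 \<le> R"
  shows "\<exists>C>0. \<forall>x. d x0 x \<le> R \<longrightarrow> tb x0 1 \<eta> \<eta> (P k x) C"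
proof -
  have V: "0 < V 1 x0" by (intro V_pos) simp
  obtain CE where CE: "CE > 0" "\<And>x y. d x0 x \<le> R \<Longrightarrow> E k x y \<le> CE / decay x0 1 y ^ (dm + 2)"
    using E_local[OF assms, of k "dm + 2"] by metis
  have CE': "0 < CE * V 1 x0" using CE(1) V by simp
  let ?C = "2 ^ (dm + 1) * (CP * (CE * V 1 x0) * (1 + (2 * A0) ^ (dm + 2)) * (1 + (1 / \<delta> powi k) powr \<eta>))"
  have "tb x0 1 \<eta> \<eta> (P k x) ?C" if x: "d x0 x \<le> R" for x
  proof (rule P_test_bound[OF _ _ _ _ _ CE'])
    show "E k x y \<le> CE * V 1 x0 / (V 1 x0 * decay x0 1 y ^ (dm + 2))" for y
      using CE(2)[OF x, of y] V by simp
  qed (use \<eta> in auto)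
  moreover have "0 < ?C" using CP CE(1) V A0_ge1 by (intro mult_pos_pos add_pos_nonneg) auto
  ultimately show ?thesis by blast
qed

lemma P_in_G\<eta>: "P k x \<in> G\<eta>"
  using P_local_test_bound[of "d x0 x" k] by (metis d_nonneg order_refl test_spaceI zero_less_one)

lemma interpolation_G0:
  assumes "0 \<le> L" "0 < \<tau>"
  shows "\<exists>\<epsilon>>0. \<forall>g. (\<forall>y. cmod (g y) \<le> \<epsilon> / decay x0 1 y ^ interp_exp \<beta> \<eta>) \<longrightarrow>
      (\<forall>y z. cmod (g y - g z) \<le> L * d y z powr \<eta>) \<longrightarrow> tb x0 1 \<beta> \<gamma> g \<tau>"
proof -
  have le: "\<eta> \<le> 1" "\<gamma> \<le> 1" using \<eta> \<gamma> by auto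
  from interpolation[OF \<beta> le(1) \<gamma>(1) le(2) assms, of x0] show ?thesis by (simp only: imp_conjL)
qed

text \<open>This is continuity of x \<mapsto> P_k(x, .) into the test space, uniform on bounded
  sets. Regularity in the first variable makes the difference small with rapid decay, both kernels
  are uniformly \<eta>-Hoelder in the second, and \<open>interpolation_G0\<close> combines the two
  facts.\<close>

lemma P_modulus:
  assumes "0 \<le> R" "0 < \<tau>"
  shows "\<exists>\<rho>>0. \<forall>x x'. d x0 x \<le> R \<longrightarrow> d x0 x' \<le> R \<longrightarrow> d x x' < \<rho> \<longrightarrow> tb x0 1 \<beta> \<gamma> (\<lambda>y. P k x y - P k x' y) \<tau>"
proof -
  define r where "r = \<delta> powi k"
  have r: "0 < r" by (simp add: r_def)
  let ?N = "interp_exp \<beta> \<eta>"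
  obtain CE where CE: "CE > 0" "\<And>x y. d x0 x \<le> R \<Longrightarrow> E k x y \<le> CE / decay x0 1 y ^ ?N"
    using E_local[OF assms(1), of k ?N] by metis
  obtain CE0 where CE0: "CE0 > 0" "\<And>x y. d x0 x \<le> R \<Longrightarrow> E k x y \<le> CE0 / decay x0 1 y ^ 0"
    using E_local[OF assms(1), of k 0] by metis
  define K0 where "K0 = CP * CE0"
  define L where "L = (K0 + 2 * K0) / r powr \<eta>"
  have pos: "0 \<le> K0" using CP CE0 by (simp add: K0_def)
  have size: "cmod (P k x y) \<le> K0" if "d x0 x \<le> R" for x y
  proof -
    have "CP * E k x y \<le> K0" using CE0(2)[OF that, of y] CP by (simp add: K0_def)
    then show ?thesis using P_size[of k x y] by linarith
  qed
  have hold: "cmod (P k x y - P k x z) \<le> L * d y z powr \<eta>" if x: "d x0 x \<le> R" for x y z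
  proof -
    have "cmod (P k x y - P k x z) \<le> (K0 + 2 * K0) * (d y z / r) powr \<eta>"
    proof (cases "d y z \<le> r")
      case True
      have "cmod (P k x y - P k x z) \<le> CP * (d y z / r) powr \<eta> * E k x y"
        using P_reg2[of y z k x] True by (simp add: r_def)
      also have "\<dots> \<le> CP * (d y z / r) powr \<eta> * CE0"
        using CE0(2)[OF x, of y] CP by (intro mult_left_mono) auto
      also have "\<dots> = K0 * (d y z / r) powr \<eta>" by (simp add: K0_def)
      also have "\<dots> \<le> (K0 + 2 * K0) * (d y z / r) powr \<eta>"
        using pos by (intro mult_right_mono) (linarith, simp)
      finally show ?thesis .
    next
      case False
      have "cmod (P k x y - P k x z) \<le> 2 * K0 * 1"
        using size[OF x, of y] size[OF x, of z] norm_triangle_ineq4[of "P k x y" "P k x z"] by simp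
      also have "\<dots> \<le> (K0 + 2 * K0) * (d y z / r) powr \<eta>"
        using False r \<eta> pos by (intro mult_mono ge_one_powr_ge_zero) auto
      finally show ?thesis .
    qed
    then show ?thesis using r by (simp add: L_def powr_divide)
  qed
  have L: "0 \<le> 2 * L" using pos by (simp add: L_def)
  obtain \<epsilon> where \<epsilon>: "\<epsilon> > 0" "\<And>g. (\<And>y. cmod (g y) \<le> \<epsilon> / decay x0 1 y ^ ?N) \<Longrightarrow>
      (\<And>y z. cmod (g y - g z) \<le> 2 * L * d y z powr \<eta>) \<Longrightarrow> tb x0 1 \<beta> \<gamma> g \<tau>"
    using interpolation_G0[OF L assms(2)] by metis
  \<comment> \<open>The first entry permits kernel regularity, the second makes (d(x,x')/r)^\<eta>
    at most \<epsilon>/(CP CE).\<close>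
  define \<rho> where "\<rho> = min r (r * (\<epsilon> / (CP * CE)) powr (1 / \<eta>))"
  have \<rho>: "0 < \<rho>" using r \<epsilon> CP CE by (simp add: \<rho>_def)
  have "tb x0 1 \<beta> \<gamma> (\<lambda>y. P k x y - P k x' y) \<tau>" if x: "d x0 x \<le> R" "d x0 x' \<le> R" "d x x' < \<rho>" for x x'
  proof (rule \<epsilon>(2))
    fix y z
    have xr: "d x x' \<le> r" "d x x' / r \<le> (\<epsilon> / (CP * CE)) powr (1 / \<eta>)"
      using x(3) r by (auto simp: \<rho>_def field_simps)
    have "(d x x' / r) powr \<eta> \<le> ((\<epsilon> / (CP * CE)) powr (1 / \<eta>)) powr \<eta>"
      using xr r \<eta> by (intro powr_mono2) auto
    also have "\<dots> = \<epsilon> / (CP * CE)" using \<eta> \<epsilon> CP CE by (simp add: powr_powr)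
    finally have p: "(d x x' / r) powr \<eta> \<le> \<epsilon> / (CP * CE)" .
    have "cmod (P k x y - P k x' y) \<le> CP * (d x x' / r) powr \<eta> * E k x y"
      using P_reg1[of x x' k y] xr by (simp add: r_def)
    also have "\<dots> \<le> CP * (\<epsilon> / (CP * CE)) * (CE / decay x0 1 y ^ ?N)"
      using p CP CE(2)[OF x(1)] \<epsilon> CE by (intro mult_mono) auto
    also have "\<dots> = \<epsilon> / decay x0 1 y ^ ?N" using CP CE by simp
    finally show "cmod (P k x y - P k x' y) \<le> \<epsilon> / decay x0 1 y ^ ?N" .
    have "cmod ((P k x y - P k x' y) - (P k x z - P k x' z)) \<le> cmod (P k x y - P k x z) + cmod (P k x' y - P k x' z)"
      using norm_triangle_ineq4[of "P k x y - P k x z" "P k x' y - P k x' z"] by (simp add: algebra_simps)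
    then show "cmod ((P k x y - P k x' y) - (P k x z - P k x' z)) \<le> 2 * L * d y z powr \<eta>"
      using hold[OF x(1), of y z] hold[OF x(2), of y z] by linarith
  qed
  with \<rho> show ?thesis by blast
qed

end

section \<open>Convergence of the averages\<close>

context hts
begin

lemma dominated_by_size:
  assumes h [measurable]: "(h :: 'a \<Rightarrow> complex) \<in> borel_measurable \<mu>"
    and le: "\<And>x. cmod (h x) \<le> K * sz y r 1 x" and "0 \<le> K" "0 < r"
  shows "integrable \<mu> h" "cmod (\<integral>x. h x \<partial>\<mu>) \<le> K * size_const 1"
proof -
  have "(\<integral>\<^sup>+x. ennreal (cmod (h x)) \<partial>\<mu>) \<le> (\<integral>\<^sup>+x. ennreal K * ennreal (sz y r 1 x) \<partial>\<mu>)"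
    using le assms by (intro nn_integral_mono) (auto simp: ennreal_mult[symmetric] intro: ennreal_leI)
  also have "\<dots> = ennreal K * (\<integral>\<^sup>+x. ennreal (sz y r 1 x) \<partial>\<mu>)" by (simp add: nn_integral_cmult)
  also have "\<dots> \<le> ennreal K * ennreal (size_const 1)"
    using assms by (intro mult_left_mono nn_integral_size_const) auto
  finally have le: "(\<integral>\<^sup>+x. ennreal (cmod (h x)) \<partial>\<mu>) \<le> ennreal (K * size_const 1)"
    using assms by (simp add: ennreal_mult' ennreal_mult'')
  show i: "integrable \<mu> h"
    using le by (intro integrableI_bounded) (auto intro: le_less_trans)
  have "ennreal (cmod (\<integral>x. h x \<partial>\<mu>)) \<le> ennreal (K * size_const 1)"
    using integral_norm_bound_ennreal[OF i] le by (rule order_trans)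
  then show "cmod (\<integral>x. h x \<partial>\<mu>) \<le> K * size_const 1"
    using assms size_const_pos[of 1] by (subst (asm) ennreal_le_iff) auto
qed

lemma bounded_on_finite_set:
  assumes A [measurable]: "A \<in> sets \<mu>" and fin: "emeasure \<mu> A < \<infinity>"
    and h [measurable]: "(h :: 'a \<Rightarrow> complex) \<in> borel_measurable \<mu>"
    and le: "\<And>x. x \<in> A \<Longrightarrow> cmod (h x) \<le> K" and "0 \<le> K"
  shows "integrable \<mu> (\<lambda>x. indicator A x * h x)" "cmod (\<integral>x. indicator A x * h x \<partial>\<mu>) \<le> K * measure \<mu> A"
proof -
  have iA: "integrable \<mu> (\<lambda>x. K * indicator A x)" using fin by (intro integrable_mult_right) simp
  have le': "cmod (indicator A x * h x) \<le> K * indicator A x" for x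
    using le[of x] by (simp split: split_indicator)
  show i: "integrable \<mu> (\<lambda>x. indicator A x * h x)"
  proof (rule Bochner_Integration.integrable_bound[OF iA])
    show "AE x in \<mu>. cmod (indicator A x * h x) \<le> norm (K * indicator A x)"
      using le' by (intro AE_I2) (simp add: order_trans[OF _ abs_ge_self])
  qed measurable
  have "cmod (\<integral>x. indicator A x * h x \<partial>\<mu>) \<le> (\<integral>x. cmod (indicator A x * h x) \<partial>\<mu>)" by (rule integral_norm_bound)
  also have "\<dots> \<le> (\<integral>x. K * indicator A x \<partial>\<mu>)"
    using i iA le' by (intro integral_mono integrable_norm)
  finally show "cmod (\<integral>x. indicator A x * h x \<partial>\<mu>) \<le> K * measure \<mu> A" by simp
qed

text \<open>Size and regularity bound values and differences linearly, so they survive integration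
  in the parameter by the triangle inequality for scalar integrals; no vector-valued integral is
  involved.\<close>

lemma test_bound_integral:
  assumes A [measurable]: "A \<in> sets \<mu>" and fin: "emeasure \<mu> A < \<infinity>"
    and F [measurable]: "\<And>y. (\<lambda>x. F x y) \<in> borel_measurable \<mu>" and \<phi> [measurable]: "\<phi> \<in> borel_measurable \<mu>"
    and L: "\<And>x. x \<in> A \<Longrightarrow> cmod (\<phi> x) \<le> L" "0 \<le> L" and K: "0 \<le> K" "\<And>x. x \<in> A \<Longrightarrow> tb w r b g (F x) K" and r: "0 < r"
  shows "tb w r b g (\<lambda>y. \<integral>x. indicator A x * (F x y * \<phi> x) \<partial>\<mu>) (K * L * measure \<mu> A)"
  unfolding test_bound_def
proof (intro conjI allI impI)
  have s: "cmod (F x y * \<phi> x) \<le> K * sz w r g y * L" if "x \<in> A" for x y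
    using K(2)[OF that] L(1)[OF that] L(2) K(1) r unfolding norm_mult test_bound_def by (intro mult_mono) auto
  fix y
  have "cmod (\<integral>x. indicator A x * (F x y * \<phi> x) \<partial>\<mu>) \<le> (K * sz w r g y * L) * measure \<mu> A"
    using s K L r by (intro bounded_on_finite_set(2)[OF A fin]) auto
  then show "cmod (\<integral>x. indicator A x * (F x y * \<phi> x) \<partial>\<mu>) \<le> K * L * measure \<mu> A * sz w r g y"
    by (simp add: mult_ac)
  fix z assume yz: "d y z \<le> inverse (2 * A0) * (r + d w y)"
  let ?e = "K * (d y z / (r + d w y)) powr b * sz w r g y"
  have i: "integrable \<mu> (\<lambda>x. indicator A x * (F x y * \<phi> x))" for y
    using s[of _ y] K L r by (intro bounded_on_finite_set(1)[OF A fin, where K="K * sz w r g y * L"]) auto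
  have "(\<integral>x. indicator A x * (F x y * \<phi> x) \<partial>\<mu>) - (\<integral>x. indicator A x * (F x z * \<phi> x) \<partial>\<mu>)
     = (\<integral>x. indicator A x * ((F x y - F x z) * \<phi> x) \<partial>\<mu>)"
    by (subst Bochner_Integration.integral_diff[symmetric, OF i i]) (simp add: algebra_simps)
  also have "cmod \<dots> \<le> (?e * L) * measure \<mu> A"
  proof (rule bounded_on_finite_set(2)[OF A fin])
    fix x assume x: "x \<in> A"
    have "cmod (F x y - F x z) \<le> ?e" using K(2)[OF x] yz unfolding test_bound_def by blast
    then show "cmod ((F x y - F x z) * \<phi> x) \<le> ?e * L"
      using L(1)[OF x] L(2) K(1) r unfolding norm_mult by (intro mult_mono) auto
  qed (use K L r in auto)
  finally show "cmod ((\<integral>x. indicator A x * (F x y * \<phi> x) \<partial>\<mu>) - (\<integral>x. indicator A x * (F x z * \<phi> x) \<partial>\<mu>))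
     \<le> K * L * measure \<mu> A * (d y z / (r + d w y)) powr b * sz w r g y"
    by (simp add: mult_ac)
qed

lemma test_bound_sum:
  assumes "finite I" "\<And>i. i \<in> I \<Longrightarrow> tb w r b g (f i) (C i)" "0 < r"
  shows "tb w r b g (\<lambda>y. \<Sum>i\<in>I. f i y) (\<Sum>i\<in>I. C i)"
  using assms(1,2)
proof (induction I rule: finite_induct)
  case empty
  then show ?case by (simp add: test_bound_def)
qed (simp add: test_bound_add)

lemma integral_partition:
  fixes n :: nat
  assumes A: "\<And>i. i < n \<Longrightarrow> A i \<in> sets \<mu>" "\<And>i. i < n \<Longrightarrow> A i \<subseteq> S" and disj: "disjoint_family_on A {..<n}"
    and S: "S \<in> sets \<mu>" and h: "integrable \<mu> (\<lambda>x. indicator S x * h x :: complex)"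
  shows "(\<integral>x. indicator S x * h x \<partial>\<mu>) = (\<Sum>i<n. \<integral>x. indicator (A i) x * h x \<partial>\<mu>) + (\<integral>x. indicator (S - (\<Union>i<n. A i)) x * h x \<partial>\<mu>)"
proof -
  have i: "integrable \<mu> (\<lambda>x. indicator T x * h x)" if T: "T \<in> sets \<mu>" "T \<subseteq> S" for T
  proof -
    have "integrable \<mu> (\<lambda>x. indicator T x *\<^sub>R (indicator S x * h x))"
      using T(1) h by (rule integrable_mult_indicator)
    moreover have "(\<lambda>x. indicator T x *\<^sub>R (indicator S x * h x)) = (\<lambda>x. indicator T x * h x)"
      by (rule ext) (use T(2) in \<open>auto split: split_indicator\<close>)
    ultimately show ?thesis by simp
  qed
  let ?U = "\<Union>i<n. A i"
  have U: "?U \<in> sets \<mu>" using A by (intro sets.finite_UN) auto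
  have US: "?U \<subseteq> S" using A by auto
  have pw: "indicator S x * h x = (\<Sum>i<n. indicator (A i) x * h x) + indicator (S - ?U) x * h x" for x
  proof -
    have "(\<Sum>i<n. indicator (A i) x * h x) = (\<Sum>i<n. indicator (A i) x) * h x" by (simp add: sum_distrib_right)
    also have "(\<Sum>i<n. indicator (A i) x) = (indicator ?U x :: complex)"
      using disj by (intro indicator_UN_disjoint[symmetric]) auto
    finally have eq: "(\<Sum>i<n. indicator (A i) x * h x) = indicator ?U x * h x" .
    show ?thesis unfolding eq using US by (auto split: split_indicator)
  qed
  have "(\<integral>x. indicator S x * h x \<partial>\<mu>) = (\<integral>x. (\<Sum>i<n. indicator (A i) x * h x) + indicator (S - ?U) x * h x \<partial>\<mu>)"
    using pw by (intro Bochner_Integration.integral_cong) auto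
  also have "\<dots> = (\<integral>x. (\<Sum>i<n. indicator (A i) x * h x) \<partial>\<mu>) + (\<integral>x. indicator (S - ?U) x * h x \<partial>\<mu>)"
    using A S U by (intro Bochner_Integration.integral_add Bochner_Integration.integrable_sum i) auto
  also have "(\<integral>x. (\<Sum>i<n. indicator (A i) x * h x) \<partial>\<mu>) = (\<Sum>i<n. \<integral>x. indicator (A i) x * h x \<partial>\<mu>)"
    using A by (intro Bochner_Integration.integral_sum i) auto
  finally show ?thesis .
qed

end

text \<open>Small balls with centres in \<open>D\<close> cover the large one and are made disjoint.
  Its measure being finite, continuity from above makes the part missed by finitely many pieces as
  small as desired.\<close>

lemma (in hts_sep) fine_partition:
  assumes "0 < R" "0 < \<rho>" "0 < \<kappa>"
  shows "\<exists>n A c. (\<forall>i<n. A i \<in> sets \<mu> \<and> A i \<subseteq> B w R \<and> c i \<in> B w R \<and> (\<forall>x\<in>A i. d x (c i) < \<rho>)) \<and>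
    disjoint_family_on A {..<n::nat} \<and> measure \<mu> (B w R - (\<Union>i<n. A i)) < \<kappa>"
proof -
  have "D \<noteq> {}" using dense_D[of 1] by auto
  define v where "v = from_nat_into D"
  have v: "range v = D" using \<open>D \<noteq> {}\<close> countable_D by (simp add: v_def)
  define C where "C = (\<lambda>i. B w R \<inter> B (v i) (\<rho> / (2 * A0)))"
  define A where "A = disjointed C"
  have \<rho>': "0 < \<rho> / (2 * A0)" using assms A0_ge1 by simp
  have AC: "A i \<subseteq> C i" for i unfolding A_def by (rule disjointed_subset)
  have AR: "A i \<subseteq> B w R" for i using AC[of i] by (auto simp: C_def)
  have "range C \<subseteq> sets \<mu>" by (auto simp: C_def)
  then have "range A \<subseteq> sets \<mu>" unfolding A_def by (rule sets.range_disjointed_sets)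
  then have Am [measurable]: "A i \<in> sets \<mu>" for i by auto
  have UA: "(\<Union>i. A i) = B w R"
  proof -
    have "(\<Union>i. A i) = (\<Union>i. C i)" unfolding A_def by (rule UN_disjointed_eq)
    also have "\<dots> = B w R"
    proof (intro equalityI subsetI)
      fix x assume x: "x \<in> B w R"
      obtain u where u: "u \<in> D" "d x u < \<rho> / (2 * A0)" using dense_D[OF \<rho>'] by metis
      obtain i where "u = v i" using u v by auto
      then have "x \<in> C i" using x u by (simp add: C_def qball_def d_sym[of "v i"])
      then show "x \<in> (\<Union>i. C i)" by auto
    qed (auto simp: C_def)
    finally show ?thesis .
  qed
  define S where "S = (\<lambda>n. B w R - (\<Union>i<n. A i))"
  have Sm [measurable]: "S n \<in> sets \<mu>" for n unfolding S_def by measurable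
  have Sfin: "emeasure \<mu> (S n) \<noteq> \<infinity>" for n
  proof -
    have "emeasure \<mu> (S n) \<le> emeasure \<mu> (B w R)" unfolding S_def by (intro emeasure_mono) auto
    then show ?thesis using emeasure_ball_fin[of w R] by (auto simp: top_unique)
  qed
  have "(\<lambda>n. emeasure \<mu> (S n)) \<longlonglongrightarrow> emeasure \<mu> (\<Inter>n. S n)"
  proof (rule Lim_emeasure_decseq)
    show "decseq S" unfolding S_def decseq_def by (auto intro: less_le_trans)
  qed (use Sfin Sm in auto)
  moreover have "(\<Inter>n. S n) = {}"
  proof -
    have "x \<notin> (\<Inter>n. S n)" for x
    proof
      assume x: "x \<in> (\<Inter>n. S n)"
      then have "x \<in> S 0" by blast
      then have "x \<in> (\<Union>i. A i)" unfolding UA by (simp add: S_def)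
      then obtain i where "x \<in> A i" by blast
      then have "x \<notin> S (Suc i)" by (auto simp: S_def)
      with x show False by blast
    qed
    then show ?thesis by blast
  qed
  ultimately have "(\<lambda>n. emeasure \<mu> (S n)) \<longlonglongrightarrow> 0" by simp
  then have "\<forall>\<^sub>F n in sequentially. emeasure \<mu> (S n) < ennreal \<kappa>"
    using assms by (intro order_tendstoD(2)[of _ 0]) auto
  then obtain n where n: "emeasure \<mu> (S n) < ennreal \<kappa>" by (auto simp: eventually_sequentially)
  then have "measure \<mu> (S n) < \<kappa>"
    using Sfin[of n] assms by (simp add: emeasure_eq_ennreal_measure[OF Sfin[of n, unfolded infinity_ennreal_def]] ennreal_less_iff)
  \<comment> \<open>Disjointing may leave empty pieces; these receive the centre of the ball, so
    that every tag lies in it.\<close>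
  define c where "c = (\<lambda>i. if A i = {} then w else SOME x. x \<in> A i)"
  have c: "c i \<in> A i" if "A i \<noteq> {}" for i using that by (auto simp: c_def intro: someI_ex)
  have cR: "c i \<in> B w R" for i
  proof (cases "A i = {}")
    case True
    then show ?thesis using assms by (simp add: c_def qball_def)
  qed (use c AR in blast)
  have cA: "d x (c i) < \<rho>" if "x \<in> A i" for x i
  proof -
    have "c i \<in> A i" using that c by blast
    then have "d (v i) (c i) < \<rho> / (2 * A0)" "d (v i) x < \<rho> / (2 * A0)" using AC[of i] that by (auto simp: C_def qball_def)
    then have "d x (v i) + d (v i) (c i) < \<rho> / (2 * A0) + \<rho> / (2 * A0)" by (simp add: d_sym[of x])
    then have "A0 * (d x (v i) + d (v i) (c i)) < A0 * (\<rho> / (2 * A0) + \<rho> / (2 * A0))"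
      using A0_ge1 by (intro mult_strict_left_mono) auto
    also have "\<dots> = \<rho>" using A0_ge1 by (simp add: field_simps)
    finally show ?thesis using d_tri[of x "c i" "v i"] by linarith
  qed
  have "disjoint_family_on A {..<n}"
    using disjoint_family_disjointed[of C] unfolding A_def by (rule disjoint_family_on_mono[rotated]) simp
  then show ?thesis
    using Am AR cR cA \<open>measure \<mu> (S n) < \<kappa>\<close> unfolding S_def
    by (intro exI[of _ n] exI[of _ A] exI[of _ c] conjI allI impI ballI) auto
qed

context ati
begin

text \<open>The transposed operator: integrating in the first variable gives a superposition of the
  functions P_k(x, .), to which a distribution can be applied under the integral sign.\<close>

definition avg :: "int \<Rightarrow> ('a \<Rightarrow> complex) \<Rightarrow> 'a \<Rightarrow> complex" where
  "avg k \<phi> y = (\<integral>x. P k x y * \<phi> x \<partial>\<mu>)"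

text \<open>The exponential decay supplies any number of spare powers of the weight, uniformly in
  \<open>k\<close>; they absorb distances while an integrable size function of order 1
  remains.\<close>

lemma E_size: "\<exists>C>0. \<forall>k x y. E k x y * decay y (\<delta> powi k) x ^ m \<le> C * sz y (\<delta> powi k) 1 x"
proof -
  obtain CE where CE: "CE > 0" "\<And>k w x y. d w x \<le> 0 * \<delta> powi k \<Longrightarrow>
      E k x y \<le> CE / (V (\<delta> powi k) w * decay w (\<delta> powi k) y ^ (m + (dm + 1)))"
    using E_le[of 0 "m + (dm + 1)"] by (metis order_refl)
  have "E k x y * decay y (\<delta> powi k) x ^ m \<le> CE * 2 ^ (dm + 1) * sz y (\<delta> powi k) 1 x" for k x y
  proof -
    define r where "r = \<delta> powi k"
    have r: "0 < r" by (simp add: r_def)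
    have V: "0 < V r y" using r by (rule V_pos)
    let ?t = "decay y r x"
    have "E k y x \<le> CE / (V r y * ?t ^ (m + (dm + 1)))" unfolding r_def by (rule CE(2)) simp
    then have "E k x y * ?t ^ m \<le> CE / (V r y * ?t ^ (m + (dm + 1))) * ?t ^ m"
      unfolding E_sym[of k x y] using r by (intro mult_right_mono) auto
    also have "\<dots> = CE * (1 / (V r y * ?t ^ (dm + 1)))" using r by (simp add: power_add)
    also have "\<dots> \<le> CE * (2 ^ (dm + 1) * sz y r 1 x)"
      using CE r by (intro mult_left_mono size_ge_decay) auto
    finally show ?thesis by (simp add: r_def)
  qed
  then show ?thesis using CE by (intro exI[of _ "CE * 2 ^ (dm + 1)"]) auto
qed

text \<open>The integral of a non-integrable function is 0 by convention, so an integral equal to 1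
  forces integrability.\<close>

lemma P_integrable: "integrable \<mu> (\<lambda>x. P k x y)"
  using P_integral[of k y] not_integrable_integral_eq by fastforce

lemma powr_le_decay:
  assumes "0 < r" "0 < s" "s \<le> 1"
  shows "d x y powr s \<le> r powr s * decay y r x"
proof -
  have "d x y / r \<le> decay y r x" by (simp add: decay_def d_sym[of x y])
  then have "(d x y / r) powr s \<le> decay y r x powr s" using assms by (intro powr_mono2) auto
  also have "\<dots> \<le> decay y r x" using assms powr_mono[of s 1 "decay y r x"] by simp
  finally have "r powr s * (d x y / r) powr s \<le> r powr s * decay y r x" by (intro mult_left_mono) auto
  then show ?thesis using assms by (simp add: powr_divide)
qed

context
  fixes \<phi> :: "'a \<Rightarrow> complex" and L R :: real
  assumes L: "0 < L" and R: "1 \<le> R" and \<phi>L: "\<And>y. cmod (\<phi> y) \<le> L"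
    and supp: "\<And>y. y \<notin> B x0 R \<Longrightarrow> \<phi> y = 0" and hoelder: "\<And>y z. cmod (\<phi> y - \<phi> z) \<le> L * d y z powr \<eta>"
begin

section \<open>Averages of a Hoelder function with bounded support\<close>

lemma \<phi>_measurable [measurable]: "\<phi> \<in> borel_measurable \<mu>"
proof (intro measurable_continuous continuous_hoelder[of \<eta>])
  fix x show "\<exists>\<rho>>0. \<exists>C. \<forall>y. d x y < \<rho> \<longrightarrow> dist (\<phi> x) (\<phi> y) \<le> C * d x y powr \<eta>"
    by (rule exI[of _ 1], intro conjI exI[of _ L] allI impI) (simp_all add: dist_norm hoelder)
qed (use \<eta> in simp)

text \<open>Near the support, normalisation replaces \<phi>(x) by \<phi>(x) - \<phi>(y), and the
  Hoelder bound gains \<delta>^(k\<eta>). Far away \<phi>(y) = 0 and only kernel values at distances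
  of the order of the decay weight enter, which gain equally many powers of \<delta>^k and of the
  weight. Writing the exponent as a successor secures at least one power of \<delta>^k, which for k
  \<ge> 0 is at most \<delta>^(k\<eta>).\<close>

lemma avg_size: "\<exists>A>0. \<forall>k y. 0 \<le> k \<longrightarrow> cmod (avg k \<phi> y - \<phi> y) \<le> A * (\<delta> powi k) powr \<eta> / decay x0 1 y ^ Suc N"
proof -
  let ?M = "Suc N" let ?S = "size_const 1"
  have S: "0 < ?S" by (intro size_const_pos) simp
  obtain C1 where C1: "C1 > 0" "\<And>k x y. E k x y * decay y (\<delta> powi k) x ^ 1 \<le> C1 * sz y (\<delta> powi k) 1 x"
    using E_size[of 1] by metis
  obtain CN where CN: "CN > 0" "\<And>k x y. E k x y * decay y (\<delta> powi k) x ^ ?M \<le> CN * sz y (\<delta> powi k) 1 x"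
    using E_size[of ?M] by metis
  define A1 where "A1 = CP * L * C1 * ?S * (4 * A0 * R) ^ ?M"
  define A2 where "A2 = CP * L * CN * ?S * (4 * A0) ^ ?M"
  have A12: "0 < A1" "0 < A2" using CP L C1 CN S R A0_ge1 by (auto simp: A1_def A2_def)
  have "cmod (avg k \<phi> y - \<phi> y) \<le> (A1 + A2) * (\<delta> powi k) powr \<eta> / decay x0 1 y ^ ?M" if k: "0 \<le> k" for k y
  proof -
    define r where "r = \<delta> powi k"
    have r: "0 < r" by (simp add: r_def)
    have r1: "r \<le> 1" unfolding r_def using k \<delta> by (simp add: power_int_def power_le_one)
    let ?t = "decay x0 1 y"
    have t: "0 < ?t ^ ?M" by simp
    show ?thesis
    \<comment> \<open>Beyond this threshold the first term of d(x0,y) \<le> A0 R + A0 d(x,y), valid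
      for \<open>x\<close> in the support, is absorbed on the left.\<close>
    proof (cases "d x0 y < 2 * A0 * R")
      case True
      have le: "cmod (P k x y * (\<phi> x - \<phi> y)) \<le> (CP * L * r powr \<eta> * C1) * sz y r 1 x" for x
      proof -
        have "cmod (P k x y * (\<phi> x - \<phi> y)) \<le> (CP * E k x y) * (L * d x y powr \<eta>)"
          unfolding norm_mult using CP by (intro mult_mono P_size hoelder) auto
        also have "\<dots> \<le> (CP * E k x y) * (L * (r powr \<eta> * decay y r x))"
          using CP L r \<eta> by (intro mult_left_mono powr_le_decay) auto
        also have "\<dots> = (CP * L * r powr \<eta>) * (E k x y * decay y r x ^ 1)" by simp
        also have "\<dots> \<le> (CP * L * r powr \<eta>) * (C1 * sz y r 1 x)"
          unfolding r_def using CP L by (intro mult_left_mono C1(2)) auto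
        finally show ?thesis by (simp add: mult.assoc)
      qed
      have i: "integrable \<mu> (\<lambda>x. P k x y * (\<phi> x - \<phi> y))"
        and b: "cmod (\<integral>x. P k x y * (\<phi> x - \<phi> y) \<partial>\<mu>) \<le> (CP * L * r powr \<eta> * C1) * ?S"
        using dominated_by_size[OF _ le] CP L C1 r by simp_all
      have "(\<integral>x. P k x y * (\<phi> x - \<phi> y) \<partial>\<mu>) = avg k \<phi> y - \<phi> y"
      proof -
        have i2: "integrable \<mu> (\<lambda>x. P k x y * \<phi> y)" using P_integrable by simp
        have "avg k \<phi> y = (\<integral>x. P k x y * (\<phi> x - \<phi> y) + P k x y * \<phi> y \<partial>\<mu>)"
          unfolding avg_def by (simp add: algebra_simps)
        also have "\<dots> = (\<integral>x. P k x y * (\<phi> x - \<phi> y) \<partial>\<mu>) + \<phi> y"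
          using i i2 by (simp add: P_integral)
        finally show ?thesis by simp
      qed
      then have "cmod (avg k \<phi> y - \<phi> y) \<le> (CP * L * r powr \<eta> * C1) * ?S" using b by simp
      also have "\<dots> \<le> (CP * L * r powr \<eta> * C1) * ?S * ((4 * A0 * R) ^ ?M / ?t ^ ?M)"
      proof -
        have "1 \<le> 2 * A0 * R" using mult_mono[of 1 "2 * A0" 1 R] A0_ge1 R by simp
        then have "?t \<le> 4 * A0 * R" using True by (simp add: decay_def)
        then have "?t ^ ?M \<le> (4 * A0 * R) ^ ?M" by (intro power_mono) auto
        then have one: "1 \<le> (4 * A0 * R) ^ ?M / ?t ^ ?M" using t by (simp only: le_divide_eq_1_pos)
        have "0 \<le> (CP * L * r powr \<eta> * C1) * ?S" using CP L C1(1) S by simp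
        from mult_left_mono[OF one this] show ?thesis by (simp only: mult_1_right)
      qed
      also have "\<dots> = A1 * (r powr \<eta> / ?t ^ ?M)" by (simp add: A1_def)
      also have "\<dots> \<le> (A1 + A2) * (r powr \<eta> / ?t ^ ?M)" using A12 t by (intro mult_right_mono divide_nonneg_pos) auto
      finally show ?thesis by (simp add: r_def)
    next
      case False
      have "R \<le> 2 * A0 * R" using A0_ge1 R by simp
      then have y0: "\<phi> y = 0" using False supp[of y] by (auto simp: qball_def)
      have le: "cmod (P k x y * \<phi> x) \<le> (CP * L * (4 * A0 * r / ?t) ^ ?M * CN) * sz y r 1 x" for x
      proof (cases "x \<in> B x0 R")
        case True
        then have x: "d x0 x < R" by (simp add: qball_def)
        have "d x0 y \<le> A0 * (d x0 x + d x y)" by (rule d_tri)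
        also have "\<dots> \<le> A0 * (R + d x y)" using x A0_ge1 by (intro mult_left_mono) auto
        finally have "d x0 y \<le> A0 * R + A0 * d x y" by (simp add: distrib_left)
        then have "d x0 y \<le> 2 * A0 * d x y" using False by simp
        moreover have "1 \<le> d x0 y"
        proof -
          have "1 * 1 \<le> 2 * A0 * R" using A0_ge1 R by (intro mult_mono) auto
          then show ?thesis using False by simp
        qed
        ultimately have "?t \<le> 4 * A0 * d x y" by (simp add: decay_def)
        also have "d x y \<le> r * decay y r x" using r by (simp add: decay_def d_sym[of x y] field_simps)
        finally have "?t \<le> 4 * A0 * (r * decay y r x)" using A0_ge1 by (simp add: mult_left_mono)
        then have "1 \<le> 4 * A0 * r / ?t * decay y r x" by (simp add: field_simps)
        then have "1 \<le> (4 * A0 * r / ?t * decay y r x) ^ ?M" by (rule one_le_power)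
        then have one: "1 \<le> (4 * A0 * r / ?t) ^ ?M * decay y r x ^ ?M" by (simp only: power_mult_distrib)
        have "cmod (P k x y * \<phi> x) \<le> (CP * E k x y) * L"
          unfolding norm_mult using CP by (intro mult_mono P_size \<phi>L) auto
        also have "\<dots> \<le> (CP * E k x y) * L * ((4 * A0 * r / ?t) ^ ?M * decay y r x ^ ?M)"
          using mult_left_mono[OF one, of "(CP * E k x y) * L"] CP L by simp
        also have "\<dots> = (CP * L * (4 * A0 * r / ?t) ^ ?M) * (E k x y * decay y r x ^ ?M)" by (simp only: mult_ac)
        also have "\<dots> \<le> (CP * L * (4 * A0 * r / ?t) ^ ?M) * (CN * sz y r 1 x)"
          unfolding r_def using CP L A0_ge1 by (intro mult_left_mono CN(2)) auto
        finally show ?thesis by (simp only: mult.assoc)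
      qed (use supp CP L CN A0_ge1 r in simp)
      have "cmod (avg k \<phi> y) \<le> (CP * L * (4 * A0 * r / ?t) ^ ?M * CN) * ?S"
        unfolding avg_def using dominated_by_size(2)[OF _ le] CP L CN r A0_ge1 by simp
      also have "\<dots> = A2 * (r ^ ?M / ?t ^ ?M)"
        by (simp only: A2_def power_mult_distrib power_divide times_divide_eq_right times_divide_eq_left mult_ac)
      also have "\<dots> \<le> A2 * (r powr \<eta> / ?t ^ ?M)"
      proof (intro mult_left_mono divide_right_mono)
        have "r ^ ?M = r powr real ?M" using r by (simp add: powr_realpow[symmetric] del: power_Suc)
        also have "\<dots> \<le> r powr \<eta>" using r r1 \<eta> by (intro powr_mono') auto
        finally show "r ^ ?M \<le> r powr \<eta>" .
      qed (use A12 in auto)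
      also have "\<dots> \<le> (A1 + A2) * (r powr \<eta> / ?t ^ ?M)" using A12 t by (intro mult_right_mono divide_nonneg_pos) auto
      finally show ?thesis using y0 by (simp add: r_def)
    qed
  qed
  then show ?thesis using A12 by (intro exI[of _ "A1 + A2"]) auto
qed

text \<open>For d(y,z) \<le> \<delta>^k the difference of two kernels has integral zero, so
  \<phi>(y) may be subtracted, and the loss \<delta>^(-k\<eta>) from the kernels cancels against the
  gain from \<phi>. For larger distances the size bound is already at most a multiple of
  d(y,z)^\<eta>. Hence the constant is independent of \<open>k\<close>.\<close>

lemma avg_hoelder:
  "\<exists>L'>0. \<forall>k y z. 0 \<le> k \<longrightarrow> cmod ((avg k \<phi> y - \<phi> y) - (avg k \<phi> z - \<phi> z)) \<le> L' * d y z powr \<eta>"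
proof -
  let ?S = "size_const 1"
  have S: "0 < ?S" by (intro size_const_pos) simp
  obtain C1 where C1: "C1 > 0" "\<And>k x y. E k x y * decay y (\<delta> powi k) x ^ 1 \<le> C1 * sz y (\<delta> powi k) 1 x"
    using E_size[of 1] by metis
  obtain A where A: "A > 0" "\<And>k y. 0 \<le> k \<Longrightarrow> cmod (avg k \<phi> y - \<phi> y) \<le> A * (\<delta> powi k) powr \<eta> / decay x0 1 y ^ Suc 0"
    using avg_size[of 0] by metis
  define L1 where "L1 = CP * L * C1 * ?S"
  have L1: "0 < L1" using CP L C1 S by (simp add: L1_def)
  have "cmod ((avg k \<phi> y - \<phi> y) - (avg k \<phi> z - \<phi> z)) \<le> (L1 + L + 2 * A) * d y z powr \<eta>" if k: "0 \<le> k" for k y z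
  proof -
    define r where "r = \<delta> powi k"
    have r: "0 < r" by (simp add: r_def)
    show ?thesis
    proof (cases "d y z \<le> r")
      case True
      have le: "cmod ((P k x y - P k x z) * (\<phi> x - \<phi> y)) \<le> (CP * L * d y z powr \<eta> * C1) * sz y r 1 x" for x
      proof -
        have "cmod ((P k x y - P k x z) * (\<phi> x - \<phi> y)) \<le> (CP * (d y z / r) powr \<eta> * E k x y) * (L * d x y powr \<eta>)"
          unfolding norm_mult r_def using CP True by (intro mult_mono P_reg2 hoelder) (auto simp: r_def)
        also have "\<dots> \<le> (CP * (d y z / r) powr \<eta> * E k x y) * (L * (r powr \<eta> * decay y r x))"
          using CP L r \<eta> by (intro mult_left_mono powr_le_decay) auto
        also have "\<dots> = (CP * L * d y z powr \<eta>) * (E k x y * decay y r x ^ 1)"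
          using r by (simp add: powr_divide)
        also have "\<dots> \<le> (CP * L * d y z powr \<eta>) * (C1 * sz y r 1 x)"
          unfolding r_def using CP L by (intro mult_left_mono C1(2)) auto
        finally show ?thesis by (simp add: mult.assoc)
      qed
      have i: "integrable \<mu> (\<lambda>x. (P k x y - P k x z) * (\<phi> x - \<phi> y))"
        and b: "cmod (\<integral>x. (P k x y - P k x z) * (\<phi> x - \<phi> y) \<partial>\<mu>) \<le> (CP * L * d y z powr \<eta> * C1) * ?S"
        using dominated_by_size[OF _ le] CP L C1 r by simp_all
      have iP: "integrable \<mu> (\<lambda>x. P k x u * \<phi> x)" for u
      proof (rule Bochner_Integration.integrable_bound[of _ "\<lambda>x. L * cmod (P k x u)"])
        show "AE x in \<mu>. cmod (P k x u * \<phi> x) \<le> norm (L * cmod (P k x u))"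
          using \<phi>L L by (intro AE_I2) (simp add: norm_mult mult.commute[of L] mult_left_mono)
      qed (use P_integrable in auto)
      have "avg k \<phi> y - avg k \<phi> z = (\<integral>x. P k x y * \<phi> x - P k x z * \<phi> x \<partial>\<mu>)"
        unfolding avg_def by (rule Bochner_Integration.integral_diff[symmetric, OF iP iP])
      also have "\<dots> = (\<integral>x. (P k x y - P k x z) * (\<phi> x - \<phi> y) + (P k x y - P k x z) * \<phi> y \<partial>\<mu>)"
        by (simp add: algebra_simps)
      also have "\<dots> = (\<integral>x. (P k x y - P k x z) * (\<phi> x - \<phi> y) \<partial>\<mu>)"
        using i P_integrable by (simp add: P_integral)
      finally have "cmod (avg k \<phi> y - avg k \<phi> z) \<le> L1 * d y z powr \<eta>" using b by (simp add: L1_def mult_ac)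
      moreover have "cmod ((avg k \<phi> y - \<phi> y) - (avg k \<phi> z - \<phi> z)) \<le> cmod (avg k \<phi> y - avg k \<phi> z) + cmod (\<phi> y - \<phi> z)"
        using norm_triangle_ineq4[of "avg k \<phi> y - avg k \<phi> z" "\<phi> y - \<phi> z"] by (simp add: algebra_simps)
      ultimately have "cmod ((avg k \<phi> y - \<phi> y) - (avg k \<phi> z - \<phi> z)) \<le> (L1 + L) * d y z powr \<eta>"
        using hoelder[of y z] by (simp add: distrib_right)
      also have "\<dots> \<le> (L1 + L + 2 * A) * d y z powr \<eta>" using A by (intro mult_right_mono) auto
      finally show ?thesis .
    next
      case False
      have b: "cmod (avg k \<phi> u - \<phi> u) \<le> A * d y z powr \<eta>" for u
      proof -
        have "cmod (avg k \<phi> u - \<phi> u) \<le> A * r powr \<eta> / decay x0 1 u ^ Suc 0" unfolding r_def by (rule A(2)[OF k])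
        also have "\<dots> \<le> A * r powr \<eta> / 1" using A by (intro divide_left_mono) auto
        also have "\<dots> \<le> A * d y z powr \<eta>" using False r \<eta> A by (simp add: powr_mono2)
        finally show ?thesis .
      qed
      have "cmod ((avg k \<phi> y - \<phi> y) - (avg k \<phi> z - \<phi> z)) \<le> 2 * A * d y z powr \<eta>"
        using b[of y] b[of z] norm_triangle_ineq4[of "avg k \<phi> y - \<phi> y" "avg k \<phi> z - \<phi> z"] by linarith
      also have "\<dots> \<le> (L1 + L + 2 * A) * d y z powr \<eta>" using L1 L by (intro mult_right_mono) auto
      finally show ?thesis .
    qed
  qed
  then show ?thesis using L1 L A by (intro exI[of _ "L1 + L + 2 * A"]) auto
qed

lemma avg_converges:
  assumes "0 < \<tau>"
  shows "\<exists>n0. \<forall>n\<ge>n0. tb x0 1 \<beta> \<gamma> (\<lambda>y. avg (int n) \<phi> y - \<phi> y) \<tau>"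
proof -
  let ?N = "interp_exp \<beta> \<eta>"
  obtain L' where L': "L' > 0" "\<And>k y z. 0 \<le> k \<Longrightarrow> cmod ((avg k \<phi> y - \<phi> y) - (avg k \<phi> z - \<phi> z)) \<le> L' * d y z powr \<eta>"
    using avg_hoelder by metis
  obtain \<epsilon> where \<epsilon>: "\<epsilon> > 0" "\<And>g. (\<And>y. cmod (g y) \<le> \<epsilon> / decay x0 1 y ^ ?N) \<Longrightarrow>
      (\<And>y z. cmod (g y - g z) \<le> L' * d y z powr \<eta>) \<Longrightarrow> tb x0 1 \<beta> \<gamma> g \<tau>"
    using interpolation_G0[of L' \<tau>] L'(1) assms by (metis less_imp_le)
  obtain A where A: "A > 0" "\<And>k y. 0 \<le> k \<Longrightarrow> cmod (avg k \<phi> y - \<phi> y) \<le> A * (\<delta> powi k) powr \<eta> / decay x0 1 y ^ Suc ?N"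
    using avg_size[of ?N] by metis
  have "(\<lambda>n. A * (\<delta> powr \<eta>) ^ n) \<longlonglongrightarrow> A * 0"
  proof (intro tendsto_mult tendsto_const LIMSEQ_realpow_zero)
    show "\<delta> powr \<eta> < 1" using \<delta> \<eta> powr_less_mono2[of \<eta> \<delta> 1] by simp
  qed simp
  then have "\<forall>\<^sub>F n in sequentially. A * (\<delta> powr \<eta>) ^ n < \<epsilon>" using \<epsilon> by (intro order_tendstoD(2)) auto
  then obtain n0 where n0: "\<And>n. n \<ge> n0 \<Longrightarrow> A * (\<delta> powr \<eta>) ^ n < \<epsilon>" by (auto simp: eventually_sequentially)
  have "tb x0 1 \<beta> \<gamma> (\<lambda>y. avg (int n) \<phi> y - \<phi> y) \<tau>" if "n \<ge> n0" for n
  proof (rule \<epsilon>(2))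
    fix y
    have e: "(\<delta> powi int n) powr \<eta> = (\<delta> powr \<eta>) ^ n"
      using \<delta> by (simp add: powr_realpow[symmetric] powr_powr mult.commute)
    have "cmod (avg (int n) \<phi> y - \<phi> y) \<le> A * (\<delta> powr \<eta>) ^ n / decay x0 1 y ^ Suc ?N"
      using A(2)[of "int n" y] unfolding e by simp
    also have "\<dots> \<le> \<epsilon> / decay x0 1 y ^ ?N"
      using n0[OF that] \<epsilon> by (intro frac_le power_increasing) auto
    finally show "cmod (avg (int n) \<phi> y - \<phi> y) \<le> \<epsilon> / decay x0 1 y ^ ?N" .
  qed (use L' in auto)
  then show ?thesis by blast
qed

end

end

section \<open>Truncation of test functions\<close>

lemma eLp_norm_finite_AE:
  assumes h [measurable]: "h \<in> borel_measurable M" and fin: "eLp_norm M p h < \<infinity>"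
  shows "AE x in M. h x < \<infinity>"
proof (cases "p = \<infinity>")
  case True
  then have "esssup M h < \<infinity>" using fin by (simp add: eLp_norm_def)
  then show ?thesis using esssup_AE[of h M] by (auto elim!: eventually_mono intro: le_less_trans)
next
  case False
  have "(\<integral>\<^sup>+x. epowr (h x) (enn2real p) \<partial>M) \<noteq> \<infinity>"
  proof
    assume "(\<integral>\<^sup>+x. epowr (h x) (enn2real p) \<partial>M) = \<infinity>"
    then have "eLp_norm M p h = \<infinity>" using False by (simp add: eLp_norm_def)
    then show False using fin by simp
  qed
  then have "AE x in M. epowr (h x) (enn2real p) \<noteq> \<infinity>" by (intro nn_integral_PInf_AE) auto
  then show ?thesis by eventually_elim (auto simp: epowr_def less_top split: if_splits)
qed

text \<open>Each measurable majorant of \<open>g'\<close> yields one of \<open>g\<close> after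
  multiplication by \<open>C\<close>. Dividing by \<open>C\<close> first lets the constant pass
  through the infimum.\<close>

lemma upper_Lp_norm_le_cmult:
  assumes C: "0 < C" "1 < p" and le: "\<And>x. g x \<le> ennreal C * g' x"
  shows "upper_Lp_norm M p g \<le> ennreal C * upper_Lp_norm M p g'"
proof -
  have C0: "ennreal C \<noteq> 0" "ennreal C < top" using C by auto
  have "upper_Lp_norm M p g / ennreal C \<le> eLp_norm M p h" if h: "h \<in> borel_measurable M" "\<And>x. g' x \<le> h x" for h
  proof -
    have "g x \<le> ennreal C * h x" for x using le[of x] mult_left_mono[OF h(2)[of x], of "ennreal C"] by simp
    then have "upper_Lp_norm M p g \<le> eLp_norm M p (\<lambda>x. ennreal C * h x)"
      unfolding upper_Lp_norm_def using h by (intro INF_lower) auto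
    also have "\<dots> \<le> ennreal C * eLp_norm M p h" using C h by (intro eLp_norm_cmult)
    finally show ?thesis using C by (intro divide_le_posI_ennreal) (auto simp: mult.commute)
  qed
  then have "upper_Lp_norm M p g / ennreal C \<le> upper_Lp_norm M p g'"
    unfolding upper_Lp_norm_def[of M p g'] by (intro INF_greatest) auto
  then have "ennreal C * (upper_Lp_norm M p g / ennreal C) \<le> ennreal C * upper_Lp_norm M p g'"
    by (rule mult_left_mono) simp
  moreover have "ennreal C * (upper_Lp_norm M p g / ennreal C) = upper_Lp_norm M p g"
    unfolding ennreal_times_divide mult.commute[of "ennreal C" "upper_Lp_norm M p g"]
    using C0 by (intro mult_divide_eq_ennreal) auto
  ultimately show ?thesis by simp
qed

context hts_cut
begin

section \<open>Linear calculus for distributions, and truncation\<close>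

lemma \<D>_add: "\<Lambda> \<in> \<D> \<Longrightarrow> \<phi> \<in> G0 \<Longrightarrow> \<psi> \<in> G0 \<Longrightarrow> \<Lambda> (\<lambda>x. \<phi> x + \<psi> x) = \<Lambda> \<phi> + \<Lambda> \<psi>"
  and \<D>_cmult: "\<Lambda> \<in> \<D> \<Longrightarrow> \<phi> \<in> G0 \<Longrightarrow> \<Lambda> (\<lambda>x. c * \<phi> x) = c * \<Lambda> \<phi>"
  by (auto simp: distributions_def)

lemma test0_diff: "\<phi> \<in> G0 \<Longrightarrow> \<psi> \<in> G0 \<Longrightarrow> (\<lambda>x. \<phi> x - \<psi> x) \<in> G0"
  using test0_add[of \<phi> "\<lambda>x. - 1 * \<psi> x"] test0_cmult[of \<psi> "- 1"] by simp

lemma \<D>_diff: "\<Lambda> \<in> \<D> \<Longrightarrow> \<phi> \<in> G0 \<Longrightarrow> \<psi> \<in> G0 \<Longrightarrow> \<Lambda> (\<lambda>x. \<phi> x - \<psi> x) = \<Lambda> \<phi> - \<Lambda> \<psi>"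
  using \<D>_add[of \<Lambda> \<phi> "\<lambda>x. - 1 * \<psi> x"] \<D>_cmult[of \<Lambda> \<psi> "- 1"] test0_cmult[of \<psi> "- 1"] by simp

lemma \<D>_sum:
  assumes \<Lambda>: "\<Lambda> \<in> \<D>" and "finite I" "\<And>i. i \<in> I \<Longrightarrow> f i \<in> G0"
  shows "(\<lambda>y. \<Sum>i\<in>I. f i y) \<in> G0 \<and> \<Lambda> (\<lambda>y. \<Sum>i\<in>I. f i y) = (\<Sum>i\<in>I. \<Lambda> (f i))"
  using assms(2,3)
proof (induction I rule: finite_induct)
  case empty
  have z: "(\<lambda>_. 0) \<in> G0" by (intro G\<eta>_test0 test_spaceI[of _ _ _ _ _ 1] test_bound_zero) auto
  then show ?case using \<D>_cmult[OF \<Lambda> z, of 0] by simp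
next
  case (insert i I)
  then have "(\<lambda>y. \<Sum>i\<in>I. f i y) \<in> G0" "\<Lambda> (\<lambda>y. \<Sum>i\<in>I. f i y) = (\<Sum>i\<in>I. \<Lambda> (f i))" "f i \<in> G0" by auto
  then show ?case using insert.hyps test0_add[of "f i" "\<lambda>y. \<Sum>i\<in>I. f i y"] \<D>_add[OF \<Lambda>, of "f i" "\<lambda>y. \<Sum>i\<in>I. f i y"] by simp
qed

lemma \<D>_bound:
  assumes "\<Lambda> \<in> \<D>"
  obtains C where "0 < C" "\<And>\<phi> \<tau>. \<phi> \<in> G0 \<Longrightarrow> 0 < \<tau> \<Longrightarrow> tb x0 1 \<beta> \<gamma> \<phi> \<tau> \<Longrightarrow> cmod (\<Lambda> \<phi>) \<le> C * \<tau>"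
proof -
  obtain C where C: "\<And>\<phi>. \<phi> \<in> G0 \<Longrightarrow> cmod (\<Lambda> \<phi>) \<le> C * tn x0 1 \<beta> \<gamma> \<phi>"
    using assms unfolding distributions_def mem_Collect_eq by metis
  show ?thesis
  \<comment> \<open>\<open>distributions\<close> admits any real constant; a positive one is needed
    to pass from the norm to a larger bound.\<close>
  proof (rule that[of "max C 1"])
    fix \<phi> and \<tau> :: real assume *: "\<phi> \<in> G0" "0 < \<tau>" "tb x0 1 \<beta> \<gamma> \<phi> \<tau>"
    have n: "0 \<le> tn x0 1 \<beta> \<gamma> \<phi>" using * test0_sub by (intro test_norm_nonneg) auto
    have "cmod (\<Lambda> \<phi>) \<le> C * tn x0 1 \<beta> \<gamma> \<phi>" by (rule C[OF *(1)])
    also have "\<dots> \<le> max C 1 * tn x0 1 \<beta> \<gamma> \<phi>" using n by (intro mult_right_mono) auto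
    also have "\<dots> \<le> max C 1 * \<tau>" using * by (intro mult_left_mono test_norm_le) auto
    finally show "cmod (\<Lambda> \<phi>) \<le> max C 1 * \<tau>" .
  qed simp
qed

lemma decay_comparable':
  assumes "0 < r" "d y z \<le> inverse (2 * A0) * (r + d x y)"
  shows "decay x r z \<le> 3 * A0 * decay x r y"
proof -
  have "d x z \<le> A0 * (d x y + d y z)" by (rule d_tri)
  also have "\<dots> \<le> A0 * (d x y + inverse (2 * A0) * (r + d x y))"
    using assms A0_ge1 by (intro mult_left_mono add_left_mono) auto
  also have "\<dots> = A0 * d x y + (r + d x y) / 2" using A0_ge1 by (simp add: distrib_left[of A0] field_simps)
  also have "\<dots> \<le> A0 * (r + d x y) + A0 * (r + d x y)"
    using A0_ge1 assms mult_right_mono[of "1/2" A0 "r + d x y"] by (intro add_mono mult_left_mono) auto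
  finally have le: "d x z \<le> A0 * (r + d x y) + A0 * (r + d x y)" .
  have "r \<le> A0 * (r + d x y)" using mult_mono[of 1 A0 r "r + d x y"] A0_ge1 assms by simp
  with le have "r + d x z \<le> 3 * A0 * (r + d x y)" by linarith
  also have "\<dots> = r * (3 * A0 * decay x r y)" using assms(1) by (simp add: decay_eq)
  finally have "r * decay x r z \<le> r * (3 * A0 * decay x r y)"
    using assms(1) by (simp only: decay_eq)
  then show ?thesis using assms(1) by simp
qed

text \<open>Multiply by a cutoff function at radius \<rho>. The remainder matters only where the
  decay weight is at least \<rho>/(3 A0), and there the size factor of order \<eta> is that of order
  \<gamma> times the small number decay^(-(\<eta>-\<gamma>)). Regularity survives because 1 +
  d(x0,y) is at most a multiple of \<rho> wherever the cutoff changes.\<close>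

lemma truncation:
  assumes \<phi>: "\<phi> \<in> G\<eta>" and "0 < \<tau>"
  shows "\<exists>\<phi>' L R. 0 < L \<and> 1 \<le> R \<and> (\<forall>y. cmod (\<phi>' y) \<le> L) \<and> (\<forall>y. y \<notin> B x0 R \<longrightarrow> \<phi>' y = 0) \<and>
    (\<forall>y z. cmod (\<phi>' y - \<phi>' z) \<le> L * d y z powr \<eta>) \<and> tb x0 1 \<beta> \<gamma> (\<lambda>y. \<phi> y - \<phi>' y) \<tau>"
proof -
  obtain K where K: "0 < K" and \<phi>K: "tb x0 1 \<eta> \<eta> \<phi> K" using \<phi> unfolding test_space_def by auto
  obtain C where C: "0 < C" "\<And>x r. 0 < r \<Longrightarrow> \<exists>\<psi> :: 'a \<Rightarrow> real. (\<forall>y. 0 \<le> \<psi> y) \<and> (\<forall>y. \<psi> y \<le> 1) \<and>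
    (\<forall>y\<in>B x r. \<psi> y = 1) \<and> (\<forall>y. y \<notin> B x (2 * A0 * r) \<longrightarrow> \<psi> y = 0) \<and>
    (\<forall>y z. \<bar>\<psi> y - \<psi> z\<bar> \<le> C * (d y z / r) powr \<eta>)"
    by (rule cutoff_uniform) metis
  let ?s = "\<eta> - \<gamma>"
  have s: "0 < ?s" using \<gamma> by simp
  let ?t = "decay x0 1"
  \<comment> \<open>The product rule adds the variation of the cutoff to that of \<phi>; 6 A0^2
    bounds (1 + d(x0,y))/\<rho> when either point lies in the ball supporting the cutoff.\<close>
  define K1 where "K1 = K * (1 + C * (6 * A0\<^sup>2) powr \<eta>)"
  have K1: "0 < K1" "K \<le> K1" using K C by (auto simp: K1_def intro!: mult_pos_pos add_pos_nonneg)
  define M where "M = K1 * (3 * A0) powr ?s"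
  have M: "0 < M" using K1 A0_ge1 by (simp add: M_def)
  \<comment> \<open>Solves M \<rho>^(-(\<eta>-\<gamma>)) \<le> \<tau>; the factor 3 A0 inside
    \<open>M\<close> comes from \<open>decay_comparable'\<close>.\<close>
  define \<rho> where "\<rho> = max 1 ((M / \<tau>) powr (1 / ?s))"
  have \<rho>: "1 \<le> \<rho>" by (simp add: \<rho>_def)
  have M\<rho>: "K1 * (3 * A0 / \<rho>) powr ?s \<le> \<tau>"
  proof -
    have "((M / \<tau>) powr (1 / ?s)) powr ?s \<le> \<rho> powr ?s" using s by (intro powr_mono2) (auto simp: \<rho>_def)
    then have "M / \<tau> \<le> \<rho> powr ?s" using M assms s by (simp add: powr_powr)
    then have "M / \<rho> powr ?s \<le> \<tau>" using assms \<rho> by (simp add: field_simps)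
    then show ?thesis using \<rho> A0_ge1 by (simp add: M_def powr_divide)
  qed
  obtain \<psi> :: "'a \<Rightarrow> real" where \<psi>: "\<And>y. 0 \<le> \<psi> y" "\<And>y. \<psi> y \<le> 1"
    "\<And>y. y \<in> B x0 \<rho> \<Longrightarrow> \<psi> y = 1" "\<And>y. y \<notin> B x0 (2 * A0 * \<rho>) \<Longrightarrow> \<psi> y = 0"
    "\<And>y z. \<bar>\<psi> y - \<psi> z\<bar> \<le> C * (d y z / \<rho>) powr \<eta>"
    using C(2)[of \<rho> x0] \<rho> by (metis less_le_trans zero_less_one)
  define \<phi>' where "\<phi>' = (\<lambda>y. \<phi> y * complex_of_real (\<psi> y))"
  have size: "cmod (\<phi> y) \<le> K * sz x0 1 \<eta> y" for y using \<phi>K unfolding test_bound_def by blast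
  have reg: "cmod (\<phi> y - \<phi> z) \<le> K * (d y z / (1 + d x0 y)) powr \<eta> * sz x0 1 \<eta> y"
    if "d y z \<le> inverse (2 * A0) * (1 + d x0 y)" for y z using \<phi>K that unfolding test_bound_def by blast
  have V: "0 < V 1 x0" by (intro V_pos) simp
  have sz1: "sz x0 1 \<eta> y \<le> 1 / V 1 x0" for y
  proof -
    have "sz x0 1 \<eta> y \<le> 1 / V 1 x0 * 1"
      unfolding test_size_def using V \<eta>
      by (intro mult_mono divide_left_mono powr_size_le1) (auto simp: V2_eq intro!: add_pos_nonneg mult_pos_pos)
    then show ?thesis by simp
  qed
  have sup: "cmod (\<phi> y) \<le> K / V 1 x0" for y
    using size[of y] mult_left_mono[OF sz1[of y], of K] K by simp
  have szs: "sz x0 1 \<eta> y = sz x0 1 \<gamma> y / ?t y powr ?s" for y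
  proof -
    have "(1 / ?t y) powr \<eta> = (1 / ?t y) powr \<gamma> * (1 / ?t y) powr ?s" by (simp add: powr_add[symmetric])
    also have "(1 / ?t y) powr ?s = 1 / ?t y powr ?s" by (simp add: powr_divide)
    finally show ?thesis by (simp add: test_size_def decay_def)
  qed
  have far: "K1 * sz x0 1 \<eta> y \<le> \<tau> * sz x0 1 \<gamma> y" if "\<rho> \<le> 3 * A0 * ?t y" for y
  proof -
    have "\<rho> / (3 * A0) \<le> ?t y" using that A0_ge1 by (simp add: field_simps)
    then have "(\<rho> / (3 * A0)) powr ?s \<le> ?t y powr ?s" using s \<rho> A0_ge1 by (intro powr_mono2) auto
    then have "1 / ?t y powr ?s \<le> 1 / (\<rho> / (3 * A0)) powr ?s" using \<rho> A0_ge1 by (intro divide_left_mono mult_pos_pos) auto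
    also have "\<dots> = (3 * A0 / \<rho>) powr ?s" using \<rho> A0_ge1 by (simp add: powr_divide)
    finally have "K1 * (1 / ?t y powr ?s) \<le> K1 * (3 * A0 / \<rho>) powr ?s" using K1 by (intro mult_left_mono) auto
    then have "K1 * (1 / ?t y powr ?s) \<le> \<tau>" using M\<rho> by linarith
    then have "K1 * (1 / ?t y powr ?s) * sz x0 1 \<gamma> y \<le> \<tau> * sz x0 1 \<gamma> y" by (intro mult_right_mono) auto
    then show ?thesis by (simp add: szs)
  qed
  have diff: "\<phi> y - \<phi>' y = \<phi> y * complex_of_real (1 - \<psi> y)" for y by (simp add: \<phi>'_def algebra_simps)
  have small: "tb x0 1 \<beta> \<gamma> (\<lambda>y. \<phi> y - \<phi>' y) \<tau>"
    unfolding test_bound_def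
  proof (intro conjI allI impI)
    fix y
    show "cmod (\<phi> y - \<phi>' y) \<le> \<tau> * sz x0 1 \<gamma> y"
    proof (cases "y \<in> B x0 \<rho>")
      case True
      then show ?thesis using \<psi>(3) assms by (simp add: diff)
    next
      case False
      then have "\<rho> \<le> 1 * ?t y" by (simp add: qball_def decay_def)
      also have "\<dots> \<le> 3 * A0 * ?t y" using A0_ge1 by (intro mult_right_mono) auto
      finally have f: "\<rho> \<le> 3 * A0 * ?t y" .
      have "cmod (\<phi> y - \<phi>' y) \<le> cmod (\<phi> y) * 1"
        unfolding diff norm_mult norm_of_real using \<psi>(1,2)[of y] by (intro mult_left_mono) auto
      also have "\<dots> \<le> K * sz x0 1 \<eta> y" using size[of y] by simp
      also have "\<dots> \<le> K1 * sz x0 1 \<eta> y" using K1 by (intro mult_right_mono) auto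
      finally show ?thesis using far[OF f] by linarith
    qed
    fix z assume yz: "d y z \<le> inverse (2 * A0) * (1 + d x0 y)"
    show "cmod ((\<phi> y - \<phi>' y) - (\<phi> z - \<phi>' z)) \<le> \<tau> * (d y z / (1 + d x0 y)) powr \<beta> * sz x0 1 \<gamma> y"
    proof (cases "y \<in> B x0 \<rho> \<and> z \<in> B x0 \<rho>")
      case True
      then show ?thesis using \<psi>(3) assms by (simp add: diff)
    next
      case False
      have tz: "?t z \<le> 3 * A0 * ?t y" using yz by (intro decay_comparable') auto
      have f: "\<rho> \<le> 3 * A0 * ?t y"
      proof (cases "y \<in> B x0 \<rho>")
        case True
        then have "z \<notin> B x0 \<rho>" using False by simp
        then have "\<rho> \<le> ?t z" by (simp add: qball_def decay_def)
        then show ?thesis using tz by linarith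
      next
        case False
        then have "\<rho> \<le> 1 * ?t y" by (simp add: qball_def decay_def)
        also have "\<dots> \<le> 3 * A0 * ?t y" using A0_ge1 by (intro mult_right_mono) auto
        finally show ?thesis .
      qed
      let ?q = "d y z / (1 + d x0 y)"
      have pos: "0 < 1 + d x0 y" by (intro add_pos_nonneg) auto
      have q0: "0 \<le> ?q" using pos by simp
      have q1: "?q \<le> 1"
      proof -
        have "inverse (2 * A0) \<le> 1" using A0_ge1 by (intro inverse_le_1_iff[THEN iffD2]) simp
        then have "inverse (2 * A0) * (1 + d x0 y) \<le> 1 * (1 + d x0 y)" using pos by (intro mult_right_mono) auto
        then show ?thesis using yz pos by simp
      qed
      have \<psi>d: "\<bar>\<psi> y - \<psi> z\<bar> \<le> C * (6 * A0\<^sup>2) powr \<eta> * ?q powr \<eta>"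
      proof (cases "y \<in> B x0 (2 * A0 * \<rho>) \<or> z \<in> B x0 (2 * A0 * \<rho>)")
        case True
        have one: "1 \<le> 2 * A0 * \<rho>" using mult_mono[of 1 "2 * A0" 1 \<rho>] A0_ge1 \<rho> by simp
        have tt: "1 * (1 + 2 * A0 * \<rho>) \<le> 2 * A0 * (1 + 2 * A0 * \<rho>)" using A0_ge1 one by (intro mult_right_mono) auto
        have "?t y \<le> 2 * A0 * (1 + 2 * A0 * \<rho>)"
        proof (cases "y \<in> B x0 (2 * A0 * \<rho>)")
          case False
          then have "?t z \<le> 1 + 2 * A0 * \<rho>" using True by (auto simp: qball_def decay_def)
          then have "2 * A0 * ?t z \<le> 2 * A0 * (1 + 2 * A0 * \<rho>)" using A0_ge1 by (intro mult_left_mono) auto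
          moreover have "?t y \<le> 2 * A0 * ?t z" using yz by (intro decay_comparable) auto
          ultimately show ?thesis by linarith
        next
          case True
          then have "?t y \<le> 1 + 2 * A0 * \<rho>" by (simp add: qball_def decay_def)
          then show ?thesis using tt[unfolded mult_1_left] by (rule order_trans)
        qed
        also have "\<dots> \<le> 2 * A0 * (A0 * \<rho> + 2 * A0 * \<rho>)"
          using A0_ge1 \<rho> mult_mono[of 1 A0 1 \<rho>] by (intro mult_left_mono add_right_mono) auto
        also have "\<dots> = 6 * A0\<^sup>2 * \<rho>" by (simp add: power2_eq_square)
        finally have "?t y \<le> 6 * A0\<^sup>2 * \<rho>" .
        then have "d y z * ?t y \<le> d y z * (6 * A0\<^sup>2 * \<rho>)" by (intro mult_left_mono) auto
        then have "d y z / \<rho> \<le> 6 * A0\<^sup>2 * d y z / ?t y" using \<rho> by (intro frac_le_cross) (auto simp: mult_ac)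
        then have "d y z / \<rho> \<le> 6 * A0\<^sup>2 * ?q" by (simp add: decay_def)
        then have "(d y z / \<rho>) powr \<eta> \<le> (6 * A0\<^sup>2 * ?q) powr \<eta>" using \<eta> \<rho> by (intro powr_mono2) auto
        also have "\<dots> = (6 * A0\<^sup>2) powr \<eta> * ?q powr \<eta>" by (rule powr_mult)
        finally have "C * (d y z / \<rho>) powr \<eta> \<le> C * ((6 * A0\<^sup>2) powr \<eta> * ?q powr \<eta>)" using C by (intro mult_left_mono) auto
        then show ?thesis using \<psi>(5)[of y z] by (simp add: mult.assoc)
      qed (use \<psi>(4) C in auto)
      have "(\<phi> y - \<phi>' y) - (\<phi> z - \<phi>' z) = (\<phi> y - \<phi> z) * complex_of_real (1 - \<psi> z) + \<phi> y * complex_of_real (\<psi> z - \<psi> y)"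
        by (simp add: \<phi>'_def algebra_simps)
      also have "cmod \<dots> \<le> cmod (\<phi> y - \<phi> z) * \<bar>1 - \<psi> z\<bar> + cmod (\<phi> y) * \<bar>\<psi> z - \<psi> y\<bar>"
        by (rule order_trans[OF norm_triangle_ineq]) (simp only: norm_mult norm_of_real order_refl)
      also have "\<dots> \<le> K * ?q powr \<eta> * sz x0 1 \<eta> y * 1 + K * sz x0 1 \<eta> y * (C * (6 * A0\<^sup>2) powr \<eta> * ?q powr \<eta>)"
        using \<psi>d \<psi>(1,2)[of z] K by (intro add_mono mult_mono reg[OF yz] size) auto
      also have "\<dots> = ?q powr \<eta> * (K1 * sz x0 1 \<eta> y)" by (simp add: K1_def algebra_simps)
      also have "\<dots> \<le> ?q powr \<beta> * (\<tau> * sz x0 1 \<gamma> y)"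
      proof (rule mult_mono[OF _ far[OF f]])
        show "?q powr \<eta> \<le> ?q powr \<beta>" using q0 q1 \<beta> by (intro powr_mono') auto
      qed (use K1 in auto)
      finally show ?thesis by (simp add: mult_ac)
    qed
  qed
  define L0 where "L0 = K / V 1 x0 * (1 + 2 * (2 * A0) powr \<eta>)"
  have KV: "0 < K / V 1 x0" using K V by simp
  have hold\<phi>: "cmod (\<phi> y - \<phi> z) \<le> L0 * d y z powr \<eta>" for y z
  proof (cases "d y z \<le> inverse (2 * A0) * (1 + d x0 y)")
    case True
    have "d y z / (1 + d x0 y) \<le> d y z / 1" by (intro divide_left_mono) (auto intro: add_pos_nonneg)
    then have p: "(d y z / (1 + d x0 y)) powr \<eta> \<le> d y z powr \<eta>" using \<eta> by (intro powr_mono2) auto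
    have "cmod (\<phi> y - \<phi> z) \<le> K * (d y z / (1 + d x0 y)) powr \<eta> * sz x0 1 \<eta> y" by (rule reg[OF True])
    also have "\<dots> \<le> K * d y z powr \<eta> * (1 / V 1 x0)" using p K by (intro mult_mono sz1) auto
    also have "\<dots> = K / V 1 x0 * 1 * d y z powr \<eta>" by simp
    also have "\<dots> \<le> L0 * d y z powr \<eta>" unfolding L0_def using KV by (intro mult_right_mono mult_left_mono) auto
    finally show ?thesis .
  next
    case False
    \<comment> \<open>Outside the range of the regularity condition d(y,z) is at least 1/(2 A0), so
      the supremum bound already implies a Hoelder bound.\<close>
    have "inverse (2 * A0) * 1 \<le> inverse (2 * A0) * (1 + d x0 y)" using A0_ge1 by (intro mult_left_mono) auto
    then have "inverse (2 * A0) \<le> d y z" using False by linarith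
    then have "1 \<le> 2 * A0 * d y z" using A0_ge1 by (simp add: field_simps)
    then have "1 \<le> (2 * A0 * d y z) powr \<eta>" using \<eta> by (intro ge_one_powr_ge_zero) auto
    then have one: "1 \<le> (2 * A0) powr \<eta> * d y z powr \<eta>" using A0_ge1 by (simp add: powr_mult)
    have "cmod (\<phi> y - \<phi> z) \<le> 2 * (K / V 1 x0)"
      using sup[of y] sup[of z] norm_triangle_ineq4[of "\<phi> y" "\<phi> z"] by linarith
    also have "\<dots> \<le> 2 * (K / V 1 x0) * ((2 * A0) powr \<eta> * d y z powr \<eta>)"
      using mult_left_mono[OF one, of "2 * (K / V 1 x0)"] KV by simp
    also have "\<dots> = K / V 1 x0 * (2 * (2 * A0) powr \<eta>) * d y z powr \<eta>" by simp
    also have "\<dots> \<le> L0 * d y z powr \<eta>" unfolding L0_def using KV by (intro mult_right_mono mult_left_mono) auto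
    finally show ?thesis .
  qed
  define L where "L = L0 + K / V 1 x0 * (1 + C / \<rho> powr \<eta>)"
  have L0: "0 < L0" unfolding L0_def using KV by (intro mult_pos_pos add_pos_nonneg) auto
  have K2: "0 \<le> K / V 1 x0 * (C / \<rho> powr \<eta>)"
    using less_imp_le[OF KV] C(1) by (intro mult_nonneg_nonneg[of "K / V 1 x0"]) auto
  have L: "0 < L" "K / V 1 x0 \<le> L" using L0 KV K2 by (auto simp: L_def distrib_left)
  show ?thesis
  proof (rule exI[of _ \<phi>'], rule exI[of _ L], rule exI[of _ "2 * A0 * \<rho>"], intro conjI allI impI small)
    show "1 \<le> 2 * A0 * \<rho>" using mult_mono[of 1 "2 * A0" 1 \<rho>] A0_ge1 \<rho> by simp
    fix y
    have "cmod (\<phi>' y) \<le> cmod (\<phi> y) * 1"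
      unfolding \<phi>'_def norm_mult norm_of_real using \<psi>(1,2)[of y] by (intro mult_left_mono) auto
    then show "cmod (\<phi>' y) \<le> L" using sup[of y] L by simp
    show "\<phi>' y = 0" if "y \<notin> B x0 (2 * A0 * \<rho>)" using \<psi>(4)[OF that] by (simp add: \<phi>'_def)
    fix z
    have "\<phi>' y - \<phi>' z = (\<phi> y - \<phi> z) * complex_of_real (\<psi> z) + \<phi> y * complex_of_real (\<psi> y - \<psi> z)"
      by (simp add: \<phi>'_def algebra_simps)
    also have "cmod \<dots> \<le> cmod (\<phi> y - \<phi> z) * \<bar>\<psi> z\<bar> + cmod (\<phi> y) * \<bar>\<psi> y - \<psi> z\<bar>"
      by (rule order_trans[OF norm_triangle_ineq]) (simp only: norm_mult norm_of_real order_refl)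
    also have "\<dots> \<le> L0 * d y z powr \<eta> * 1 + K / V 1 x0 * (C * (d y z / \<rho>) powr \<eta>)"
      using \<psi>(1,2)[of z] KV L0 by (intro add_mono mult_mono hold\<phi> sup \<psi>) auto
    also have "\<dots> = (L0 + K / V 1 x0 * (C / \<rho> powr \<eta>)) * d y z powr \<eta>"
      using \<rho> by (simp add: powr_divide algebra_simps)
    also have "\<dots> \<le> L * d y z powr \<eta>"
      using KV by (intro mult_right_mono) (auto simp: L_def distrib_left)
    finally show "cmod (\<phi>' y - \<phi>' z) \<le> L * d y z powr \<eta>" .
  qed (use L in simp)
qed

end

section \<open>Distributions applied to averages\<close>

context ati
begin

lemma P_in_G0: "P k x \<in> G0"
  by (intro G\<eta>_test0 P_in_G\<eta>)

lemma P_bound_G0: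
  assumes "0 \<le> R"
  obtains C where "0 < C" "\<And>x. d x0 x \<le> R \<Longrightarrow> tb x0 1 \<beta> \<gamma> (P k x) C" "\<And>x. d x0 x \<le> R \<Longrightarrow> tb x0 1 \<eta> \<eta> (P k x) C"
proof -
  obtain C where C: "0 < C" "\<And>x. d x0 x \<le> R \<Longrightarrow> tb x0 1 \<eta> \<eta> (P k x) C"
    using P_local_test_bound[OF assms, of k] by metis
  have "tb x0 1 \<beta> \<gamma> (P k x) C" if "d x0 x \<le> R" for x
    using \<eta> \<beta> \<gamma> C by (intro test_bound_exponents[OF C(2)[OF that]]) auto
  then show ?thesis using C that by metis
qed

text \<open>Norm continuity of x \<mapsto> P_k(x, .) is composed with a bounded functional. The
  radius A0 (d(x0,x) + 1) captures the point together with its neighbours, as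
  \<open>P_modulus\<close> is uniform on bounded sets.\<close>

lemma distribution_kernel_continuous:
  assumes \<Lambda>: "\<Lambda> \<in> \<D>"
  shows "continuous_on UNIV (\<lambda>x. \<Lambda> (P k x))"
proof (rule continuous_eps)
  fix x and e :: real assume e: "0 < e"
  obtain C where C: "0 < C" "\<And>\<phi> \<tau>. \<phi> \<in> G0 \<Longrightarrow> 0 < \<tau> \<Longrightarrow> tb x0 1 \<beta> \<gamma> \<phi> \<tau> \<Longrightarrow> cmod (\<Lambda> \<phi>) \<le> C * \<tau>"
    using \<D>_bound[OF \<Lambda>] by metis
  define R where "R = A0 * (d x0 x + 1)"
  define \<tau> where "\<tau> = e / (2 * C)"
  have \<tau>: "0 < \<tau>" using e C by (simp add: \<tau>_def)
  have R: "0 \<le> R" "d x0 x \<le> R"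
    using A0_ge1 mult_mono[of 1 A0 "d x0 x" "d x0 x + 1"] by (auto simp: R_def)
  obtain \<rho> where \<rho>: "\<rho> > 0" "\<And>x x'. d x0 x \<le> R \<Longrightarrow> d x0 x' \<le> R \<Longrightarrow> d x x' < \<rho> \<Longrightarrow> tb x0 1 \<beta> \<gamma> (\<lambda>y. P k x y - P k x' y) \<tau>"
    using P_modulus[OF R(1) \<tau>, of k] by metis
  have "dist (\<Lambda> (P k x)) (\<Lambda> (P k x')) < e" if "d x x' < min \<rho> 1" for x'
  proof -
    have "d x0 x' \<le> A0 * (d x0 x + d x x')" by (rule d_tri)
    also have "\<dots> \<le> R" unfolding R_def using that A0_ge1 by (intro mult_left_mono) auto
    finally have "tb x0 1 \<beta> \<gamma> (\<lambda>y. P k x y - P k x' y) \<tau>" using \<rho>(2)[OF R(2)] that by simp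
    then have "cmod (\<Lambda> (\<lambda>y. P k x y - P k x' y)) \<le> C * \<tau>" by (intro C(2) test0_diff P_in_G0 \<tau>)
    also have "\<dots> < e" using e C by (simp add: \<tau>_def)
    finally show ?thesis by (simp add: dist_norm \<D>_diff[OF \<Lambda> P_in_G0 P_in_G0])
  qed
  then show "\<exists>\<rho>>0. \<forall>x'. d x x' < \<rho> \<longrightarrow> dist (\<Lambda> (P k x)) (\<Lambda> (P k x')) < e"
    using \<rho>(1) by (intro exI[of _ "min \<rho> 1"]) auto
qed

text \<open>Both sides are compared with the same Riemann sum: the average in the test space, before
  \<Lambda> is applied, and the scalar integral after it is applied.\<close>

lemma distribution_avg:
  assumes \<Lambda>: "\<Lambda> \<in> \<D>" and L: "0 < L" and R: "1 \<le> R" and \<phi>L: "\<And>y. cmod (\<phi> y) \<le> L"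
    and supp: "\<And>y. y \<notin> B x0 R \<Longrightarrow> \<phi> y = 0" and hoelder: "\<And>y z. cmod (\<phi> y - \<phi> z) \<le> L * d y z powr \<eta>"
  shows "avg k \<phi> \<in> G\<eta>" "\<Lambda> (avg k \<phi>) = (\<integral>x. \<Lambda> (P k x) * \<phi> x \<partial>\<mu>)"
proof -
  let ?S = "B x0 R"
  let ?f = "\<lambda>x. \<Lambda> (P k x)"
  have \<phi>m [measurable]: "\<phi> \<in> borel_measurable \<mu>"
    by (rule \<phi>_measurable[OF L R \<phi>L supp hoelder])
  have fm [measurable]: "?f \<in> borel_measurable \<mu>"
    by (intro measurable_continuous distribution_kernel_continuous \<Lambda>)
  have S [measurable]: "?S \<in> sets \<mu>" and Sfin: "emeasure \<mu> ?S < \<infinity>" by (rule ball_sets, rule emeasure_ball_fin)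
  have sub_fin: "emeasure \<mu> T < \<infinity>" if "T \<in> sets \<mu>" "T \<subseteq> ?S" for T
    using emeasure_mono[OF that(2) S] Sfin by (rule le_less_trans)
  obtain C where C: "0 < C" "\<And>\<phi> \<tau>. \<phi> \<in> G0 \<Longrightarrow> 0 < \<tau> \<Longrightarrow> tb x0 1 \<beta> \<gamma> \<phi> \<tau> \<Longrightarrow> cmod (\<Lambda> \<phi>) \<le> C * \<tau>"
    using \<D>_bound[OF \<Lambda>] by metis
  have R0: "0 \<le> R" using R by simp
  obtain K where K: "0 < K" "\<And>x. d x0 x \<le> R \<Longrightarrow> tb x0 1 \<beta> \<gamma> (P k x) K" "\<And>x. d x0 x \<le> R \<Longrightarrow> tb x0 1 \<eta> \<eta> (P k x) K"
    using P_bound_G0[OF R0, of k] by metis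
  have inS: "d x0 x \<le> R" if "x \<in> ?S" for x using that by (simp add: qball_def)
  have restrict: "h x * \<phi> x = indicator ?S x * (h x * \<phi> x)" for h :: "'a \<Rightarrow> complex" and x
    using supp[of x] by (auto split: split_indicator)
  have avg_eq: "avg k \<phi> = (\<lambda>y. \<integral>x. indicator ?S x * (P k x y * \<phi> x) \<partial>\<mu>)"
    unfolding avg_def using restrict[of "\<lambda>x. P k x _"] by (intro ext Bochner_Integration.integral_cong) auto
  show avgG: "avg k \<phi> \<in> G\<eta>"
    unfolding avg_eq using \<phi>L L K inS Sfin
    by (intro test_spaceI[OF test_bound_integral[where L=L and K=K]]) auto
  have fK: "cmod (?f x) \<le> C * K" if "x \<in> ?S" for x by (intro C(2) P_in_G0 K inS that)
  let ?W = "measure \<mu> ?S"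
  have W: "0 < ?W" using V_pos[of R x0] R by (simp add: Vol_def)
  have P\<phi>: "cmod (P k x y * \<phi> x) \<le> K * sz x0 1 \<gamma> y * L" if "x \<in> ?S" for x y
    unfolding norm_mult using K(2)[OF inS[OF that]] \<phi>L K(1) unfolding test_bound_def by (intro mult_mono) auto
  have iP: "integrable \<mu> (\<lambda>x. indicator ?S x * (P k x y * \<phi> x))" for y
    using P\<phi> K L by (intro bounded_on_finite_set(1)[OF S Sfin]) auto
  have f\<phi>: "cmod (?f x * \<phi> x) \<le> C * K * L" if "x \<in> ?S" for x
    unfolding norm_mult using fK[OF that] \<phi>L C(1) K(1) by (intro mult_mono) auto
  have if\<phi>: "integrable \<mu> (\<lambda>x. indicator ?S x * (?f x * \<phi> x))"
    using f\<phi> C K L by (intro bounded_on_finite_set(1)[OF S Sfin]) auto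
  have "cmod (\<Lambda> (avg k \<phi>) - (\<integral>x. ?f x * \<phi> x \<partial>\<mu>)) \<le> 0"
  proof (rule field_le_epsilon)
    fix e :: real assume e: "0 < e"
    \<comment> \<open>After multiplication by \<open>C\<close>, oscillation on the pieces and the
      uncovered remainder cost e/4 each, so each of the two comparisons costs e/2.\<close>
    define \<tau> where "\<tau> = e / (4 * C * L * ?W)"
    define \<kappa> where "\<kappa> = e / (4 * C * K * L)"
    have \<tau>: "0 < \<tau>" using e C L W by (simp add: \<tau>_def)
    have \<kappa>: "0 < \<kappa>" using e C K L by (simp add: \<kappa>_def)
    obtain \<rho> where \<rho>: "\<rho> > 0" "\<And>x x'. d x0 x \<le> R \<Longrightarrow> d x0 x' \<le> R \<Longrightarrow> d x x' < \<rho> \<Longrightarrow> tb x0 1 \<beta> \<gamma> (\<lambda>y. P k x y - P k x' y) \<tau>"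
      using P_modulus[OF R0 \<tau>, of k] by metis
    have "0 < R" using R by simp
    from fine_partition[OF this \<rho>(1) \<kappa>, of x0] obtain n A c where
      Ac: "\<And>i. i < n \<Longrightarrow> A i \<in> sets \<mu>" "\<And>i. i < n \<Longrightarrow> A i \<subseteq> ?S" "\<And>i. i < n \<Longrightarrow> c i \<in> ?S"
        "\<And>i x. i < n \<Longrightarrow> x \<in> A i \<Longrightarrow> d x (c i) < \<rho>"
      and disj: "disjoint_family_on A {..<n::nat}" and rest: "measure \<mu> (?S - (\<Union>i<n. A i)) < \<kappa>"
      by metis
    let ?U = "?S - (\<Union>i<n. A i)"
    have UA: "(\<Union>i<n. A i) \<in> sets \<mu>" using Ac(1) by (intro sets.finite_UN) auto
    have U [measurable]: "?U \<in> sets \<mu>" using UA by auto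
    have Ufin: "emeasure \<mu> ?U < \<infinity>" by (intro sub_fin U) auto
    have Afin: "emeasure \<mu> (A i) < \<infinity>" if "i < n" for i using Ac that by (intro sub_fin) auto
    have Asum: "(\<Sum>i<n. measure \<mu> (A i)) \<le> ?W"
    proof -
      have "(\<Sum>i<n. measure \<mu> (A i)) = measure \<mu> (\<Union>i<n. A i)"
        using Ac(1) disj Afin by (intro measure_finite_Union[symmetric]) (auto simp: less_top)
      also have "\<dots> \<le> ?W" using Ac(2) UA Sfin by (intro measure_mono_fmeasurable) (auto simp: fmeasurable_def)
      finally show ?thesis .
    qed
    define w where "w = (\<lambda>i. \<integral>x. indicator (A i) x * \<phi> x \<partial>\<mu>)"
    define S' where "S' = (\<lambda>y. \<Sum>i<n. w i * P k (c i) y)"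
    have S': "S' \<in> G0" "\<Lambda> S' = (\<Sum>i<n. w i * ?f (c i))"
    proof -
      have "(\<lambda>y. w i * P k (c i) y) \<in> G0" for i by (intro test0_cmult P_in_G0)
      with \<D>_sum[OF \<Lambda> finite_lessThan, of n "\<lambda>i y. w i * P k (c i) y"] \<D>_cmult[OF \<Lambda> P_in_G0]
      show "S' \<in> G0" "\<Lambda> S' = (\<Sum>i<n. w i * ?f (c i))" by (simp_all add: S'_def)
    qed
    \<comment> \<open>Stated for a general integrand \<open>h\<close> because it is used twice: with
      \<open>P k x y\<close> for fixed \<open>y\<close>, and with the values of \<Lambda> on the
      kernels.\<close>
    have split: "(\<integral>x. indicator ?S x * (h x * \<phi> x) \<partial>\<mu>) - (\<Sum>i<n. w i * h (c i))
        = (\<Sum>i<n. \<integral>x. indicator (A i) x * ((h x - h (c i)) * \<phi> x) \<partial>\<mu>) + (\<integral>x. indicator ?U x * (h x * \<phi> x) \<partial>\<mu>)"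
      if [measurable]: "h \<in> borel_measurable \<mu>" and hM: "\<And>x. x \<in> ?S \<Longrightarrow> cmod (h x) \<le> M" for h M
    proof -
      have M: "0 \<le> M"
        by (rule order_trans[OF norm_ge_zero hM[of x0]]) (use R in \<open>simp add: qball_def\<close>)
      have b: "cmod (h x * \<phi> x) \<le> M * L" if "x \<in> ?S" for x
        unfolding norm_mult using hM[OF that] \<phi>L M by (intro mult_mono) auto
      have i: "integrable \<mu> (\<lambda>x. indicator T x * (h x * \<phi> x))" "integrable \<mu> (\<lambda>x. indicator T x * \<phi> x)"
        if T: "T \<in> sets \<mu>" "T \<subseteq> ?S" for T
      proof -
        show "integrable \<mu> (\<lambda>x. indicator T x * (h x * \<phi> x))"
          using b L M T by (intro bounded_on_finite_set(1)[where K="M * L"] sub_fin) auto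
        show "integrable \<mu> (\<lambda>x. indicator T x * \<phi> x)"
          using \<phi>L L T by (intro bounded_on_finite_set(1)[where K=L] sub_fin) auto
      qed
      have "(\<integral>x. indicator (A j) x * (h x * \<phi> x) \<partial>\<mu>) - w j * h (c j) = (\<integral>x. indicator (A j) x * ((h x - h (c j)) * \<phi> x) \<partial>\<mu>)"
        if j: "j < n" for j
      proof -
        have "w j * h (c j) = (\<integral>x. indicator (A j) x * \<phi> x * h (c j) \<partial>\<mu>)" unfolding w_def by simp
        then have "(\<integral>x. indicator (A j) x * (h x * \<phi> x) \<partial>\<mu>) - w j * h (c j)
           = (\<integral>x. indicator (A j) x * (h x * \<phi> x) - indicator (A j) x * \<phi> x * h (c j) \<partial>\<mu>)"
          using i[OF Ac(1)[OF j] Ac(2)[OF j]] by (simp only:) (intro Bochner_Integration.integral_diff[symmetric] integrable_mult_left)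
        also have "\<dots> = (\<integral>x. indicator (A j) x * ((h x - h (c j)) * \<phi> x) \<partial>\<mu>)"
          by (rule Bochner_Integration.integral_cong) (auto simp: algebra_simps)
        finally show ?thesis .
      qed
      then have "(\<Sum>j<n. \<integral>x. indicator (A j) x * (h x * \<phi> x) \<partial>\<mu>) - (\<Sum>j<n. w j * h (c j))
          = (\<Sum>j<n. \<integral>x. indicator (A j) x * ((h x - h (c j)) * \<phi> x) \<partial>\<mu>)"
        by (simp add: sum_subtractf[symmetric])
      then show ?thesis
        using integral_partition[OF Ac(1,2) disj S i(1)[OF S order_refl]] by (simp add: algebra_simps)
    qed
    let ?T = "\<tau> * L * ?W + K * L * \<kappa>"
    have T0: "0 < ?T" using \<tau> L W K \<kappa> by (intro add_pos_pos mult_pos_pos)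
    have CT: "C * ?T = e / 2"
      using C K L W by (simp add: \<tau>_def \<kappa>_def field_simps)
    have "tb x0 1 \<beta> \<gamma> (\<lambda>y. avg k \<phi> y - S' y) ((\<Sum>i<n. \<tau> * L * measure \<mu> (A i)) + K * L * measure \<mu> ?U)"
    proof -
      have "(\<lambda>y. avg k \<phi> y - S' y) = (\<lambda>y. (\<Sum>i<n. \<integral>x. indicator (A i) x * ((P k x y - P k (c i) y) * \<phi> x) \<partial>\<mu>)
          + (\<integral>x. indicator ?U x * (P k x y * \<phi> x) \<partial>\<mu>))"
      proof
        fix y
        have "cmod (P k x y) \<le> K * sz x0 1 \<gamma> y" if "x \<in> ?S" for x
          using K(2)[OF inS[OF that]] unfolding test_bound_def by blast
        from split[OF P_measurable1 this] show "avg k \<phi> y - S' y = (\<Sum>i<n. \<integral>x. indicator (A i) x * ((P k x y - P k (c i) y) * \<phi> x) \<partial>\<mu>)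
          + (\<integral>x. indicator ?U x * (P k x y * \<phi> x) \<partial>\<mu>)"
          by (simp only: avg_eq S'_def)
      qed
      moreover have "tb x0 1 \<beta> \<gamma> (\<lambda>y. \<integral>x. indicator (A i) x * ((P k x y - P k (c i) y) * \<phi> x) \<partial>\<mu>) (\<tau> * L * measure \<mu> (A i))"
        if "i < n" for i
        using Ac[OF that] Afin[OF that] \<phi>L L \<tau> \<rho>(2) inS by (intro test_bound_integral) auto
      moreover have "tb x0 1 \<beta> \<gamma> (\<lambda>y. \<integral>x. indicator ?U x * (P k x y * \<phi> x) \<partial>\<mu>) (K * L * measure \<mu> ?U)"
        using Ufin \<phi>L L K inS by (intro test_bound_integral) auto
      ultimately show ?thesis
        by (simp only:) (intro test_bound_add test_bound_sum, auto)
    qed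
    moreover have "(\<Sum>i<n. \<tau> * L * measure \<mu> (A i)) + K * L * measure \<mu> ?U \<le> ?T"
      unfolding sum_distrib_left[symmetric] using Asum rest \<tau> L K by (intro add_mono mult_left_mono) auto
    ultimately have "tb x0 1 \<beta> \<gamma> (\<lambda>y. avg k \<phi> y - S' y) ?T" by (rule test_bound_mono) simp
    then have "cmod (\<Lambda> (\<lambda>y. avg k \<phi> y - S' y)) \<le> C * ?T"
      by (intro C(2) test0_diff G\<eta>_test0[OF avgG] S'(1) T0)
    then have 1: "cmod (\<Lambda> (avg k \<phi>) - \<Lambda> S') \<le> e / 2"
      using CT \<D>_diff[OF \<Lambda> G\<eta>_test0[OF avgG] S'(1)] by simp
    have "(\<integral>x. ?f x * \<phi> x \<partial>\<mu>) = (\<integral>x. indicator ?S x * (?f x * \<phi> x) \<partial>\<mu>)"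
      using restrict[of ?f] by (intro Bochner_Integration.integral_cong) auto
    then have "(\<integral>x. ?f x * \<phi> x \<partial>\<mu>) - \<Lambda> S' = (\<Sum>i<n. \<integral>x. indicator (A i) x * ((?f x - ?f (c i)) * \<phi> x) \<partial>\<mu>) + (\<integral>x. indicator ?U x * (?f x * \<phi> x) \<partial>\<mu>)"
      using split[OF fm fK] by (simp only: S'(2))
    also have "cmod \<dots> \<le> (\<Sum>i<n. C * \<tau> * L * measure \<mu> (A i)) + C * K * L * measure \<mu> ?U"
    proof (rule norm_triangle_le, rule add_mono)
      show "cmod (\<Sum>i<n. \<integral>x. indicator (A i) x * ((?f x - ?f (c i)) * \<phi> x) \<partial>\<mu>) \<le> (\<Sum>i<n. C * \<tau> * L * measure \<mu> (A i))"
      proof (rule sum_norm_le)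
        fix i assume "i \<in> {..<n}"
        then have i: "i < n" by simp
        show "cmod (\<integral>x. indicator (A i) x * ((?f x - ?f (c i)) * \<phi> x) \<partial>\<mu>) \<le> C * \<tau> * L * measure \<mu> (A i)"
        proof (rule bounded_on_finite_set(2)[OF Ac(1)[OF i] Afin[OF i]])
          fix x assume x: "x \<in> A i"
          have "tb x0 1 \<beta> \<gamma> (\<lambda>y. P k x y - P k (c i) y) \<tau>"
            using Ac(2-4)[OF i] x inS by (intro \<rho>(2)) auto
          then have "cmod (\<Lambda> (\<lambda>y. P k x y - P k (c i) y)) \<le> C * \<tau>" by (intro C(2) test0_diff P_in_G0 \<tau>)
          then have "cmod (?f x - ?f (c i)) \<le> C * \<tau>" by (simp add: \<D>_diff[OF \<Lambda> P_in_G0 P_in_G0])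
          then show "cmod ((?f x - ?f (c i)) * \<phi> x) \<le> C * \<tau> * L"
            unfolding norm_mult using \<phi>L C(1) \<tau> by (intro mult_mono) auto
        qed (use C \<tau> L in auto)
      qed
      show "cmod (\<integral>x. indicator ?U x * (?f x * \<phi> x) \<partial>\<mu>) \<le> C * K * L * measure \<mu> ?U"
        using f\<phi> C K L by (intro bounded_on_finite_set(2)[OF U Ufin]) auto
    qed
    also have "\<dots> = C * (\<tau> * L * (\<Sum>i<n. measure \<mu> (A i)) + K * L * measure \<mu> ?U)"
      by (simp only: sum_distrib_left distrib_left mult.assoc)
    also have "\<dots> \<le> C * ?T"
      using Asum rest \<tau> L K C by (intro mult_left_mono add_mono) auto
    finally have 2: "cmod ((\<integral>x. ?f x * \<phi> x \<partial>\<mu>) - \<Lambda> S') \<le> e / 2" using CT by simp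
    show "cmod (\<Lambda> (avg k \<phi>) - (\<integral>x. ?f x * \<phi> x \<partial>\<mu>)) \<le> 0 + e"
      using 1 2 norm_triangle_ineq4[of "\<Lambda> (avg k \<phi>) - \<Lambda> S'" "(\<integral>x. ?f x * \<phi> x \<partial>\<mu>) - \<Lambda> S'"] by simp
  qed
  then show "\<Lambda> (avg k \<phi>) = (\<integral>x. ?f x * \<phi> x \<partial>\<mu>)" by simp
qed

end

section \<open>Representation of distributions and comparison of the maximal functions\<close>

lemma eLp_norm_cong_AE:
  assumes "g \<in> borel_measurable M" "h \<in> borel_measurable M" and ae: "AE x in M. g x = h x"
  shows "eLp_norm M p g = eLp_norm M p h"
proof -
  have "esssup M g = esssup M h" using ae by (rule esssup_AE_cong[OF assms(1,2)])
  moreover have "(\<integral>\<^sup>+ x. epowr (g x) (enn2real p) \<partial>M) = (\<integral>\<^sup>+ x. epowr (h x) (enn2real p) \<partial>M)"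
    using ae by (intro nn_integral_cong_AE) (auto elim!: eventually_mono)
  ultimately show ?thesis by (simp add: eLp_norm_def)
qed

context ati
begin

lemma radial_max_measurable [measurable]:
  assumes "\<Lambda> \<in> \<D>"
  shows "radial_max P \<Lambda> \<in> borel_measurable \<mu>"
proof -
  have [measurable]: "(\<lambda>x. \<Lambda> (P k x)) \<in> borel_measurable \<mu>" for k
    by (intro measurable_continuous distribution_kernel_continuous assms)
  have "(\<lambda>x. SUP k. ennreal (cmod (\<Lambda> (P k x)))) \<in> borel_measurable \<mu>"
    by (intro borel_measurable_SUP) auto
  then show ?thesis by (simp add: radial_max_def[abs_def])
qed

theorem radial_representation:
  assumes \<Lambda>: "\<Lambda> \<in> \<D>" and p: "1 < p" and fin: "upper_Lp_norm \<mu> p (radial_max P \<Lambda>) < \<infinity>"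
  shows "\<exists>f \<in> Lp_space \<mu> p. (\<forall>\<phi>\<in>G0. \<Lambda> \<phi> = (\<integral>x. f x * \<phi> x \<partial>\<mu>)) \<and>
    Lp_norm \<mu> p f \<le> upper_Lp_norm \<mu> p (radial_max P \<Lambda>)"
proof -
  define h where "h = radial_max P \<Lambda>"
  have hm [measurable]: "h \<in> borel_measurable \<mu>" unfolding h_def by (rule radial_max_measurable[OF \<Lambda>])
  have up: "upper_Lp_norm \<mu> p (radial_max P \<Lambda>) = eLp_norm \<mu> p h"
    unfolding h_def by (rule upper_Lp_norm_measurable[OF radial_max_measurable[OF \<Lambda>]])
  have hfin: "eLp_norm \<mu> p h < \<infinity>" using fin up by simp
  \<comment> \<open>\<open>enn2real\<close> sends \<infinity> to 0, so \<open>H\<close> represents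
    \<open>h\<close> only where \<open>h\<close> is finite, which is almost everywhere.\<close>
  define H where "H = (\<lambda>x. complex_of_real (enn2real (h x)))"
  have H [measurable]: "H \<in> borel_measurable \<mu>" unfolding H_def by measurable
  have Hh: "ennreal (cmod (H x)) \<le> h x" for x by (simp add: H_def ennreal_enn2real_if)
  have HLp: "H \<in> Lp_space \<mu> p"
    using hfin eLp_norm_mono[of "\<lambda>x. ennreal (cmod (H x))" \<mu> h p] Hh
    by (auto simp: Lp_space_def Lp_norm_def intro: le_less_trans)
  define f where "f = (\<lambda>n x. \<Lambda> (P (int n) x))"
  have fm [measurable]: "f n \<in> borel_measurable \<mu>" for n
    unfolding f_def by (intro measurable_continuous distribution_kernel_continuous \<Lambda>)
  have fh: "ennreal (cmod (f n x)) \<le> h x" for n x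
    unfolding f_def h_def radial_max_def by (intro SUP_upper) simp
  \<comment> \<open>The case distinction bounds the quotient by 1 at every point. Where
    \<open>h\<close> is finite it is the true quotient, with 0/0 = 0 where \<open>H\<close>
    vanishes.\<close>
  define u where "u = (\<lambda>n x. if cmod (f n x) \<le> cmod (H x) then f n x / H x else 0)"
  have um: "u n \<in> borel_measurable \<mu>" for n unfolding u_def by measurable
  have u1: "cmod (u n x) \<le> 1" for n x
    by (auto simp: u_def norm_divide divide_le_eq_1)
  obtain F g where Fg: "F \<noteq> bot \<and> F \<le> sequentially \<and> g \<in> borel_measurable \<mu> \<and> (\<forall>x. cmod (g x) \<le> 1) \<and>
    (\<forall>\<psi> :: 'a \<Rightarrow> complex. integrable \<mu> \<psi> \<longrightarrow> ((\<lambda>n. \<integral>x. u n x * \<psi> x \<partial>\<mu>) \<longlongrightarrow> (\<integral>x. g x * \<psi> x \<partial>\<mu>)) F)"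
    using weak_star_cluster[of u, OF um u1] by (elim exE) (rule that)
  have F: "F \<noteq> bot" "F \<le> sequentially" and gm [measurable]: "g \<in> borel_measurable \<mu>"
    and g1: "\<And>x. cmod (g x) \<le> 1"
    and lim: "\<And>\<psi> :: 'a \<Rightarrow> complex. integrable \<mu> \<psi> \<Longrightarrow> ((\<lambda>n. \<integral>x. u n x * \<psi> x \<partial>\<mu>) \<longlongrightarrow> (\<integral>x. g x * \<psi> x \<partial>\<mu>)) F"
    using Fg by simp_all
  define f' where "f' = (\<lambda>x. g x * H x)"
  have f'm [measurable]: "f' \<in> borel_measurable \<mu>" unfolding f'_def by measurable
  have f'H: "cmod (f' x) \<le> cmod (H x)" for x
    unfolding f'_def norm_mult using g1[of x] by (intro mult_left_le_one_le) auto
  have f'h: "ennreal (cmod (f' x)) \<le> h x" for x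
    using ennreal_leI[OF f'H[of x]] Hh[of x] by (rule order_trans)
  have norm: "Lp_norm \<mu> p f' \<le> eLp_norm \<mu> p h"
    unfolding Lp_norm_def by (intro eLp_norm_mono f'h) measurable
  then have f'Lp: "f' \<in> Lp_space \<mu> p" using hfin by (auto simp: Lp_space_def intro: le_less_trans)
  have compact_case: "\<Lambda> \<phi> = (\<integral>x. f' x * \<phi> x \<partial>\<mu>)"
    if \<phi>: "0 < L" "1 \<le> R" "\<And>y. cmod (\<phi> y) \<le> L" "\<And>y. y \<notin> B x0 R \<Longrightarrow> \<phi> y = 0"
      "\<And>y z. cmod (\<phi> y - \<phi> z) \<le> L * d y z powr \<eta>" for \<phi> L R
  proof -
    have \<phi>G: "\<phi> \<in> G0" using \<phi> by (intro G\<eta>_test0 bump_in_G\<eta>[where L=L and R=R]) auto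
    have [measurable]: "\<phi> \<in> borel_measurable \<mu>" by (rule \<phi>_measurable[OF \<phi>])
    have "(\<lambda>n. \<Lambda> (avg (int n) \<phi>)) \<longlonglongrightarrow> \<Lambda> \<phi>"
    proof (rule tendstoI)
      fix e :: real assume e: "0 < e"
      obtain C where C: "0 < C" "\<And>\<phi> \<tau>. \<phi> \<in> G0 \<Longrightarrow> 0 < \<tau> \<Longrightarrow> tb x0 1 \<beta> \<gamma> \<phi> \<tau> \<Longrightarrow> cmod (\<Lambda> \<phi>) \<le> C * \<tau>"
        using \<D>_bound[OF \<Lambda>] by metis
      define \<tau> where "\<tau> = e / (2 * C)"
      have \<tau>: "0 < \<tau>" using e C by (simp add: \<tau>_def)
      obtain n0 where n0: "\<And>n. n \<ge> n0 \<Longrightarrow> tb x0 1 \<beta> \<gamma> (\<lambda>y. avg (int n) \<phi> y - \<phi> y) \<tau>"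
        using avg_converges[OF \<phi> \<tau>] by metis
      have "dist (\<Lambda> (avg (int n) \<phi>)) (\<Lambda> \<phi>) < e" if "n \<ge> n0" for n
      proof -
        have aG: "avg (int n) \<phi> \<in> G0" by (intro G\<eta>_test0 distribution_avg(1)[OF \<Lambda> \<phi>])
        have "cmod (\<Lambda> (\<lambda>y. avg (int n) \<phi> y - \<phi> y)) \<le> C * \<tau>"
          by (intro C(2) test0_diff aG \<phi>G \<tau> n0 that)
        also have "\<dots> < e" using e C by (simp add: \<tau>_def)
        finally show ?thesis by (simp add: dist_norm \<D>_diff[OF \<Lambda> aG \<phi>G])
      qed
      then show "\<forall>\<^sub>F n in sequentially. dist (\<Lambda> (avg (int n) \<phi>)) (\<Lambda> \<phi>) < e"
        by (intro eventually_sequentiallyI[of n0]) simp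
    qed
    then have lim1: "((\<lambda>n. \<Lambda> (avg (int n) \<phi>)) \<longlongrightarrow> \<Lambda> \<phi>) F"
      using F(2) by (rule filterlim_mono[OF _ order_refl])
    \<comment> \<open>This product is the L^1 function on which weak-star convergence is
      tested.\<close>
    have iH: "integrable \<mu> (\<lambda>x. H x * \<phi> x)" by (rule test0_integrable[OF HLp p \<phi>G])
    have "\<Lambda> (avg (int n) \<phi>) = (\<integral>x. u n x * (H x * \<phi> x) \<partial>\<mu>)" for n
    proof -
      have "\<Lambda> (avg (int n) \<phi>) = (\<integral>x. f n x * \<phi> x \<partial>\<mu>)"
        unfolding f_def by (rule distribution_avg(2)[OF \<Lambda> \<phi>])
      also have "\<dots> = (\<integral>x. u n x * (H x * \<phi> x) \<partial>\<mu>)"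
      proof (rule integral_cong_AE)
        show "AE x in \<mu>. f n x * \<phi> x = u n x * (H x * \<phi> x)"
          using eLp_norm_finite_AE[OF hm hfin]
        proof eventually_elim
          case (elim x)
          then have "h x = ennreal (cmod (H x))" by (simp add: H_def ennreal_enn2real)
          then have le: "cmod (f n x) \<le> cmod (H x)" using fh[of n x] by simp
          then show ?case by (cases "H x = 0") (auto simp: u_def)
        qed
      qed (use um in measurable)
      finally show ?thesis .
    qed
    then have "((\<lambda>n. \<integral>x. u n x * (H x * \<phi> x) \<partial>\<mu>) \<longlongrightarrow> \<Lambda> \<phi>) F" using lim1 by simp
    moreover have "((\<lambda>n. \<integral>x. u n x * (H x * \<phi> x) \<partial>\<mu>) \<longlongrightarrow> (\<integral>x. f' x * \<phi> x \<partial>\<mu>)) F"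
      using lim[OF iH] by (simp add: f'_def mult.assoc)
    ultimately show ?thesis by (rule tendsto_unique[OF F(1)])
  qed
  have "\<Lambda> \<phi> = (\<integral>x. f' x * \<phi> x \<partial>\<mu>)" if \<phi>: "\<phi> \<in> G0" for \<phi>
  proof -
    \<comment> \<open>Both sides are bounded functionals on \<open>test0\<close>, so agreement on
      boundedly supported Hoelder functions extends by density.\<close>
    have D': "dist_of f' \<in> \<D>" by (rule induced_distribution_in[OF f'Lp p])
    obtain C1 where C1: "0 < C1" "\<And>\<phi> \<tau>. \<phi> \<in> G0 \<Longrightarrow> 0 < \<tau> \<Longrightarrow> tb x0 1 \<beta> \<gamma> \<phi> \<tau> \<Longrightarrow> cmod (\<Lambda> \<phi>) \<le> C1 * \<tau>"
      using \<D>_bound[OF \<Lambda>] by metis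
    obtain C2 where C2: "0 < C2" "\<And>\<phi> \<tau>. \<phi> \<in> G0 \<Longrightarrow> 0 < \<tau> \<Longrightarrow> tb x0 1 \<beta> \<gamma> \<phi> \<tau> \<Longrightarrow> cmod (dist_of f' \<phi>) \<le> C2 * \<tau>"
      using \<D>_bound[OF D'] by metis
    have "cmod (\<Lambda> \<phi> - dist_of f' \<phi>) \<le> 0"
    proof (rule field_le_epsilon)
      fix e :: real assume e: "0 < e"
      define \<tau> where "\<tau> = e / (C1 + C2)"
      have \<tau>: "0 < \<tau>" using e C1 C2 by (simp add: \<tau>_def)
      then have \<tau>2: "0 < \<tau> / 2" by simp
      obtain \<phi>1 where \<phi>1: "\<phi>1 \<in> G\<eta>" "tb x0 1 \<beta> \<gamma> (\<lambda>x. \<phi> x - \<phi>1 x) (\<tau> / 2)"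
        using test0_approx[OF \<phi> \<tau>2] by metis
      obtain \<phi>2 L R where \<phi>2': "0 < L \<and> 1 \<le> R \<and> (\<forall>y. cmod (\<phi>2 y) \<le> L) \<and> (\<forall>y. y \<notin> B x0 R \<longrightarrow> \<phi>2 y = 0) \<and>
        (\<forall>y z. cmod (\<phi>2 y - \<phi>2 z) \<le> L * d y z powr \<eta>) \<and> tb x0 1 \<beta> \<gamma> (\<lambda>y. \<phi>1 y - \<phi>2 y) (\<tau> / 2)"
        using truncation[OF \<phi>1(1) \<tau>2] by (elim exE) (rule that)
      have \<phi>2: "0 < L" "1 \<le> R" "\<And>y. cmod (\<phi>2 y) \<le> L" "\<And>y. y \<notin> B x0 R \<Longrightarrow> \<phi>2 y = 0"
        "\<And>y z. cmod (\<phi>2 y - \<phi>2 z) \<le> L * d y z powr \<eta>" and t2: "tb x0 1 \<beta> \<gamma> (\<lambda>y. \<phi>1 y - \<phi>2 y) (\<tau> / 2)"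
        using \<phi>2' by simp_all
      have \<phi>2G: "\<phi>2 \<in> G0" using \<phi>2 by (intro G\<eta>_test0 bump_in_G\<eta>[where L=L and R=R]) auto
      have t: "tb x0 1 \<beta> \<gamma> (\<lambda>x. \<phi> x - \<phi>2 x) \<tau>"
        using test_bound_add[OF \<phi>1(2) t2] by simp
      have "\<Lambda> \<phi>2 = dist_of f' \<phi>2"
        using compact_case[OF \<phi>2] \<phi>2G by (simp add: induced_distribution_def)
      then have "\<Lambda> \<phi> - dist_of f' \<phi> = \<Lambda> (\<lambda>x. \<phi> x - \<phi>2 x) - dist_of f' (\<lambda>x. \<phi> x - \<phi>2 x)"
        by (simp add: \<D>_diff[OF \<Lambda> \<phi> \<phi>2G] \<D>_diff[OF D' \<phi> \<phi>2G])
      also have "cmod \<dots> \<le> C1 * \<tau> + C2 * \<tau>"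
        using C1(2)[OF test0_diff[OF \<phi> \<phi>2G] \<tau> t] C2(2)[OF test0_diff[OF \<phi> \<phi>2G] \<tau> t]
          norm_triangle_ineq4[of "\<Lambda> (\<lambda>x. \<phi> x - \<phi>2 x)" "dist_of f' (\<lambda>x. \<phi> x - \<phi>2 x)"] by linarith
      also have "\<dots> = (C1 + C2) * \<tau>" by (simp add: distrib_right)
      also have "\<dots> = e" using C1 C2 by (simp add: \<tau>_def)
      finally show "cmod (\<Lambda> \<phi> - dist_of f' \<phi>) \<le> 0 + e" by simp
    qed
    then show ?thesis using \<phi> by (simp add: induced_distribution_def)
  qed
  then show ?thesis using f'Lp norm unfolding up by (intro bexI[of _ f']) auto
qed

section \<open>Comparison of the maximal functions and norms\<close>

lemma nontangential_le_grand:
  assumes "0 < \<theta>"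
  shows "\<exists>C>0. \<forall>\<Lambda>\<in>\<D>. \<forall>x. nontangential_max d \<delta> P \<theta> \<Lambda> x \<le> ennreal C * grand_max d \<mu> A0 x0 \<eta> \<beta> \<gamma> \<Lambda> x"
proof -
  have "0 \<le> \<theta>" "\<beta> \<le> \<eta>" "\<gamma> \<le> 1" using assms \<beta> \<gamma> \<eta> by auto
  then obtain C where C: "0 < C" "\<And>k w x. d w x \<le> \<theta> * \<delta> powi k \<Longrightarrow> tb w (\<delta> powi k) \<beta> \<gamma> (P k x) C"
    using P_test_bound_scaled[of \<theta> \<beta> \<gamma>] \<beta>(1) \<gamma>(1) by metis
  have "nontangential_max d \<delta> P \<theta> \<Lambda> x \<le> ennreal C * grand_max d \<mu> A0 x0 \<eta> \<beta> \<gamma> \<Lambda> x" if \<Lambda>: "\<Lambda> \<in> \<D>" for \<Lambda> x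
    unfolding nontangential_max_def
  proof (intro SUP_least)
    fix k y assume "y \<in> B x (\<theta> * \<delta> powi k)"
    then have "d x y \<le> \<theta> * \<delta> powi k" by (simp add: qball_def)
    then have t: "tb x (\<delta> powi k) \<beta> \<gamma> (P k y) C" by (rule C(2))
    \<comment> \<open>Rescales the kernel to norm at most 1 around \<open>x\<close>, which makes it
      admissible in the grand maximal function.\<close>
    define c where "c = complex_of_real (1 / C)"
    have c: "cmod c * C = 1" unfolding c_def norm_of_real using C(1) by simp
    define \<phi> where "\<phi> = (\<lambda>z. c * P k y z)"
    have t1: "tb x (\<delta> powi k) \<beta> \<gamma> \<phi> 1" using test_bound_cmult[OF t, of c] unfolding c \<phi>_def .
    have "ennreal (cmod (\<Lambda> \<phi>)) \<le> grand_max d \<mu> A0 x0 \<eta> \<beta> \<gamma> \<Lambda> x"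
      unfolding grand_max_def
    proof (rule SUP_upper, safe)
      show "\<phi> \<in> G0" unfolding \<phi>_def by (intro test0_cmult P_in_G0)
      show "\<exists>r>0. \<phi> \<in> ts x r \<beta> \<gamma> \<and> tn x r \<beta> \<gamma> \<phi> \<le> 1"
        using t1 test_spaceI[OF t1] test_norm_le[OF t1] by (intro exI[of _ "\<delta> powi k"]) simp
    qed
    moreover have "cmod (\<Lambda> \<phi>) = cmod (\<Lambda> (P k y)) / C"
      using \<D>_cmult[OF \<Lambda> P_in_G0, of c k y] C(1) by (simp add: \<phi>_def norm_mult norm_divide c_def)
    ultimately have "ennreal C * ennreal (cmod (\<Lambda> (P k y)) / C) \<le> ennreal C * grand_max d \<mu> A0 x0 \<eta> \<beta> \<gamma> \<Lambda> x"
      by (intro mult_left_mono) auto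
    then show "ennreal (cmod (\<Lambda> (P k y))) \<le> ennreal C * grand_max d \<mu> A0 x0 \<eta> \<beta> \<gamma> \<Lambda> x"
      using C by (simp add: ennreal_mult[symmetric])
  qed
  then show ?thesis using C by blast
qed

lemma radial_le_nontangential:
  assumes "0 < \<theta>"
  shows "radial_max P \<Lambda> x \<le> nontangential_max d \<delta> P \<theta> \<Lambda> x"
  unfolding radial_max_def nontangential_max_def
proof (rule SUP_mono)
  fix k
  have "x \<in> B x (\<theta> * \<delta> powi k)" using assms by (simp add: qball_def)
  then show "\<exists>m\<in>UNIV. ennreal (cmod (\<Lambda> (P k x))) \<le> (SUP y\<in>B x (\<theta> * \<delta> powi m). ennreal (cmod (\<Lambda> (P m y))))"
    by (intro bexI[of _ k] SUP_upper) auto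
qed

lemma grand_le_hl:
  assumes f: "f \<in> Lp_space \<mu> p"
  shows "grand_max d \<mu> A0 x0 \<eta> \<beta> \<gamma> (dist_of f) x \<le> ennreal (2 * size_const \<gamma>) * hl (\<lambda>y. ennreal (cmod (f y))) x"
  unfolding grand_max_def
proof (rule SUP_least, safe)
  fix \<phi> and r :: real assume \<phi>: "\<phi> \<in> G0" and r: "0 < r" "\<phi> \<in> ts x r \<beta> \<gamma>" "tn x r \<beta> \<gamma> \<phi> \<le> 1"
  \<comment> \<open>A norm of at most 1 makes every constant above 1 admissible; 2 is one choice,
    and it reappears in the estimate.\<close>
  have "tb x r \<beta> \<gamma> \<phi> 2" using r by (intro test_norm_lessD) auto
  then have "ennreal (cmod (\<integral>y. f y * \<phi> y \<partial>\<mu>)) \<le> ennreal (2 * size_const \<gamma>) * hl (\<lambda>y. ennreal (cmod (f y))) x"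
    using f r \<beta> \<gamma> by (intro test_pairing_hl[where \<beta>=\<beta> and \<phi>=\<phi> and r=r]) (auto simp: Lp_space_def)
  then show "ennreal (cmod (dist_of f \<phi>)) \<le> ennreal (2 * size_const \<gamma>) * hl (\<lambda>y. ennreal (cmod (f y))) x"
    using \<phi> by (simp add: induced_distribution_def)
qed

theorem grand_Lp_bounded:
  assumes p: "1 < p"
  shows "\<exists>C>0. \<forall>f \<in> Lp_space \<mu> p. upper_Lp_norm \<mu> p (grand_max d \<mu> A0 x0 \<eta> \<beta> \<gamma> (dist_of f)) \<le> ennreal C * Lp_norm \<mu> p f"
proof -
  obtain C where C: "0 < C" "\<And>u. u \<in> borel_measurable \<mu> \<Longrightarrow> eLp_norm \<mu> p (hl u) \<le> ennreal C * eLp_norm \<mu> p u"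
    using hl_Lp_bounded[OF p] by metis
  let ?K = "2 * size_const \<gamma>"
  have K: "0 < ?K" using \<gamma> by (simp add: size_const_pos)
  have "upper_Lp_norm \<mu> p (grand_max d \<mu> A0 x0 \<eta> \<beta> \<gamma> (dist_of f)) \<le> ennreal (?K * C) * Lp_norm \<mu> p f"
    if f: "f \<in> Lp_space \<mu> p" for f
  proof -
    let ?u = "\<lambda>y. ennreal (cmod (f y))"
    have [measurable]: "f \<in> borel_measurable \<mu>" using f by (simp add: Lp_space_def)
    have "upper_Lp_norm \<mu> p (grand_max d \<mu> A0 x0 \<eta> \<beta> \<gamma> (dist_of f)) \<le> ennreal ?K * upper_Lp_norm \<mu> p (hl ?u)"
      by (rule upper_Lp_norm_le_cmult[OF K p grand_le_hl[OF f]])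
    also have "upper_Lp_norm \<mu> p (hl ?u) = eLp_norm \<mu> p (hl ?u)" by (rule upper_Lp_norm_measurable) measurable
    also have "ennreal ?K * eLp_norm \<mu> p (hl ?u) \<le> ennreal ?K * (ennreal C * eLp_norm \<mu> p ?u)"
      by (intro mult_left_mono C(2)) auto
    also have "\<dots> = ennreal (?K * C) * Lp_norm \<mu> p f"
      using K C(1) by (simp add: Lp_norm_def ennreal_mult mult.assoc)
    finally show ?thesis .
  qed
  then show ?thesis using K C by (intro exI[of _ "?K * C"]) auto
qed

text \<open>By uniqueness of the representing function, the function produced by \<open>radial_representation\<close>
  for the distribution of \<open>f\<close> is \<open>f\<close> itself.\<close>

lemma Lp_norm_le_radial:
  assumes f: "f \<in> Lp_space \<mu> p" and p: "1 < p"
  shows "Lp_norm \<mu> p f \<le> upper_Lp_norm \<mu> p (radial_max P (dist_of f))"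
proof (cases "upper_Lp_norm \<mu> p (radial_max P (dist_of f)) < \<infinity>")
  case True
  obtain f' where f': "f' \<in> Lp_space \<mu> p" "\<And>\<phi>. \<phi> \<in> G0 \<Longrightarrow> dist_of f \<phi> = (\<integral>x. f' x * \<phi> x \<partial>\<mu>)"
    "Lp_norm \<mu> p f' \<le> upper_Lp_norm \<mu> p (radial_max P (dist_of f))"
    using radial_representation[OF induced_distribution_in[OF f p] p True] by metis
  have "AE x in \<mu>. f x - f' x = 0"
  proof (rule distribution_determines_function)
    show "(\<lambda>x. f x - f' x) \<in> borel_measurable \<mu>" using f f'(1) by (auto simp: Lp_space_def)
    fix \<phi> assume \<phi>: "\<phi> \<in> G\<eta>"
    have i: "integrable \<mu> (\<lambda>x. f x * \<phi> x)" "integrable \<mu> (\<lambda>x. f' x * \<phi> x)"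
      using test0_integrable[OF f p G\<eta>_test0[OF \<phi>]] test0_integrable[OF f'(1) p G\<eta>_test0[OF \<phi>]] .
    then show "integrable \<mu> (\<lambda>x. (f x - f' x) * \<phi> x)" by (simp add: left_diff_distrib)
    show "(\<integral>x. (f x - f' x) * \<phi> x \<partial>\<mu>) = 0"
      using i f'(2)[OF G\<eta>_test0[OF \<phi>]] G\<eta>_test0[OF \<phi>] by (simp add: left_diff_distrib induced_distribution_def)
  qed
  then have "AE x in \<mu>. ennreal (cmod (f x)) = ennreal (cmod (f' x))" by eventually_elim simp
  then have "Lp_norm \<mu> p f = Lp_norm \<mu> p f'"
    unfolding Lp_norm_def using f f'(1) by (intro eLp_norm_cong_AE) (auto simp: Lp_space_def)
  then have "Lp_norm \<mu> p f \<le> Lp_norm \<mu> p f'" by simp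
  then show ?thesis using f'(3) by (rule order_trans)
qed (simp add: top_unique not_less)

end

theorem theorem3p4:
  fixes d :: "'a::topological_space \<Rightarrow> 'a \<Rightarrow> real"
    and \<mu> :: "'a measure"
    and A0 C\<mu> \<delta> c0 C0 \<eta> \<beta> \<gamma> :: real
    and \<A> :: "int \<Rightarrow> 'i set"
    and z :: "int \<Rightarrow> 'i \<Rightarrow> 'a"
    and x0 :: 'a
    and P :: "int \<Rightarrow> 'a \<Rightarrow> 'a \<Rightarrow> complex"
    and p :: ennreal
  assumes "homogeneous_type_space d \<mu> A0 C\<mu>"
    and "dyadic_points d A0 \<delta> c0 C0 \<A> z"
    and "smoothness_index d \<mu> A0 \<delta> \<A> z \<eta>"
    and "one_exp_ATI d \<mu> \<delta> (Ypts \<A> z) \<eta> P"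
    and "1 < p"
    and "0 < \<beta>" "\<beta> < \<eta>" "0 < \<gamma>" "\<gamma> < \<eta>"
  shows
    "let G0 = test0 d \<mu> A0 x0 \<eta> \<beta> \<gamma>;
         \<D> = distributions d \<mu> A0 x0 \<eta> \<beta> \<gamma>;
         dist = induced_distribution d \<mu> A0 x0 \<eta> \<beta> \<gamma>;
         Mplus = radial_max P;
         Mtheta = nontangential_max d \<delta> P;
         Mstar = grand_max d \<mu> A0 x0 \<eta> \<beta> \<gamma>;
         Lp = Lp_space \<mu> p
     in
       (\<forall>\<Lambda> \<in> Hardy_space \<D> Mplus \<mu> p.
          \<exists>f \<in> Lp. (\<forall>\<phi>\<in>G0. integrable \<mu> (\<lambda>x. f x * \<phi> x) \<and> \<Lambda> \<phi> = (LINT x|\<mu>. f x * \<phi> x)) \<and>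
                   Lp_norm \<mu> p f \<le> upper_Lp_norm \<mu> p (Mplus \<Lambda>)) \<and>
       (\<forall>f \<in> Lp. (\<forall>\<phi>\<in>G0. integrable \<mu> (\<lambda>x. f x * \<phi> x)) \<and> dist f \<in> \<D>) \<and>
       (\<exists>C::real. 0 < C \<and> (\<forall>f \<in> Lp. dist f \<in> Hardy_space \<D> Mstar \<mu> p \<and>
          upper_Lp_norm \<mu> p (Mstar (dist f)) \<le> ennreal C * Lp_norm \<mu> p f)) \<and>
       (\<forall>\<theta>::real. 0 < \<theta> \<longrightarrow>
          Hardy_space \<D> Mplus \<mu> p = Hardy_space \<D> (Mtheta \<theta>) \<mu> p \<and>
          Hardy_space \<D> (Mtheta \<theta>) \<mu> p = Hardy_space \<D> Mstar \<mu> p \<and>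
          Hardy_space \<D> Mstar \<mu> p = dist ` Lp \<and>
          (\<exists>C::real. 0 < C \<and> (\<forall>f \<in> Lp.
             let N = {Lp_norm \<mu> p f, upper_Lp_norm \<mu> p (Mplus (dist f)),
                      upper_Lp_norm \<mu> p (Mtheta \<theta> (dist f)), upper_Lp_norm \<mu> p (Mstar (dist f))}
             in \<forall>s\<in>N. \<forall>t\<in>N. s \<le> ennreal C * t)))"
proof -
  obtain CP \<nu> a where CP: "0 < CP" "0 < \<nu>" "0 < a" "kernel_estimates d \<delta> \<eta> P CP (Eker d \<mu> \<delta> \<nu> a)"
    and P1: "\<And>k x. (LINT y|\<mu>. P k y x) = 1"
    using assms(4) unfolding one_exp_ATI_def by (elim conjE exE) metis
  \<comment> \<open>The dyadic points of all levels; they are dense because the covering radii C0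
    \<delta>^k tend to 0 as k grows.\<close>
  define D where "D = (\<Union>k. z k ` \<A> k)"
  have dy: "0 < \<delta>" "\<delta> < 1" "0 < c0" "c0 \<le> C0" "\<And>k. countable (\<A> k)"
    "\<And>k x. \<exists>\<alpha>\<in>\<A> k. d x (z k \<alpha>) \<le> C0 * \<delta> powi k"
    using assms(2) by (simp_all add: dyadic_points_def)
  have dense: "\<exists>w\<in>D. d x w < r" if r: "0 < r" for x r
  proof -
    have "0 < C0" using dy by linarith
    have "(\<lambda>n. C0 * \<delta> ^ n) \<longlonglongrightarrow> C0 * 0"
      using dy by (intro tendsto_mult tendsto_const LIMSEQ_realpow_zero) auto
    then have "\<forall>\<^sub>F n in sequentially. C0 * \<delta> ^ n < r" using r by (intro order_tendstoD(2)) auto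
    then obtain n where n: "C0 * \<delta> ^ n < r" by (auto simp: eventually_sequentially)
    obtain \<alpha> where "\<alpha> \<in> \<A> (int n)" "d x (z (int n) \<alpha>) \<le> C0 * \<delta> powi int n" using dy(6) by metis
    then show ?thesis using n by (intro bexI[of _ "z (int n) \<alpha>"]) (auto simp: D_def)
  qed
  interpret ati d \<mu> A0 C\<mu> D \<eta> \<beta> \<gamma> x0 \<delta> CP \<nu> a P
  proof
    show "homogeneous_type_space d \<mu> A0 C\<mu>" by (rule assms(1))
    show "countable D" unfolding D_def using dy(5) by simp
    show "0 < \<eta>" "\<eta> < 1" "cutoff_index d A0 \<eta>" using assms(3) by (simp_all add: smoothness_index_def)
  qed (use assms(6-9) dense dy CP P1 in auto)
  let ?Mp = "radial_max P" let ?Mt = "nontangential_max d \<delta> P" let ?Ms = "grand_max d \<mu> A0 x0 \<eta> \<beta> \<gamma>"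
  let ?up = "upper_Lp_norm \<mu> p"
  note p = \<open>1 < p\<close>
  have rep: "\<exists>f \<in> Lp_space \<mu> p. (\<forall>\<phi>\<in>G0. integrable \<mu> (\<lambda>x. f x * \<phi> x) \<and> \<Lambda> \<phi> = (LINT x|\<mu>. f x * \<phi> x)) \<and>
      Lp_norm \<mu> p f \<le> ?up (?Mp \<Lambda>)" if "\<Lambda> \<in> Hardy_space \<D> ?Mp \<mu> p" for \<Lambda>
  proof -
    have "\<Lambda> \<in> \<D>" "?up (?Mp \<Lambda>) < \<infinity>" using that by (simp_all add: Hardy_space_def)
    from radial_representation[OF this(1) p this(2)] show ?thesis using test0_integrable[OF _ p] by metis
  qed
  obtain CS where CS: "0 < CS" "\<And>f. f \<in> Lp_space \<mu> p \<Longrightarrow> ?up (?Ms (dist_of f)) \<le> ennreal CS * Lp_norm \<mu> p f"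
    using grand_Lp_bounded[OF p] by metis
  have grand: "dist_of f \<in> Hardy_space \<D> ?Ms \<mu> p" if f: "f \<in> Lp_space \<mu> p" for f
  proof -
    have "ennreal CS * Lp_norm \<mu> p f < \<infinity>" using f by (simp add: Lp_space_def ennreal_mult_less_top)
    with CS(2)[OF f] have "?up (?Ms (dist_of f)) < \<infinity>" by (rule le_less_trans)
    then show ?thesis using induced_distribution_in[OF f p] by (simp add: Hardy_space_def)
  qed
  have mono: "?up g \<le> ?up g'" if "\<And>x. g x \<le> g' x" for g g' :: "'a \<Rightarrow> ennreal"
    using upper_Lp_norm_le_cmult[of 1 p g g' \<mu>] p that by simp
  have eqv: "Hardy_space \<D> ?Mp \<mu> p = Hardy_space \<D> (?Mt \<theta>) \<mu> p \<and>
      Hardy_space \<D> (?Mt \<theta>) \<mu> p = Hardy_space \<D> ?Ms \<mu> p \<and>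
      Hardy_space \<D> ?Ms \<mu> p = dist_of ` Lp_space \<mu> p \<and>
      (\<exists>C::real. 0 < C \<and> (\<forall>f \<in> Lp_space \<mu> p.
         let N = {Lp_norm \<mu> p f, ?up (?Mp (dist_of f)), ?up (?Mt \<theta> (dist_of f)), ?up (?Ms (dist_of f))}
         in \<forall>s\<in>N. \<forall>t\<in>N. s \<le> ennreal C * t))" if \<theta>: "0 < \<theta>" for \<theta> :: real
  proof -
    obtain CT where CT: "0 < CT" "\<And>\<Lambda> x. \<Lambda> \<in> \<D> \<Longrightarrow> ?Mt \<theta> \<Lambda> x \<le> ennreal CT * ?Ms \<Lambda> x"
      using nontangential_le_grand[OF \<theta>] by metis
    have pt: "?up (?Mp \<Lambda>) \<le> ?up (?Mt \<theta> \<Lambda>)" for \<Lambda>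
      by (intro mono radial_le_nontangential \<theta>)
    have tg: "?up (?Mt \<theta> \<Lambda>) \<le> ennreal CT * ?up (?Ms \<Lambda>)" if "\<Lambda> \<in> \<D>" for \<Lambda>
      using CT that by (intro upper_Lp_norm_le_cmult p) auto
    \<comment> \<open>The equality of the four spaces is obtained from a cycle of
      inclusions.\<close>
    have "Hardy_space \<D> ?Ms \<mu> p \<subseteq> Hardy_space \<D> (?Mt \<theta>) \<mu> p"
    proof
      fix \<Lambda> assume "\<Lambda> \<in> Hardy_space \<D> ?Ms \<mu> p"
      then have \<Lambda>: "\<Lambda> \<in> \<D>" "?up (?Ms \<Lambda>) < \<infinity>" by (simp_all add: Hardy_space_def)
      then have "ennreal CT * ?up (?Ms \<Lambda>) < \<infinity>" by (simp add: ennreal_mult_less_top)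
      with tg[OF \<Lambda>(1)] have "?up (?Mt \<theta> \<Lambda>) < \<infinity>" by (rule le_less_trans)
      then show "\<Lambda> \<in> Hardy_space \<D> (?Mt \<theta>) \<mu> p" using \<Lambda> by (simp add: Hardy_space_def)
    qed
    moreover have "Hardy_space \<D> (?Mt \<theta>) \<mu> p \<subseteq> Hardy_space \<D> ?Mp \<mu> p"
      using pt by (auto simp: Hardy_space_def intro: le_less_trans)
    moreover have "Hardy_space \<D> ?Mp \<mu> p \<subseteq> dist_of ` Lp_space \<mu> p"
    proof
      fix \<Lambda> assume \<Lambda>: "\<Lambda> \<in> Hardy_space \<D> ?Mp \<mu> p"
      obtain f where f: "f \<in> Lp_space \<mu> p" "\<And>\<phi>. \<phi> \<in> G0 \<Longrightarrow> \<Lambda> \<phi> = (LINT x|\<mu>. f x * \<phi> x)"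
        using rep[OF \<Lambda>] by metis
      \<comment> \<open>Agreement on \<open>test0\<close> becomes equality of HOL functions because
        both functionals are extensional.\<close>
      have "\<Lambda> \<in> extensional G0" using \<Lambda> by (simp add: Hardy_space_def distributions_def)
      then have "\<Lambda> = dist_of f"
        using f(2) unfolding induced_distribution_def by (intro extensionalityI[of _ G0]) auto
      then show "\<Lambda> \<in> dist_of ` Lp_space \<mu> p" using f(1) by (rule image_eqI)
    qed
    moreover have "dist_of ` Lp_space \<mu> p \<subseteq> Hardy_space \<D> ?Ms \<mu> p" using grand by auto
    moreover have "\<exists>C::real. 0 < C \<and> (\<forall>f \<in> Lp_space \<mu> p.
         let N = {Lp_norm \<mu> p f, ?up (?Mp (dist_of f)), ?up (?Mt \<theta> (dist_of f)), ?up (?Ms (dist_of f))}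
         in \<forall>s\<in>N. \<forall>t\<in>N. s \<le> ennreal C * t)"
    proof (intro exI conjI ballI)
      \<comment> \<open>A path along l \<le> m \<le> t \<le> CT g and g \<le> CS l meets
        \<open>CT\<close> and \<open>CS\<close> at most once each; the maxima with 1 cover every
        partial path.\<close>
      let ?C = "max 1 CT * max 1 CS"
      show "0 < ?C" by (intro mult_pos_pos) auto
      fix f assume f: "f \<in> Lp_space \<mu> p"
      define l m t g where "l = Lp_norm \<mu> p f" and "m = ?up (?Mp (dist_of f))"
        and "t = ?up (?Mt \<theta> (dist_of f))" and "g = ?up (?Ms (dist_of f))"
      have D: "dist_of f \<in> \<D>" by (rule induced_distribution_in[OF f p])
      have 1: "l \<le> m" unfolding l_def m_def by (rule Lp_norm_le_radial[OF f p])
      have 2: "m \<le> t" unfolding m_def t_def by (rule pt)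
      have 3: "t \<le> ennreal CT * g" unfolding t_def g_def by (rule tg[OF D])
      have 4: "g \<le> ennreal CS * l" unfolding g_def l_def by (rule CS(2)[OF f])
      have s: "ennreal c * x \<le> ennreal ?C * x" if "c \<le> ?C" for c x
        using that by (intro mult_right_mono ennreal_leI) auto
      have C1: "1 \<le> ?C" "CS \<le> ?C" "CT * CS \<le> ?C"
      proof -
        show "1 \<le> ?C" using mult_mono[of 1 "max 1 CT" 1 "max 1 CS"] by simp
        show "CS \<le> ?C" using mult_mono[of 1 "max 1 CT" CS "max 1 CS"] CS by simp
        show "CT * CS \<le> ?C" using CS CT by (intro mult_mono) auto
      qed
      have t4: "t \<le> ennreal (CT * CS) * l"
        using order_trans[OF 3 mult_left_mono[OF 4]] CT CS by (simp add: ennreal_mult mult.assoc)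
      have top: "g \<le> ennreal ?C * l" "t \<le> ennreal ?C * l"
        using order_trans[OF 4 s[OF C1(2)]] order_trans[OF t4 s[OF C1(3)]] by auto
      have mg: "x \<le> ennreal CT * g \<or> x = g" and ml: "x \<le> ennreal ?C * l" if "x \<in> {l, m, t, g}" for x
      proof -
        have "l \<le> ennreal CT * g" "m \<le> ennreal CT * g" using order_trans[OF 2 3] order_trans[OF 1 order_trans[OF 2 3]] by auto
        then show "x \<le> ennreal CT * g \<or> x = g" using that 3 by auto
        have "m \<le> ennreal ?C * l" "l \<le> ennreal ?C * l" using order_trans[OF 2 top(2)] s[of 1 l] C1(1) by auto
        then show "x \<le> ennreal ?C * l" using that top by auto
      qed
      have all: "x \<le> ennreal ?C * y" if x: "x \<in> {l, m, t, g}" and y: "y \<in> {l, m, t, g}" for x y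
      proof (cases "y = g")
        case True
        have "CT \<le> ?C" using mult_mono[of CT "max 1 CT" 1 "max 1 CS"] CT by simp
        then have "ennreal CT * g \<le> ennreal ?C * g" "g \<le> ennreal ?C * g" using s[of CT g] s[of 1 g] C1(1) by auto
        then show ?thesis using mg[OF x] True order_trans by blast
      next
        case False
        then have "l \<le> y" using y 1 order_trans[OF 1 2] by auto
        then have "ennreal ?C * l \<le> ennreal ?C * y" by (rule mult_left_mono) simp
        with ml[OF x] show ?thesis by (rule order_trans)
      qed
      show "let N = {Lp_norm \<mu> p f, ?up (?Mp (dist_of f)), ?up (?Mt \<theta> (dist_of f)), ?up (?Ms (dist_of f))}
         in \<forall>s\<in>N. \<forall>t\<in>N. s \<le> ennreal ?C * t"
        unfolding Let_def l_def[symmetric] m_def[symmetric] t_def[symmetric] g_def[symmetric] using all by blast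
    qed
    ultimately show ?thesis by blast
  qed
  have A2: "\<forall>f\<in>Lp_space \<mu> p. (\<forall>\<phi>\<in>G0. integrable \<mu> (\<lambda>x. f x * \<phi> x)) \<and> dist_of f \<in> \<D>"
    using test0_integrable[OF _ p] induced_distribution_in[OF _ p] by auto
  have A3: "\<exists>C::real. 0 < C \<and> (\<forall>f\<in>Lp_space \<mu> p. dist_of f \<in> Hardy_space \<D> ?Ms \<mu> p \<and>
      ?up (?Ms (dist_of f)) \<le> ennreal C * Lp_norm \<mu> p f)"
    using CS grand by (intro exI[of _ CS]) auto
  show ?thesis
    unfolding Let_def
    by (rule conjI[OF ballI[OF rep] conjI[OF A2 conjI[OF A3 allI[OF impI[OF eqv[unfolded Let_def]]]]]])
qed

end
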